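(* Let $n\ge 1$, let $\mathbf{p}=(p_1,\dots,p_n)$ be a tuple of positive integers, let $\mathbb{B}^{\mathbf{p}}\subset\mathbb{C}^n$ be the associated complex ellipsoid, let $u(z)=\log\big(\sum_{j=1}^n|z_j|^{2p_j}\big)$, and let $1\le p<\infty$. Let $f\in H^p_u(\mathbb{B}^{\mathbf{p}})$. Then the radial limit $f^*(\xi)=\lim_{r\to 1^-}f(r\xi)$ exists for $\mu_u$-almost every $\xi\in\partial\mathbb{B}^{\mathbf{p}}$, and $f^*\in L^p(\partial\mathbb{B}^{\mathbf{p}},\mu_u)$.
   Context: The complex ellipsoid is $\mathbb{B}^{\mathbf{p}}=\{z\in\mathbb{C}^n:\ \rho(z)=\sum_{j=1}^n|z_j|^{2p_j}-1<0\}$. The function $u(z)=\log\big(\sum_{j=1}^n|z_j|^{2p_j}\big)$, with values in $[-\infty,0)$ on $\mathbb{B}^{\mathbf{p}}$, is a continuous negative plurisubharmonic exhaustion function of $\mathbb{B}^{\mathbf{p}}$. For $r<0$ put $B_u(r)=\{z\in\mathbb{B}^{\mathbf{p}}:u(z)<r\}$, $S_u(r)=\{z\in\mathbb{B}^{\mathbf{p}}:u(z)=r\}$, $u_r=\max\{u,r\}$, and define the Demailly Monge-Ampère measure $\mu_{u,r}=(dd^cu_r)^n-\chi_{\mathbb{B}^{\mathbf{p}}\setminus B_u(r)}(dd^cu)^n$, a positive measure supported on $S_u(r)$ ($d^c$ is a fixed positive multiple of $i(\bar\partial-\partial)$). For $p>0$ the Poletsky-Stessin Hardy space $H^p_u(\mathbb{B}^{\mathbf{p}})$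 is the set of holomorphic $f$ on $\mathbb{B}^{\mathbf{p}}$ with $\limsup_{r\to0^-}\int_{S_u(r)}|f|^p\,d\mu_{u,r}<\infty$. The measure $\mu_u$ is the boundary Monge-Ampère measure associated with $u$: the weak-* limit of $\mu_{u,r}$ as $r\to 0^-$ (as measures on $\overline{\mathbb{B}^{\mathbf{p}}}$), which is a positive finite measure supported on $\partial\mathbb{B}^{\mathbf{p}}$. *)

theory Defs
  imports "HOL-Analysis.Analysis"
begin

section \<open>Functions on complex n-space\<close>

text \<open>Complex Frechet differentiability: the real derivative exists and is complex linear.\<close>

definition holomorphic_cn :: "(complex ^ 'n \<Rightarrow> complex) \<Rightarrow> (complex ^ 'n) set \<Rightarrow> bool" where
  "holomorphic_cn f \<Omega> \<longleftrightarrow>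
     (\<forall>z\<in>\<Omega>. \<exists>L. (f has_derivative L) (at z) \<and> (\<forall>a v. L (a *s v) = a * L v))"

text \<open>\<open>Ck k f\<close>: all iterated real directional derivatives of order at most \<open>k\<close> exist and are
  continuous.\<close>

primrec Ck :: "nat \<Rightarrow> (complex ^ 'n \<Rightarrow> complex) \<Rightarrow> bool" where
  "Ck 0 f \<longleftrightarrow> continuous_on UNIV f"
| "Ck (Suc k) f \<longleftrightarrow>
     (\<forall>z. f differentiable (at z)) \<and> (\<forall>v. Ck k (\<lambda>z. frechet_derivative f (at z) v))"

definition Cc :: "(complex ^ 'n) set \<Rightarrow> (complex ^ 'n \<Rightarrow> complex) set" where
  "Cc \<Omega> = {\<phi>. continuous_on UNIV \<phi> \<and>
     compact (closure {z. \<phi> z \<noteq> 0}) \<and> closure {z. \<phi> z \<noteq> 0} \<subseteq> \<Omega>}"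

definition test_functions :: "(complex ^ 'n) set \<Rightarrow> (complex ^ 'n \<Rightarrow> complex) set" where
  "test_functions \<Omega> = {\<phi> \<in> Cc \<Omega>. \<forall>k. Ck k \<phi>}"

definition dz :: "'n \<Rightarrow> (complex ^ 'n \<Rightarrow> complex) \<Rightarrow> complex ^ 'n \<Rightarrow> complex" where
  "dz a \<phi> z = (frechet_derivative \<phi> (at z) (axis a 1)
                - \<i> * frechet_derivative \<phi> (at z) (axis a \<i>)) / 2"

definition dzbar :: "'n \<Rightarrow> (complex ^ 'n \<Rightarrow> complex) \<Rightarrow> complex ^ 'n \<Rightarrow> complex" where
  "dzbar b \<phi> z = (frechet_derivative \<phi> (at z) (axis b 1)
                + \<i> * frechet_derivative \<phi> (at z) (axis b \<i>)) / 2"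

section \<open>The Bedford--Taylor Monge--Ampere operator\<close>

text \<open>
  Normalisation: \<open>d\<^sup>c = c \<sqdot> i (\<partial>bar - \<partial>)\<close> with a real constant \<open>c > 0\<close>, hence
  \<open>dd\<^sup>c \<phi> = 2 c i \<partial>\<partial>bar \<phi> = 4 c \<Sum>\<^sub>a\<^sub>b (\<partial>\<^sub>a \<partial>bar\<^sub>b \<phi>) \<omega>\<^sub>a\<^sub>b\<close> where
  \<open>\<omega>\<^sub>a\<^sub>b = (i/2) dz\<^sub>a \<and> dzbar\<^sub>b\<close>.

  A current \<open>T\<close> of bidegree \<open>(k,k)\<close> on an open set \<open>\<Omega>\<close> is given by the numbers
  \<open>T (\<phi> \<omega>\<^sub>L)\<close>, where \<open>\<phi>\<close> is a function and \<open>\<omega>\<^sub>L\<close> is the product of the \<open>\<omega>\<^sub>a\<^sub>b\<close>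
  over a list \<open>L\<close> of \<open>n - k\<close> index pairs; 2-forms commute, so the order is irrelevant.
  For \<open>n\<close> pairs, \<open>\<omega>\<^sub>L\<close> is the volume form times the determinant of the incidence matrix of \<open>L\<close>:
  the sign of the permutation taking first to second components if \<open>L\<close> is the graph of
  one, and \<open>0\<close> otherwise.

  In \<open>bedford_taylor_chain c \<Omega> v M\<close> the functional \<open>M k L\<close> is
  \<open>\<phi> \<mapsto> \<integral> \<phi> (dd\<^sup>c v)\<^sup>k \<and> \<omega>\<^sub>L\<close>. It has order 0, so that it acts on continuous functions with
  compact support and can be multiplied by the continuous function \<open>v\<close>; the last clause is
  the Bedford--Taylor definition \<open>(dd\<^sup>c v)\<^sup>k\<^sup>+\<^sup>1 = dd\<^sup>c (v (dd\<^sup>c v)\<^sup>k)\<close>, that is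
  \<open>\<integral> \<phi> (dd\<^sup>c v)\<^sup>k\<^sup>+\<^sup>1 \<and> \<omega>\<^sub>L = \<integral> v (dd\<^sup>c v)\<^sup>k \<and> dd\<^sup>c \<phi> \<and> \<omega>\<^sub>L\<close>.
  These definitions are meant for open \<open>\<Omega>\<close> and continuous plurisubharmonic \<open>v\<close> on \<open>\<Omega>\<close>, for which
  the chain exists and is unique on the lists of the right length.
\<close>

definition order_zero ::
  "(complex ^ 'n) set \<Rightarrow> ((complex ^ 'n \<Rightarrow> complex) \<Rightarrow> complex) \<Rightarrow> bool" where
  "order_zero \<Omega> T \<longleftrightarrow>
     (\<forall>\<phi>\<in>Cc \<Omega>. \<forall>\<psi>\<in>Cc \<Omega>. \<forall>a b. T (\<lambda>z. a * \<phi> z + b * \<psi> z) = a * T \<phi> + b * T \<psi>) \<and>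
     (\<forall>K. compact K \<and> K \<subseteq> \<Omega> \<longrightarrow>
        (\<exists>C. \<forall>\<phi>\<in>Cc \<Omega>. \<forall>B. {z. \<phi> z \<noteq> 0} \<subseteq> K \<and> (\<forall>z. cmod (\<phi> z) \<le> B) \<longrightarrow>
           cmod (T \<phi>) \<le> C * B))"

definition volume_coeff :: "('n::finite \<times> 'n) list \<Rightarrow> real" where
  "volume_coeff L = det (\<chi> a b. if (a, b) \<in> set L then 1 else 0)"

definition bedford_taylor_chain ::
  "real \<Rightarrow> (complex ^ 'n) set \<Rightarrow> (complex ^ 'n \<Rightarrow> real) \<Rightarrow>
   (nat \<Rightarrow> ('n \<times> 'n) list \<Rightarrow> (complex ^ 'n \<Rightarrow> complex) \<Rightarrow> complex) \<Rightarrow> bool" where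
  "bedford_taylor_chain c \<Omega> v M \<longleftrightarrow>
     (\<forall>k L. k + length L = CARD('n) \<longrightarrow> order_zero \<Omega> (M k L)) \<and>
     (\<forall>L. length L = CARD('n) \<longrightarrow>
        (\<forall>\<phi>\<in>Cc \<Omega>. M 0 L \<phi> = of_real (volume_coeff L) * (LINT z|lborel. \<phi> z))) \<and>
     (\<forall>k L. Suc k + length L = CARD('n) \<longrightarrow>
        (\<forall>\<phi>\<in>test_functions \<Omega>. M (Suc k) L \<phi> =
           of_real (4 * c) * (\<Sum>a\<in>UNIV. \<Sum>b\<in>UNIV.
             M k ((a, b) # L) (\<lambda>z. of_real (v z) * dz a (dzbar b \<phi>) z))))"

text \<open>\<open>\<mu>\<close> is the measure \<open>(dd\<^sup>c v)\<^sup>n\<close> on \<open>\<Omega>\<close>, extended by zero to the whole space.\<close>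

definition is_monge_ampere_measure ::
  "real \<Rightarrow> (complex ^ 'n) set \<Rightarrow> (complex ^ 'n \<Rightarrow> real) \<Rightarrow> (complex ^ 'n) measure \<Rightarrow> bool" where
  "is_monge_ampere_measure c \<Omega> v \<mu> \<longleftrightarrow>
     sets \<mu> = sets borel \<and> emeasure \<mu> (- \<Omega>) = 0 \<and>
     (\<forall>K. compact K \<and> K \<subseteq> \<Omega> \<longrightarrow> emeasure \<mu> K < \<infinity>) \<and>
     (\<exists>M. bedford_taylor_chain c \<Omega> v M \<and>
        (\<forall>\<phi>\<in>Cc \<Omega>. M CARD('n) [] \<phi> = (LINT z|\<mu>. \<phi> z)))"

section \<open>Demailly measures and Poletsky--Stessin Hardy spaces\<close>

definition sublevel :: "(complex ^ 'n) set \<Rightarrow> (complex ^ 'n \<Rightarrow> ereal) \<Rightarrow> real \<Rightarrow> (complex ^ 'n) set" where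
  "sublevel \<Omega> u r = {z \<in> \<Omega>. u z < ereal r}"

definition level :: "(complex ^ 'n) set \<Rightarrow> (complex ^ 'n \<Rightarrow> ereal) \<Rightarrow> real \<Rightarrow> (complex ^ 'n) set" where
  "level \<Omega> u r = {z \<in> \<Omega>. u z = ereal r}"

definition trunc :: "(complex ^ 'n \<Rightarrow> ereal) \<Rightarrow> real \<Rightarrow> complex ^ 'n \<Rightarrow> real" where
  "trunc u r z = real_of_ereal (max (u z) (ereal r))"

text \<open>
  \<open>\<mu> = (dd\<^sup>c u\<^sub>r)\<^sup>n - \<chi> (dd\<^sup>c u)\<^sup>n\<close>, with \<open>\<chi>\<close> the indicator of \<open>\<Omega> - sublevel \<Omega> u r\<close>. The second term
  only involves \<open>(dd\<^sup>c u)\<^sup>n\<close> on the open set where \<open>u > -\<infinity>\<close>. The subtraction is written additively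
  because both measures may be infinite near the boundary of \<open>\<Omega>\<close>; both are
  finite on compact subsets of \<open>\<Omega>\<close>, so \<open>\<mu>\<close> is still determined.
\<close>

definition is_demailly_measure ::
  "real \<Rightarrow> (complex ^ 'n) set \<Rightarrow> (complex ^ 'n \<Rightarrow> ereal) \<Rightarrow> real \<Rightarrow> (complex ^ 'n) measure \<Rightarrow> bool" where
  "is_demailly_measure c \<Omega> u r \<mu> \<longleftrightarrow>
     sets \<mu> = sets borel \<and> emeasure \<mu> (- \<Omega>) = 0 \<and>
     (\<exists>\<alpha> \<nu>. is_monge_ampere_measure c \<Omega> (trunc u r) \<alpha> \<and>
        is_monge_ampere_measure c {z \<in> \<Omega>. u z > -\<infinity>} (\<lambda>z. real_of_ereal (u z)) \<nu> \<and>
        (\<forall>A\<in>sets borel. A \<subseteq> \<Omega> \<longrightarrow>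
           emeasure \<mu> A + emeasure \<nu> (A - sublevel \<Omega> u r) = emeasure \<alpha> A))"

definition poletsky_stessin_hardy ::
  "real \<Rightarrow> (complex ^ 'n) set \<Rightarrow> (complex ^ 'n \<Rightarrow> ereal) \<Rightarrow> real \<Rightarrow> (complex ^ 'n \<Rightarrow> complex) set" where
  "poletsky_stessin_hardy c \<Omega> u q =
     {f. holomorphic_cn f \<Omega> \<and>
        (\<exists>\<mu>. (\<forall>r<0. is_demailly_measure c \<Omega> u r (\<mu> r)) \<and>
           Limsup (at_left 0)
             (\<lambda>r. \<integral>\<^sup>+ z\<in>level \<Omega> u r. ennreal (cmod (f z) powr q) \<partial>\<mu> r) < \<infinity>)}"

text \<open>The weak-* limit of the Demailly measures as \<open>r\<close> tends to \<open>0\<close> from the left, as measures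
  on the closure of \<open>\<Omega>\<close>.\<close>

definition is_boundary_monge_ampere_measure ::
  "real \<Rightarrow> (complex ^ 'n) set \<Rightarrow> (complex ^ 'n \<Rightarrow> ereal) \<Rightarrow> (complex ^ 'n) measure \<Rightarrow> bool" where
  "is_boundary_monge_ampere_measure c \<Omega> u \<mu>u \<longleftrightarrow>
     sets \<mu>u = sets borel \<and> finite_measure \<mu>u \<and> emeasure \<mu>u (- closure \<Omega>) = 0 \<and>
     (\<exists>\<mu>. (\<forall>r<0. is_demailly_measure c \<Omega> u r (\<mu> r)) \<and>
        (\<forall>\<phi> :: complex ^ 'n \<Rightarrow> real. continuous_on (closure \<Omega>) \<phi> \<longrightarrow>
           ((\<lambda>r. LINT z:closure \<Omega>|\<mu> r. \<phi> z) \<longlongrightarrow> (LINT z:closure \<Omega>|\<mu>u. \<phi> z)) (at_left 0)))"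

section \<open>The complex ellipsoid\<close>

definition ellipsoid_sum :: "('n::finite \<Rightarrow> nat) \<Rightarrow> complex ^ 'n \<Rightarrow> real" where
  "ellipsoid_sum p z = (\<Sum>j\<in>UNIV. cmod (z $ j) ^ (2 * p j))"

definition ellipsoid :: "('n::finite \<Rightarrow> nat) \<Rightarrow> (complex ^ 'n) set" where
  "ellipsoid p = {z. ellipsoid_sum p z - 1 < 0}"

text \<open>The case distinction is needed because \<open>ln 0 = 0\<close> in the library.\<close>

definition log_exhaustion :: "('n::finite \<Rightarrow> nat) \<Rightarrow> complex ^ 'n \<Rightarrow> ereal" where
  "log_exhaustion p z =
     (if ellipsoid_sum p z = 0 then -\<infinity> else ereal (ln (ellipsoid_sum p z)))"

definition radial_limit :: "(complex ^ 'n \<Rightarrow> complex) \<Rightarrow> complex ^ 'n \<Rightarrow> complex" where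
  "radial_limit f \<xi> = Lim (at_left (1::real)) (\<lambda>r. f (r *\<^sub>R \<xi>))"

definition in_Lp_on ::
  "real \<Rightarrow> (complex ^ 'n) set \<Rightarrow> (complex ^ 'n) measure \<Rightarrow> (complex ^ 'n \<Rightarrow> complex) \<Rightarrow> bool" where
  "in_Lp_on q S \<mu> g \<longleftrightarrow>
     set_borel_measurable \<mu> S g \<and> (\<integral>\<^sup>+ z\<in>S. ennreal (cmod (g z) powr q) \<partial>\<mu>) < \<infinity>"

end

theory Submission
  imports Defs "HOL-Complex_Analysis.Complex_Analysis"
begin

text \<open>
  The ellipsoid is invariant under the circle action \<open>z \<mapsto> cis t *s z\<close>, and each complex line through the origin meets it in a disc
  centred at the origin. The theorem follows from Fatou's theorem on almost every one of these discs. What has to be shown is that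
  the slice of \<open>f\<close> to almost every disc lies in a Hardy space, and that a set which meets almost every orbit of the action
  in a null set of angles is null for \<open>\<mu>u\<close>. Both rest on the invariance of the measures under the action.

  A Bedford--Taylor chain consists of functionals of order zero whose values on test functions are prescribed recursively. Since
  test functions are dense (\<open>test_functions_dense\<close>), the chain is unique (\<open>bedford_taylor_chain_unique\<close>). Consequently
  Monge--Ampere measures are local; the Demailly measure lives on the level set, as off it the truncation \<open>u\<^sub>r\<close> is constant or
  equal to \<open>u\<close>; and it is determined by \<open>r\<close>. As rotated chains are again chains, uniqueness also makes the Demailly measures and
  their weak limit invariant under the circle action (\<open>demailly_measure_rotation\<close>, \<open>boundary_measure_rotation\<close>).

  On a disc the mean of \<open>|f|\<^sup>q\<close> over a circle increases with the radius (\<open>circle_mean_powr_mono\<close>). Averaging over orbits, the integral of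
  \<open>|f(R z)|\<^sup>q\<close> against a Demailly measure is at most that of \<open>|f|\<^sup>q\<close>, for every \<open>R < 1\<close>. The dilated function is continuous up
  to the boundary, so the weak limit gives \<open>\<integral>|f(R \<xi>)|\<^sup>q d\<mu>u \<le> C\<close> with \<open>C\<close> independent of \<open>R\<close> (\<open>dilated_boundary_integral_bounded\<close>).
  Averaging this bound over orbits and letting \<open>R\<close> tend to 1, Fatou's lemma shows that for almost every \<open>\<xi>\<close> the slice
  \<open>l \<mapsto> f(l \<xi>)\<close> has bounded means, hence radial limits at almost every angle. The same bound and Fatou's lemma put the limit in \<open>L\<^sup>q\<close>.

  Fatou's theorem on the disc (\<open>H1_radial_limits\<close>) is proved first for bounded functions: the radial maximal function satisfies
  a weak type inequality (\<open>radial_maximal_weak_type\<close>, from Vitali's covering lemma), and dilations of a bounded function converge to it in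
  mean, by Parseval's identity. If the means of \<open>|g|\<close> are bounded, then \<open>1 + |g| \<le> Re F\<close> for a holomorphic \<open>F\<close>, a limit of Herglotz
  integrals; \<open>g\<close> is the quotient of the bounded functions \<open>g / F\<close> and \<open>1 / F\<close>, and the limits of \<open>1 / F\<close> are almost everywhere nonzero because
  \<open>ln |F|\<close> has bounded means.
\<close>

section \<open>The Poisson kernel and means over circles\<close>

definition poisson :: "complex \<Rightarrow> real \<Rightarrow> real" where
  "poisson z t = (1 - (cmod z)\<^sup>2) / (cmod (cis t - z))\<^sup>2"

lemma cis_neq_of_cmod_less_one: "cmod z < 1 \<Longrightarrow> cis t \<noteq> z"
  by (metis norm_cis less_irrefl)

lemma poisson_pos: "cmod z < 1 \<Longrightarrow> 0 < poisson z t"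
  using cis_neq_of_cmod_less_one[of z t]
  by (auto simp: poisson_def power_less_one_iff abs_square_less_1 intro!: divide_pos_pos)

lemma continuous_on_poisson [continuous_intros]:
  assumes "continuous_on S u" "continuous_on S t" "\<And>x. x \<in> S \<Longrightarrow> cmod (u x) < 1"
  shows "continuous_on S (\<lambda>x. poisson (u x) (t x))"
  unfolding poisson_def
  by (intro continuous_intros assms) (use assms(3) cis_neq_of_cmod_less_one in force)

text \<open>The map \<open>w \<mapsto> cis (s + t) * cnj w\<close> is an isometry that exchanges the two configurations. It turns an integral over the
  centre into an integral over the boundary point, which is what monotonicity of means needs.\<close>

lemma poisson_swap:
  "poisson (of_real r * cis s) t = poisson (of_real r * cis t) s"
proof -
  have "cmod (cis t - of_real r * cis s) = cmod (cis s - of_real r * cis t)"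
  proof -
    have "cis t - of_real r * cis s = cis t * cis s * cnj (cis s - of_real r * cis t)"
      by (simp add: algebra_simps cis_cnj flip: cis_inverse)
    then show ?thesis by (simp only: norm_mult complex_mod_cnj norm_cis)
  qed
  then show ?thesis by (simp add: poisson_def norm_mult)
qed

text \<open>Cauchy's formula at \<open>z\<close> for \<open>u \<mapsto> g u (1 - |z|\<^sup>2) / (1 - cnj z u)\<close>, which has the value \<open>g z\<close> at \<open>z\<close>: on the unit
  circle \<open>1 - cnj z u = u cnj (u - z)\<close>, so the Cauchy kernel becomes the Poisson kernel.\<close>

lemma poisson_integral_formula:
  fixes g :: "complex \<Rightarrow> complex"
  assumes "continuous_on (cball 0 1) g" "g holomorphic_on ball 0 1" and z: "cmod z < 1"
  shows "((\<lambda>t. of_real (poisson z t) * g (cis t)) has_integral 2 * pi * g z) {0..2*pi}"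
proof -
  define f where "f u = g u * (1 - of_real ((cmod z)\<^sup>2)) / (1 - cnj z * u)" for u
  have nz: "1 - cnj z * u \<noteq> 0" if "cmod u \<le> 1" for u
  proof
    assume "1 - cnj z * u = 0"
    then have "cmod z * cmod u = 1"
      by (metis complex_mod_cnj norm_mult norm_one right_minus_eq)
    with z that show False
      by (metis mult_left_le norm_ge_zero not_le)
  qed
  have "continuous_on (cball 0 1) f" "f holomorphic_on ball 0 1"
    unfolding f_def using nz
    by (auto intro!: continuous_intros holomorphic_intros assms)
  then have "((\<lambda>u. f u/(u-z)) has_contour_integral (2 * of_real pi * \<i> * f z)) (circlepath 0 1)"
    by (intro Cauchy_integral_circlepath) (use z in auto)
  then have "((\<lambda>t. f (cis t) / (cis t - z) * \<i> * cis t) has_integral 2 * pi * \<i> * f z) {0..2*pi}"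
    unfolding circlepath_def by (subst (asm) has_contour_integral_part_circlepath_iff) simp_all
  then have *: "((\<lambda>t. - \<i> * (f (cis t) / (cis t - z) * \<i> * cis t)) has_integral - \<i> * (2 * pi * \<i> * f z)) {0..2*pi}"
    by (rule has_integral_mult_right)
  have fz: "f z = g z"
    using nz[of z] z by (simp add: f_def complex_norm_square mult.commute del: of_real_power)
  have "- \<i> * (f (cis t) / (cis t - z) * \<i> * cis t) = of_real (poisson z t) * g (cis t)" for t
  proof -
    have 1: "1 - cnj z * cis t = cis t * cnj (cis t - z)"
      by (simp add: algebra_simps cis_cnj flip: cis_inverse)
    have 2: "of_real ((cmod (cis t - z))\<^sup>2) = (cis t - z) * cnj (cis t - z)"
      by (rule complex_norm_square)
    define d e w where "d = cis t - z" and "e = cnj d" and "w = cis t"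
    have "d \<noteq> 0" "e \<noteq> 0" "w \<noteq> 0"
      using cis_neq_of_cmod_less_one[OF z, of t] by (auto simp: d_def e_def w_def)
    then show ?thesis
      unfolding f_def poisson_def of_real_divide 1 2
      unfolding d_def[symmetric]
      unfolding e_def[symmetric] w_def[symmetric]
      by (simp add: field_simps)
  qed
  with * show ?thesis by (simp add: fz mult_ac)
qed

lemma integral_poisson:
  assumes "cmod z < 1" shows "(poisson z has_integral 2 * pi) {0..2*pi}"
proof -
  have "((\<lambda>t. of_real (poisson z t) * 1) has_integral complex_of_real (2 * pi) * 1) {0..2*pi}"
    using poisson_integral_formula[of "\<lambda>_. 1" z] assms by simp
  then have "((\<lambda>t. of_real (poisson z t)) has_integral complex_of_real (2 * pi)) {0..2*pi}"
    by simp
  then have "((\<lambda>t. Re (of_real (poisson z t))) has_integral Re (complex_of_real (2 * pi))) {0..2*pi}"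
    by (rule has_integral_Re)
  then show ?thesis by simp
qed

lemma norm_le_poisson_integral:
  assumes g: "continuous_on (cball 0 1) g" "g holomorphic_on ball 0 1" and z: "cmod z < 1"
  shows "2 * pi * cmod (g z) \<le> integral {0..2*pi} (\<lambda>t. poisson z t * cmod (g (cis t)))"
proof -
  have c: "continuous_on {0..2*pi} (\<lambda>t. g (cis t))"
    by (rule continuous_on_compose2[OF g(1)]) (auto intro!: continuous_intros)
  have "norm (integral {0..2*pi} (\<lambda>t. of_real (poisson z t) * g (cis t)))
      \<le> integral {0..2*pi} (\<lambda>t. poisson z t * cmod (g (cis t)))"
    by (rule integral_norm_bound_integral)
      (use c poisson_pos[OF z] z in \<open>auto intro!: integrable_continuous_real continuous_intros
         simp: norm_mult less_imp_le abs_of_pos\<close>)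
  then show ?thesis
    using integral_unique[OF poisson_integral_formula[OF assms]] by (simp add: norm_mult)
qed

text \<open>The graph of a convex power lies above its tangent at \<open>a\<close>. Integrated against a probability density
  of mean \<open>a\<close> this is Jensen's inequality.\<close>

lemma powr_tangent_le:
  fixes a y q :: real
  assumes "0 \<le> a" "0 \<le> y" "1 \<le> q"
  shows "a powr q + q * a powr (q - 1) * (y - a) \<le> y powr q"
proof (cases "a = 0")
  case True then show ?thesis using assms by simp
next
  case False
  show ?thesis
  proof (cases "y = 0")
    case True
    have "a powr q = a powr (q - 1) * a" using False assms by (simp add: powr_diff)
    moreover have "a powr q * (1 - q) \<le> 0" using assms by (simp add: mult_nonneg_nonpos)
    ultimately show ?thesis using True assms by (simp add: algebra_simps)
  next
    case y: False
    have 1: "1 + q * (x - 1) \<le> x powr q" if x: "x > 0" for x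
    proof -
      have "((\<lambda>x. x powr q) has_real_derivative q) (at 1 within {0<..})"
        using has_real_derivative_powr[of 1 q] by (auto intro: has_field_derivative_at_within)
      from convex_on_imp_above_tangent[OF powr_convex[OF assms(3)] _ _ _ this] x
      show ?thesis by (smt (verit) connected_Ioi greaterThan_iff interior_open open_greaterThan powr_one_eq_one x zero_less_one)
    qed
    have "a powr q * (1 + q * (y / a - 1)) \<le> a powr q * (y / a) powr q"
      by (intro mult_left_mono 1) (use assms y False in auto)
    also have "\<dots> = y powr q" using assms False by (simp add: powr_divide)
    finally show ?thesis
      using False assms by (simp add: field_simps powr_diff)
  qed
qed

lemma norm_powr_le_poisson_integral:
  assumes g: "continuous_on (cball 0 1) g" "g holomorphic_on ball 0 1" and z: "cmod z < 1" and q: "1 \<le> q"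
  shows "2 * pi * cmod (g z) powr q \<le> integral {0..2*pi} (\<lambda>t. poisson z t * cmod (g (cis t)) powr q)"
proof -
  define a where "a = cmod (g z)"
  have c: "continuous_on {0..2*pi} (\<lambda>t. g (cis t))"
    by (rule continuous_on_compose2[OF g(1)]) (auto intro!: continuous_intros)
  have cp: "continuous_on {0..2*pi} (poisson z)" using z by (intro continuous_intros) auto
  have cn: "continuous_on {0..2*pi} (\<lambda>t. poisson z t * cmod (g (cis t)))"
    by (intro continuous_intros c cp)
  have cq: "continuous_on {0..2*pi} (\<lambda>t. poisson z t * cmod (g (cis t)) powr q)"
    by (intro continuous_intros c cp continuous_on_powr') (use q in auto)
  have "a powr q * (2 * pi) + q * a powr (q - 1) * (integral {0..2*pi} (\<lambda>t. poisson z t * cmod (g (cis t))) - a * (2 * pi))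
     = integral {0..2*pi} (\<lambda>t. a powr q * poisson z t + q * a powr (q - 1) *
           (poisson z t * cmod (g (cis t)) - a * poisson z t))"
    using integral_poisson[OF z] integrable_continuous_real[OF cp] integrable_continuous_real[OF cn]
    by (simp add: integral_add integral_diff integrable_diff integrable_on_mult_right integral_unique)
  also have "\<dots> \<le> integral {0..2*pi} (\<lambda>t. poisson z t * cmod (g (cis t)) powr q)"
  proof (rule integral_le)
    fix t
    have "poisson z t * (a powr q + q * a powr (q - 1) * (cmod (g (cis t)) - a)) \<le> poisson z t * cmod (g (cis t)) powr q"
      using poisson_pos[OF z, of t] q by (intro mult_left_mono powr_tangent_le) (auto simp: a_def)
    then show "a powr q * poisson z t + q * a powr (q - 1) * (poisson z t * cmod (g (cis t)) - a * poisson z t)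
        \<le> poisson z t * cmod (g (cis t)) powr q" by (simp add: algebra_simps)
  qed (intro integrable_continuous_real continuous_intros c cp cq cn)+
  finally show ?thesis
    using norm_le_poisson_integral[OF g z] q unfolding a_def
    by (smt (verit, ccfv_SIG) mult.commute mult_nonneg_nonneg powr_ge_zero)
qed

text \<open>Integrating the Poisson bound over the circle of radius \<open>r\<close> and exchanging the integrals leaves
  \<open>2 \<pi>\<close> in front of each boundary value, by the symmetry of the kernel.\<close>

lemma circle_mean_powr_mono:
  assumes g: "continuous_on (cball 0 1) g" "g holomorphic_on ball 0 1" and q: "1 \<le> q"
    and r: "0 \<le> r" "r < 1"
  shows "integral {0..2*pi} (\<lambda>s. cmod (g (of_real r * cis s)) powr q)
     \<le> integral {0..2*pi} (\<lambda>t. cmod (g (cis t)) powr q)"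
proof -
  have c1: "continuous_on UNIV (\<lambda>t. cmod (g (cis t)) powr q)"
    by (intro continuous_on_powr' continuous_intros continuous_on_compose2[OF g(1)]) (use q in auto)
  have c2: "continuous_on UNIV (\<lambda>s. cmod (g (of_real r * cis s)) powr q)"
    by (intro continuous_on_powr' continuous_intros continuous_on_compose2[OF g(1)]) (use q r in \<open>auto simp: norm_mult\<close>)
  have c12: "continuous_on (cbox (0, 0) (2*pi, 2*pi))
     (\<lambda>(s, t). poisson (of_real r * cis s) t * cmod (g (cis t)) powr q)"
    unfolding split_beta
    by (intro continuous_intros continuous_on_powr' continuous_on_compose2[OF g(1)]) (use q r in \<open>auto simp: norm_mult\<close>)
  have nr: "cmod (of_real r * cis s) < 1" for s using r by (simp add: norm_mult)
  have "2 * pi * integral {0..2*pi} (\<lambda>s. cmod (g (of_real r * cis s)) powr q)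
     = integral {0..2*pi} (\<lambda>s. 2 * pi * cmod (g (of_real r * cis s)) powr q)" by simp
  also have "\<dots> \<le> integral {0..2*pi} (\<lambda>s. integral {0..2*pi} (\<lambda>t. poisson (of_real r * cis s) t * cmod (g (cis t)) powr q))"
  proof (rule integral_le)
    show "(\<lambda>s. 2 * pi * cmod (g (of_real r * cis s)) powr q) integrable_on {0..2*pi}"
      by (intro integrable_continuous_real continuous_intros continuous_on_subset[OF c2]) auto
    show "(\<lambda>s. integral {0..2*pi} (\<lambda>t. poisson (of_real r * cis s) t * cmod (g (cis t)) powr q)) integrable_on {0..2*pi}"
      using integral_integrable_2dim[of "(0::real)" "2*pi" "0" "2*pi"] c12
      by (intro integrable_continuous_real)
         (use integral_continuous_on_param[of "{0..2*pi}" 0 "2*pi"] in \<open>auto simp: cbox_Pair_eq\<close>)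
    show "\<And>s. 2 * pi * cmod (g (of_real r * cis s)) powr q \<le> integral {0..2*pi} (\<lambda>t. poisson (of_real r * cis s) t * cmod (g (cis t)) powr q)"
      by (rule norm_powr_le_poisson_integral[OF g nr q])
  qed
  also have "\<dots> = integral {0..2*pi} (\<lambda>t. integral {0..2*pi} (\<lambda>s. poisson (of_real r * cis s) t * cmod (g (cis t)) powr q))"
    using integral_swap_continuous[OF c12] by simp
  also have "\<dots> = integral {0..2*pi} (\<lambda>t. 2 * pi * cmod (g (cis t)) powr q)"
  proof -
    have "integral {0..2*pi} (\<lambda>s. poisson (of_real r * cis s) t) = 2 * pi" for t
      using integral_poisson[OF nr[of t]] poisson_swap[of r _ t] by (simp add: integral_unique)
    then show ?thesis by simp
  qed
  finally show ?thesis by simp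
qed

section \<open>The radial maximal function\<close>

text \<open>Half a turn replaces integrals over \<open>[0, 2 \<pi>]\<close> by integrals over \<open>[-\<pi>, \<pi>]\<close>, where the kernel is even.\<close>

lemma poisson_minus_shift: "poisson (- z) (t + pi) = poisson z t"
proof -
  have "cis (t + pi) - - z = - (cis t - z)" by (simp flip: cis_mult)
  then show ?thesis by (simp only: poisson_def norm_minus_cancel)
qed

lemma poisson_of_real: "poisson (of_real r) t = (1 - r\<^sup>2) / (1 - 2 * r * cos t + r\<^sup>2)"
proof -
  have "(cmod (cis t - of_real r))\<^sup>2 = 1 - 2 * r * cos t + r\<^sup>2"
    unfolding cmod_power2 using sin_cos_squared_add[of t] by (simp add: power2_eq_square algebra_simps)
  then show ?thesis by (simp add: poisson_def)
qed

lemma poisson_of_real_has_derivative: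
  assumes r: "0 \<le> r" "r < 1"
  obtains p' where "\<And>t. (poisson (of_real r) has_real_derivative p' t) (at t)"
    "\<And>t. 0 \<le> t \<Longrightarrow> t \<le> pi \<Longrightarrow> p' t \<le> 0" "continuous_on UNIV p'"
proof -
  define D where "D t = 1 - 2 * r * cos t + r\<^sup>2" for t
  have Dpos: "D t > 0" for t
  proof -
    have "(1 - r)\<^sup>2 \<le> D t"
      using mult_left_mono[OF cos_le_one[of t], of "2 * r"] r by (simp add: D_def power2_eq_square algebra_simps)
    then show ?thesis using r by (smt (verit) zero_less_power)
  qed
  define p' where "p' t = - ((1 - r\<^sup>2) * (2 * r * sin t)) / (D t)\<^sup>2" for t
  have "poisson (of_real r) = (\<lambda>t. (1 - r\<^sup>2) / D t)"
    by (simp add: fun_eq_iff poisson_of_real D_def)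
  moreover have "((\<lambda>t. (1 - r\<^sup>2) / D t) has_real_derivative p' t) (at t)" for t
  proof -
    have "(D has_real_derivative 2 * r * sin t) (at t)"
      unfolding D_def by (auto intro!: derivative_eq_intros)
    from DERIV_divide[OF DERIV_const this, of "1 - r\<^sup>2"] Dpos[of t]
    show ?thesis by (simp add: p'_def power2_eq_square)
  qed
  moreover have "p' t \<le> 0" if "0 \<le> t" "t \<le> pi" for t
    unfolding p'_def using sin_ge_zero[OF that] r
    by (intro divide_nonpos_nonneg) (auto simp: power_le_one)
  moreover have "continuous_on UNIV p'"
    unfolding p'_def D_def using Dpos unfolding D_def by (intro continuous_intros) (metis less_irrefl power_eq_0_iff)
  ultimately show ?thesis using that by metis
qed

lemma integral_symmetric_interval:
  fixes h :: "real \<Rightarrow> real"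
  assumes "continuous_on {-a..a} h" "0 \<le> a"
  shows "integral {-a..a} h = integral {0..a} (\<lambda>x. h x + h (- x))"
proof -
  have h: "h integrable_on {-a..a}" "h integrable_on {0..a}" "h integrable_on {-a..0}"
    using assms by (auto intro!: integrable_continuous_real intro: continuous_on_subset)
  have "integral {-a..0} h = integral {0..a} (\<lambda>x. h (- x))"
    using Henstock_Kurzweil_Integration.integral_reflect_real[where a = 0 and b = a and f = "\<lambda>x. h (-x)"] by simp
  moreover have "(\<lambda>x. h (- x)) integrable_on {0..a}"
    using h(3) Henstock_Kurzweil_Integration.integrable_reflect_real[where f = "\<lambda>x. h (-x)" and a = 0 and b = a] by simp
  ultimately show ?thesis
    using Henstock_Kurzweil_Integration.integral_combine[where f = h and a = "-a" and c = 0 and b = a] assms h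
    by (simp add: integral_add)
qed

text \<open>The kernel is even and decreasing on \<open>[0, \<pi>]\<close>, hence a superposition of centred averages.
  Integration by parts expresses this: if \<open>D d\<close> is the excess of \<open>\<integral>\<psi>\<close> over \<open>2 d m\<close> on the centred interval of radius
  \<open>d\<close>, then \<open>D \<le> 0\<close>, and \<open>\<integral>D' p = D(\<pi>) p(\<pi>) - \<integral>D p' \<le> 0\<close>.\<close>

lemma poisson_integral_le_of_averages:
  fixes \<psi> :: "real \<Rightarrow> real"
  assumes \<psi>: "continuous_on UNIV \<psi>" and r: "0 \<le> r" "r < 1"
    and av: "\<And>d. 0 < d \<Longrightarrow> d \<le> pi \<Longrightarrow> integral {s - d..s + d} \<psi> \<le> 2 * d * m"
  shows "integral {-pi..pi} (\<lambda>t. poisson (of_real r) t * \<psi> (s + t)) \<le> 2 * pi * m"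
proof -
  have nr: "cmod (of_real r) < 1" using r by simp
  obtain p' where p': "\<And>t. (poisson (of_real r) has_real_derivative p' t) (at t)"
      "\<And>t. 0 \<le> t \<Longrightarrow> t \<le> pi \<Longrightarrow> p' t \<le> 0" "continuous_on UNIV p'"
    using poisson_of_real_has_derivative[OF r] by blast
  have pc: "continuous_on S (poisson (of_real r))" for S using nr by (intro continuous_intros) auto
  obtain \<Phi> where \<Phi>: "\<And>x. x \<in> {s - 4 .. s + 4} \<Longrightarrow> (\<Phi> has_vector_derivative \<psi> x) (at x within {s - 4..s + 4})"
    using antiderivative_continuous[of "s - 4" "s + 4" \<psi>] \<psi> by (metis continuous_on_subset subset_UNIV)
  have \<Phi>': "(\<Phi> has_real_derivative \<psi> x) (at x)" if "x \<in> {s - pi..s + pi}" for x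
  proof -
    have "at x within {s - 4..s + 4} = at x"
      using that pi_less_4 by (intro at_within_interior) auto
    with \<Phi>[of x] that pi_less_4 show ?thesis by (auto simp: has_real_derivative_iff_has_vector_derivative)
  qed
  define D where "D d = \<Phi> (s + d) - \<Phi> (s - d) - 2 * d * m" for d
  have D: "(D has_real_derivative \<psi> (s + d) + \<psi> (s - d) - 2 * m) (at d)" if "d \<in> {0..pi}" for d
  proof -
    have "((\<lambda>d. \<Phi> (s + d)) has_real_derivative \<psi> (s + d) * 1) (at d)"
      by (rule DERIV_chain2[OF \<Phi>']) (use that in \<open>auto intro!: derivative_eq_intros\<close>)
    moreover have "((\<lambda>d. \<Phi> (s - d)) has_real_derivative \<psi> (s - d) * (- 1)) (at d)"
      by (rule DERIV_chain2[OF \<Phi>']) (use that in \<open>auto intro!: derivative_eq_intros\<close>)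
    ultimately show ?thesis unfolding D_def by (auto intro!: derivative_eq_intros)
  qed
  have Dle: "D d \<le> 0" if "d \<in> {0..pi}" for d
  proof (cases "d = 0")
    case False
    have "(\<psi> has_integral \<Phi> (s + d) - \<Phi> (s - d)) {s - d..s + d}"
    proof (rule fundamental_theorem_of_calculus)
      fix x assume "x \<in> {s - d..s + d}"
      with that have "(\<Phi> has_real_derivative \<psi> x) (at x)" by (intro \<Phi>') auto
      then show "(\<Phi> has_vector_derivative \<psi> x) (at x within {s - d..s + d})"
        using has_vector_derivative_at_within has_real_derivative_iff_has_vector_derivative by blast
    qed (use that in auto)
    with av[of d] that False show ?thesis by (simp add: D_def integral_unique)
  qed (simp add: D_def)
  let ?p = "poisson (of_real r)"
  have 1: "((\<lambda>d. (\<psi> (s + d) + \<psi> (s - d) - 2 * m) * ?p d + D d * p' d) has_integral D pi * ?p pi - D 0 * ?p 0) {0..pi}"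
  proof (rule fundamental_theorem_of_calculus)
    fix x assume x: "x \<in> {0..pi}"
    show "((\<lambda>d. D d * ?p d) has_vector_derivative (\<psi> (s + x) + \<psi> (s - x) - 2 * m) * ?p x + D x * p' x) (at x within {0..pi})"
      using DERIV_mult[OF D[OF x] p'(1)[of x]]
      by - (rule has_vector_derivative_at_within, simp add: has_real_derivative_iff_has_vector_derivative mult.commute)
  qed simp
  have ci: "(\<lambda>d. (\<psi> (s + d) + \<psi> (s - d) - 2 * m) * ?p d) integrable_on {0..pi}"
    by (intro integrable_continuous_real continuous_intros pc continuous_on_compose2[OF \<psi>]) auto
  have "integral {0..pi} (\<lambda>d. (\<psi> (s + d) + \<psi> (s - d) - 2 * m) * ?p d) \<le>
     integral {0..pi} (\<lambda>d. (\<psi> (s + d) + \<psi> (s - d) - 2 * m) * ?p d + D d * p' d)"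
    by (rule integral_le[OF ci]) (use 1 Dle p'(2) in \<open>auto simp: mult_nonpos_nonpos\<close>)
  also have "\<dots> = D pi * ?p pi" using 1 by (simp add: integral_unique D_def)
  also have "\<dots> \<le> 0" using Dle[of pi] poisson_pos[OF nr, of pi] by (simp add: mult_nonpos_nonneg)
  finally have *: "integral {0..pi} (\<lambda>d. (\<psi> (s + d) + \<psi> (s - d) - 2 * m) * ?p d) \<le> 0" .
  have psym: "?p (- t) = ?p t" for t by (simp add: poisson_of_real)
  have "integral {-pi..pi} (\<lambda>t. ?p t * (\<psi> (s + t) - m)) = integral {0..pi} (\<lambda>d. (\<psi> (s + d) + \<psi> (s - d) - 2 * m) * ?p d)"
    by (subst integral_symmetric_interval)
       (auto intro!: continuous_intros pc continuous_on_compose2[OF \<psi>] simp: psym algebra_simps)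
  with * have le: "integral {-pi..pi} (\<lambda>t. ?p t * (\<psi> (s + t) - m)) \<le> 0" by simp
  have pint: "integral {-pi..pi} ?p = 2 * pi"
    using integral_shift_real_ivl[of 0 pi "2*pi" "poisson (- of_real r)"] integral_poisson[of "- of_real r"] nr
    by (simp add: poisson_minus_shift integral_unique)
  have "integral {-pi..pi} (\<lambda>t. ?p t * \<psi> (s + t)) = integral {-pi..pi} (\<lambda>t. ?p t * (\<psi> (s + t) - m) + ?p t * m)"
    by (simp add: algebra_simps)
  also have "\<dots> = integral {-pi..pi} (\<lambda>t. ?p t * (\<psi> (s + t) - m)) + integral {-pi..pi} (\<lambda>t. ?p t * m)"
    by (intro integral_add integrable_continuous_real continuous_intros pc continuous_on_compose2[OF \<psi>]) auto
  finally show ?thesis using le pint by simp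
qed

lemma norm_le_of_circle_averages:
  assumes g: "continuous_on (cball 0 1) g" "g holomorphic_on ball 0 1" and r: "0 \<le> r" "r < 1"
    and av: "\<And>d. 0 < d \<Longrightarrow> d \<le> pi \<Longrightarrow> integral {s - d..s + d} (\<lambda>t. cmod (g (cis t))) \<le> 2 * d * m"
  shows "cmod (g (of_real r * cis s)) \<le> m"
proof -
  have nr: "cmod (- of_real r) < 1" using r by simp
  \<comment> \<open>With this reflection the point \<open>r cis s\<close> becomes \<open>-r\<close>, opposite to the start of the parametrisation, so that the shift
    by \<open>\<pi>\<close> centres the integral at \<open>s\<close>.\<close>
  define h where "h z = g (- z * cis s)" for z
  have "continuous_on (cball 0 1) h" unfolding h_def
    by (intro continuous_on_compose2[OF g(1)] continuous_intros) (auto simp: norm_mult)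
  moreover have "(g \<circ> (\<lambda>z. - z * cis s)) holomorphic_on ball 0 1"
    by (rule holomorphic_on_compose_gen[OF _ g(2)]) (auto intro!: holomorphic_intros simp: norm_mult)
  then have "h holomorphic_on ball 0 1" by (simp add: h_def[abs_def] o_def)
  ultimately have "2 * pi * cmod (h (- of_real r)) \<le> integral {0..2*pi} (\<lambda>t. poisson (- of_real r) t * cmod (h (cis t)))"
    using nr by (rule norm_le_poisson_integral)
  also have "\<dots> = integral {-pi..pi} (\<lambda>t. poisson (- of_real r) (t + pi) * cmod (h (cis (t + pi))))"
    using integral_shift_real_ivl[of 0 pi "2*pi" "\<lambda>t. poisson (- of_real r) t * cmod (h (cis t))"]
    by simp
  also have "\<dots> = integral {-pi..pi} (\<lambda>t. poisson (of_real r) t * cmod (g (cis (s + t))))"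
    by (simp add: poisson_minus_shift h_def cis_mult add.commute flip: minus_cis)
  also have "\<dots> \<le> 2 * pi * m"
    by (rule poisson_integral_le_of_averages[OF _ r av, simplified])
       (intro continuous_intros continuous_on_compose2[OF g(1)], auto)
  finally show ?thesis by (simp add: h_def)
qed

lemma integral_circle_three_periods:
  fixes g :: "complex \<Rightarrow> real"
  assumes "continuous_on UNIV (\<lambda>t. g (cis t))"
  shows "integral {-2*pi..4*pi} (\<lambda>t. g (cis t)) = 3 * integral {0..2*pi} (\<lambda>t. g (cis t))"
proof -
  let ?f = "\<lambda>t. g (cis t)"
  have c: "continuous_on S ?f" for S using assms continuous_on_subset by blast
  have p: "cis (t + 2 * pi) = cis t" for t by (simp add: cis.ctr)
  have "integral {-2*pi..0} ?f = integral {0..2*pi} ?f" "integral {0..2*pi} ?f = integral {2*pi..4*pi} ?f"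
    using integral_shift_real_ivl[of 0 "2*pi" "2*pi" ?f] integral_shift_real_ivl[of "2*pi" "2*pi" "4*pi" ?f] by (simp_all add: p)
  moreover have "integral {-2*pi..0} ?f + integral {0..4*pi} ?f = integral {-2*pi..4*pi} ?f"
    by (rule Henstock_Kurzweil_Integration.integral_combine) (auto intro!: integrable_continuous_real c)
  moreover have "integral {0..2*pi} ?f + integral {2*pi..4*pi} ?f = integral {0..4*pi} ?f"
    by (rule Henstock_Kurzweil_Integration.integral_combine) (auto intro!: integrable_continuous_real c)
  ultimately show ?thesis by simp
qed

lemma nn_integral_Icc_continuous:
  fixes f :: "real \<Rightarrow> real"
  assumes "continuous_on {a..b} f" "\<And>x. 0 \<le> f x"
  shows "(\<integral>\<^sup>+x. ennreal (f x) * indicator {a..b} x \<partial>lborel) = ennreal (integral {a..b} f)"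
  by (rule nn_integral_has_integral_lebesgue')
     (use assms in \<open>auto intro: integrable_integral integrable_continuous_real\<close>)

definition radial_exceedance :: "(complex \<Rightarrow> complex) \<Rightarrow> real \<Rightarrow> real set" where
  "radial_exceedance g m = {s \<in> {0..2*pi}. \<exists>r. 0 \<le> r \<and> r < 1 \<and> m < cmod (g (of_real r * cis s))}"

lemma borel_radial_exceedance:
  assumes g: "continuous_on (ball 0 1) g"
  shows "radial_exceedance g m \<in> sets borel"
proof -
  have "open {s. m < cmod (g (of_real r * cis s))}" if "r \<in> {0..<1}" for r
    by (intro open_Collect_less continuous_intros continuous_on_compose2[OF g]) (use that in \<open>auto simp: norm_mult\<close>)
  then have "open (\<Union>r\<in>{0..<1}. {s. m < cmod (g (of_real r * cis s))})" by blast
  moreover have "radial_exceedance g m = {0..2*pi} \<inter> (\<Union>r\<in>{0..<1}. {s. m < cmod (g (of_real r * cis s))})"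
    by (auto simp: radial_exceedance_def)
  ultimately show ?thesis by simp
qed

text \<open>If \<open>g\<close> exceeds \<open>m\<close> somewhere on the radius at \<open>s\<close>, then some centred interval about \<open>s\<close> has mean above \<open>m\<close>.
  Vitali's covering lemma selects disjoint ones whose fivefold dilations still cover; as they lie in
  three periods, the constant is \<open>15 = 5 \<cdot> 3\<close>.\<close>

theorem radial_maximal_weak_type:
  assumes g: "continuous_on (cball 0 1) g" "g holomorphic_on ball 0 1" and m: "0 < m"
  shows "emeasure lborel (radial_exceedance g m) \<le> ennreal (15 / m * integral {0..2*pi} (\<lambda>t. cmod (g (cis t))))"
proof -
  define \<psi> where "\<psi> t = cmod (g (cis t))" for t
  have \<psi>c: "continuous_on S \<psi>" for S unfolding \<psi>_def
    by (intro continuous_intros continuous_on_compose2[OF g(1)]) auto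
  have [measurable]: "\<psi> \<in> borel_measurable borel" using \<psi>c by (rule borel_measurable_continuous_onI)
  define E where "E = radial_exceedance g m"
  have "\<exists>d. 0 < d \<and> d \<le> pi \<and> 2 * d * m < integral {s - d..s + d} \<psi>" if "s \<in> E" for s
  proof (rule ccontr)
    assume "\<not> ?thesis"
    then have "\<And>d. 0 < d \<Longrightarrow> d \<le> pi \<Longrightarrow> integral {s - d..s + d} \<psi> \<le> 2 * d * m" by force
    from norm_le_of_circle_averages[OF g _ _ this[unfolded \<psi>_def]] that show False
      by (force simp: E_def radial_exceedance_def)
  qed
  then obtain \<delta> where \<delta>: "\<And>s. s \<in> E \<Longrightarrow> 0 < \<delta> s \<and> \<delta> s \<le> pi \<and> 2 * \<delta> s * m < integral {s - \<delta> s..s + \<delta> s} \<psi>"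
    by metis
  \<comment> \<open>Radii are at most \<open>\<pi>\<close>, so the intervals about points of \<open>[0, 2 \<pi>]\<close> lie in \<open>[-2 \<pi>, 4 \<pi>]\<close>.\<close>
  obtain C where C: "countable C" "C \<subseteq> E" "pairwise (\<lambda>i j. disjnt (cball i (\<delta> i)) (cball j (\<delta> j))) C"
     "E \<subseteq> (\<Union>i\<in>C. cball i (5 * \<delta> i))"
    by (rule Vitali_covering_lemma_cballs[where S = E and K = E and a = "\<lambda>i. i" and r = \<delta> and B = pi]) (use \<delta> in force)+
  define \<nu> where "\<nu> = density lborel (\<lambda>t. ennreal (\<psi> t) * indicator {-2*pi..4*pi} t)"
  have \<nu>_Icc: "emeasure \<nu> {a..b} = ennreal (integral {a..b} \<psi>)" if "{a..b} \<subseteq> {-2*pi..4*pi}" for a b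
  proof -
    have "emeasure \<nu> {a..b} = (\<integral>\<^sup>+t. ennreal (\<psi> t) * indicator {a..b} t \<partial>lborel)"
      unfolding \<nu>_def by (subst emeasure_density) (use that in \<open>auto intro!: nn_integral_cong simp: indicator_def\<close>)
    also have "\<dots> = ennreal (integral {a..b} \<psi>)"
      by (rule nn_integral_Icc_continuous[OF \<psi>c]) (simp add: \<psi>_def)
    finally show ?thesis .
  qed
  \<comment> \<open>A listing of \<open>C\<close> by natural numbers without repetition; all other indices give the empty set.\<close>
  define I where "I n = (if n \<in> to_nat_on C ` C then {from_nat_into C n} else {})" for n
  have I: "x \<in> I n \<longleftrightarrow> x \<in> C \<and> n = to_nat_on C x" for x n
    unfolding I_def using C(1) by (auto simp: from_nat_into_to_nat_on)
  define A where "A n = (\<Union>i\<in>I n. cball i (\<delta> i))" for n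
  define B where "B n = (\<Union>i\<in>I n. cball i (5 * \<delta> i))" for n
  have In: "I n = {} \<or> (\<exists>x\<in>C. I n = {x})" for n
    using C(1) by (auto simp: I_def from_nat_into_to_nat_on)
  have AB: "emeasure lborel (B n) \<le> ennreal (5 / m) * emeasure \<nu> (A n)" for n
    using In[of n]
  proof
    assume "\<exists>x\<in>C. I n = {x}"
    then obtain x where x: "x \<in> C" "I n = {x}" by blast
    with C(2) \<delta>[of x] have d: "0 < \<delta> x" "\<delta> x \<le> pi" "2 * \<delta> x * m < integral {x - \<delta> x..x + \<delta> x} \<psi>" "x \<in> {0..2*pi}"
      by (auto simp: E_def radial_exceedance_def)
    have "emeasure lborel (B n) = ennreal (10 * \<delta> x)" using x d by (simp add: B_def cball_eq_atLeastAtMost)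
    also have "\<dots> \<le> ennreal (5 / m * integral {x - \<delta> x..x + \<delta> x} \<psi>)"
      using d(3) m by (intro ennreal_leI) (simp add: field_simps)
    also have "\<dots> = ennreal (5 / m) * emeasure \<nu> (A n)"
    proof -
      have "emeasure \<nu> (A n) = ennreal (integral {x - \<delta> x..x + \<delta> x} \<psi>)"
        unfolding A_def x(2) using d by (simp add: cball_eq_atLeastAtMost \<nu>_Icc)
      then show ?thesis using m by (subst ennreal_mult') auto
    qed
    finally show ?thesis .
  qed (simp add: A_def B_def)
  have [measurable]: "A n \<in> sets borel" "B n \<in> sets borel" for n
    unfolding A_def B_def by (intro sets.finite_UN; simp add: I_def)+
  have "E \<subseteq> (\<Union>n. B n)"
  proof
    fix x assume "x \<in> E"
    then obtain i where "i \<in> C" "x \<in> cball i (5 * \<delta> i)" using C(4) by blast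
    then show "x \<in> (\<Union>n. B n)" using I by (force simp: B_def)
  qed
  then have cover: "E \<subseteq> (\<Union>n. B n)" .
  have "(\<Sum>n. emeasure \<nu> (A n)) = emeasure \<nu> (\<Union>n. A n)"
  proof (rule suminf_emeasure)
    show "disjoint_family A"
      unfolding disjoint_family_on_def
    proof (intro ballI impI)
      fix k l :: nat assume "k \<noteq> l"
      have "cball x (\<delta> x) \<inter> cball y (\<delta> y) = {}" if "x \<in> I k" "y \<in> I l" for x y
        using pairwiseD[OF C(3), of x y] that \<open>k \<noteq> l\<close> unfolding I disjnt_def by auto
      then show "A k \<inter> A l = {}" unfolding A_def by blast
    qed
  qed (auto simp: \<nu>_def)
  also have "\<dots> \<le> emeasure \<nu> UNIV" by (intro emeasure_mono) (auto simp: \<nu>_def)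
  also have "\<dots> = emeasure \<nu> {-2*pi..4*pi}"
    unfolding \<nu>_def by (auto simp: emeasure_density intro!: nn_integral_cong simp: indicator_def)
  also have "\<dots> = ennreal (3 * integral {0..2*pi} \<psi>)"
    using integral_circle_three_periods[of "\<lambda>z. cmod (g z)"] \<psi>c by (subst \<nu>_Icc) (auto simp: \<psi>_def[abs_def])
  finally have sum_le: "(\<Sum>n. emeasure \<nu> (A n)) \<le> ennreal (3 * integral {0..2*pi} \<psi>)" .
  from cover have "emeasure lborel E \<le> emeasure lborel (\<Union>n. B n)"
    by (intro emeasure_mono) auto
  also have "\<dots> \<le> (\<Sum>n. emeasure lborel (B n))"
    by (rule emeasure_subadditive_countably) auto
  also have "\<dots> \<le> (\<Sum>n. ennreal (5 / m) * emeasure \<nu> (A n))"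
    by (intro suminf_le AB) auto
  also have "\<dots> = ennreal (5 / m) * (\<Sum>n. emeasure \<nu> (A n))" by simp
  also have "\<dots> \<le> ennreal (5 / m) * ennreal (3 * integral {0..2*pi} \<psi>)"
    by (rule mult_left_mono[OF sum_le]) simp
  also have "\<dots> = ennreal (15 / m * integral {0..2*pi} \<psi>)"
    using m by (simp flip: ennreal_mult')
  finally show ?thesis by (simp add: E_def \<psi>_def[abs_def])
qed

section \<open>Radial limits of bounded holomorphic functions\<close>

text \<open>Cauchy's criterion with countably many tolerances, the form in which convergence is seen to be a
  Borel condition.\<close>

lemma ex_tendsto_at_left_iff:
  fixes f :: "real \<Rightarrow> complex"
  shows "(\<exists>l. (f \<longlongrightarrow> l) (at_left a)) \<longleftrightarrow>
     (\<forall>n::nat. \<exists>k::nat. \<forall>x y. a - 1 / (real k + 1) < x \<and> x < a \<and> a - 1 / (real k + 1) < y \<and> y < a \<longrightarrow> dist (f x) (f y) \<le> 1 / (real n + 1))"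
  (is "?L \<longleftrightarrow> ?R")
proof
  assume ?L
  then obtain l where l: "(f \<longlongrightarrow> l) (at_left a)" ..
  show ?R
  proof
    fix n :: nat
    have "\<forall>\<^sub>F x in at_left a. dist (f x) l < 1 / (2 * (real n + 1))"
      using l by (rule tendstoD) simp
    then obtain b where b: "b < a" "\<And>x. b < x \<Longrightarrow> x < a \<Longrightarrow> dist (f x) l < 1 / (2 * (real n + 1))"
      unfolding eventually_at_left_field by auto
    obtain k where k: "1 / (real k + 1) < a - b"
      using reals_Archimedean[of "a - b"] b(1) by (auto simp: inverse_eq_divide add.commute)
    have "dist (f x) (f y) \<le> 1 / (real n + 1)"
      if "a - 1 / (real k + 1) < x" "x < a" "a - 1 / (real k + 1) < y" "y < a" for x y
    proof -
      have "dist (f x) (f y) \<le> dist (f x) l + dist (f y) l" by (rule dist_triangle2)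
      also have "\<dots> \<le> 1 / (2 * (real n + 1)) + 1 / (2 * (real n + 1))"
        using that k b(2)[of x] b(2)[of y] by (intro add_mono) auto
      finally show ?thesis by (simp add: field_simps)
    qed
    then show "\<exists>k::nat. \<forall>x y. a - 1 / (real k + 1) < x \<and> x < a \<and> a - 1 / (real k + 1) < y \<and> y < a \<longrightarrow> dist (f x) (f y) \<le> 1 / (real n + 1)"
      by blast
  qed
next
  assume R: ?R
  define X where "X j = f (a - 1 / (real j + 2))" for j
  have small: "\<exists>d<a. \<forall>x y. d < x \<and> x < a \<and> d < y \<and> y < a \<longrightarrow> dist (f x) (f y) < e" if "e > 0" for e
  proof -
    obtain n where n: "1 / (real n + 1) < e" using reals_Archimedean[OF \<open>e > 0\<close>] by (auto simp: inverse_eq_divide add.commute)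
    obtain k :: nat where "\<forall>x y. a - 1 / (real k + 1) < x \<and> x < a \<and> a - 1 / (real k + 1) < y \<and> y < a \<longrightarrow> dist (f x) (f y) \<le> 1 / (real n + 1)"
      using R by blast
    then show ?thesis using n by (intro exI[of _ "a - 1 / (real k + 1)"]) force
  qed
  have ev: "\<forall>\<^sub>F j in sequentially. d < a - 1 / (real j + 2)" if "d < a" for d
  proof -
    have "(\<lambda>j. a - inverse (real (Suc (Suc j)))) \<longlonglongrightarrow> a - 0"
      by (intro tendsto_diff tendsto_const LIMSEQ_Suc[OF LIMSEQ_inverse_real_of_nat])
    then have "(\<lambda>j. a - 1 / (real j + 2)) \<longlonglongrightarrow> a"
      by (simp add: inverse_eq_divide add.commute)
    then show ?thesis using that by (simp add: order_tendstoD)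
  qed
  have "Cauchy X"
  proof (rule metric_CauchyI)
    fix e :: real assume "e > 0"
    then obtain d where d: "d < a" "\<And>x y. d < x \<and> x < a \<and> d < y \<and> y < a \<Longrightarrow> dist (f x) (f y) < e"
      using small by meson
    obtain M where "\<And>j. j \<ge> M \<Longrightarrow> d < a - 1 / (real j + 2)"
      using ev[OF d(1)] by (auto simp: eventually_sequentially)
    then show "\<exists>M. \<forall>m\<ge>M. \<forall>n\<ge>M. dist (X m) (X n) < e"
      unfolding X_def by (intro exI[of _ M] allI impI d(2)) auto
  qed
  then obtain l where l: "X \<longlonglongrightarrow> l" using Cauchy_convergent convergent_def by blast
  have "(f \<longlongrightarrow> l) (at_left a)"
  proof (rule tendstoI)
    fix e :: real assume "e > 0"
    then obtain d where d: "d < a" "\<And>x y. d < x \<and> x < a \<and> d < y \<and> y < a \<Longrightarrow> dist (f x) (f y) < e / 2"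
      using small[of "e / 2"] by auto
    have "\<forall>\<^sub>F j in sequentially. dist (X j) l < e / 2 \<and> d < a - 1 / (real j + 2)"
      using tendstoD[OF l, of "e / 2"] ev[OF d(1)] \<open>e > 0\<close> by (auto intro: eventually_conj)
    then obtain j where j: "dist (X j) l < e / 2" "d < a - 1 / (real j + 2)"
      using eventually_happens by force
    have "dist (f x) l < e" if "d < x" "x < a" for x
      using d(2)[of x "a - 1 / (real j + 2)"] that j dist_triangle[of "f x" l "X j"] by (simp add: X_def)
    then show "\<forall>\<^sub>F x in at_left a. dist (f x) l < e"
      unfolding eventually_at_left_field using d(1) by blast
  qed
  then show ?L ..
qed

lemma mult_less_one:
  fixes x y :: real
  shows "0 \<le> x \<Longrightarrow> x \<le> 1 \<Longrightarrow> 0 \<le> y \<Longrightarrow> y < 1 \<Longrightarrow> x * y < 1"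
  using mult_left_le_one_le[of y x] by linarith

lemma holomorphic_on_dilation:
  assumes g: "g holomorphic_on ball 0 1" and c: "cmod c \<le> 1"
  shows "(\<lambda>z. g (c * z)) holomorphic_on ball 0 1"
proof -
  have "(\<lambda>z. c * z) ` ball 0 1 \<subseteq> ball 0 1"
    using c by (auto simp: norm_mult intro!: mult_less_one)
  then have "(g \<circ> (\<lambda>z. c * z)) holomorphic_on ball 0 1"
    by (intro holomorphic_on_compose_gen[OF _ g] holomorphic_intros)
  then show ?thesis by (simp add: o_def)
qed

lemma circle_coefficient:
  fixes b :: "complex \<Rightarrow> complex"
  assumes b: "b holomorphic_on ball 0 1" and r: "0 < r" "r < 1"
  shows "((\<lambda>t. b (of_real r * cis t) * cis (- (of_nat n * t))) has_integral
     2 * pi * ((deriv ^^ n) b 0 / fact n) * of_real r ^ n) {0..2*pi}"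
proof -
  have "cball 0 r \<subseteq> ball (0::complex) 1" using r by auto
  then have hr: "b holomorphic_on cball 0 r" by (rule holomorphic_on_subset[OF b])
  have "continuous_on (cball 0 r) b" "b holomorphic_on ball 0 r"
    by (rule holomorphic_on_imp_continuous_on[OF hr], rule holomorphic_on_subset[OF hr ball_subset_cball])
  then have "((\<lambda>u. b u / (u - 0) ^ Suc n) has_contour_integral (2 * pi * \<i>) / fact n * (deriv ^^ n) b 0) (circlepath 0 r)"
    by (rule Cauchy_has_contour_integral_higher_derivative_circlepath) (use r in auto)
  then have "((\<lambda>t. b (of_real r * cis t) / (of_real r * cis t) ^ Suc n * of_real r * \<i> * cis t)
      has_integral (2 * pi * \<i>) / fact n * (deriv ^^ n) b 0) {0..2*pi}"
    unfolding circlepath_def by (subst (asm) has_contour_integral_part_circlepath_iff) simp_all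
  then have X: "((\<lambda>t. - \<i> * of_real r ^ n * (b (of_real r * cis t) / (of_real r * cis t) ^ Suc n * of_real r * \<i> * cis t))
      has_integral - \<i> * of_real r ^ n * ((2 * pi * \<i>) / fact n * (deriv ^^ n) b 0)) {0..2*pi}"
    by (rule has_integral_mult_right)
  have e1: "- \<i> * of_real r ^ n * (b (of_real r * cis t) / (of_real r * cis t) ^ Suc n * of_real r * \<i> * cis t)
      = b (of_real r * cis t) * cis (- (of_nat n * t))" for t
    using r Complex.DeMoivre[of t n] by (simp add: field_simps power_mult_distrib flip: cis_inverse)
  have e2: "- \<i> * of_real r ^ n * ((2 * pi * \<i>) / fact n * (deriv ^^ n) b 0)
      = 2 * pi * ((deriv ^^ n) b 0 / fact n) * of_real r ^ n"
    by (simp add: field_simps)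
  show ?thesis using X unfolding e1 e2 .
qed

text \<open>Parseval's identity for two radii. The inner product depends on \<open>r \<rho>\<close> alone, so the distance between
  \<open>b\<close> and a dilation of \<open>b\<close> can be read off from a single power series.\<close>

lemma circle_inner_product:
  fixes b :: "complex \<Rightarrow> complex"
  assumes b: "b holomorphic_on ball 0 1" and r: "0 < r" "r < 1" and \<rho>: "0 < \<rho>" "\<rho> < 1"
  shows "(\<lambda>n. 2 * pi * (cmod ((deriv ^^ n) b 0 / fact n))\<^sup>2 * (r * \<rho>) ^ n) sums
     Re (integral {0..2*pi} (\<lambda>t. b (of_real r * cis t) * cnj (b (of_real \<rho> * cis t))))"
proof -
  define a where "a n = (deriv ^^ n) b 0 / fact n" for n
  define br where "br t = b (of_real r * cis t)" for t
  have bc: "continuous_on (ball 0 1) b" using b by (rule holomorphic_on_imp_continuous_on)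
  have c: "continuous_on {0..2*pi} br" unfolding br_def
    by (intro continuous_intros continuous_on_compose2[OF bc]) (use r in \<open>auto simp: norm_mult\<close>)
  then obtain B where B: "\<And>t. t \<in> {0..2*pi} \<Longrightarrow> cmod (br t) \<le> B"
    using compact_imp_bounded[OF compact_continuous_image[OF c compact_Icc]]
    unfolding bounded_iff by blast
  have ser: "(\<lambda>n. a n * w ^ n) sums b w" if "cmod w < 1" for w
    using holomorphic_power_series[OF b, of w] that by (simp add: a_def)
  have "summable (\<lambda>n. cmod (a n * of_real \<rho> ^ n))"
  proof (rule powser_insidea)
    show "summable (\<lambda>n. a n * (of_real ((\<rho> + 1) / 2)) ^ n)"
      by (rule sums_summable[OF ser]) (use \<rho> in \<open>auto simp del: of_real_divide of_real_add\<close>)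
  qed (use \<rho> in \<open>auto simp del: of_real_divide of_real_add\<close>)
  then have sM: "summable (\<lambda>n. B * cmod (a n * of_real \<rho> ^ n))" by (rule summable_mult)
  define f where "f n t = br t * cnj (a n * (of_real \<rho> * cis t) ^ n)" for n t
  have "uniform_limit {0..2*pi} (\<lambda>N t. \<Sum>n<N. f n t) (\<lambda>t. suminf (\<lambda>n. f n t)) sequentially"
    by (rule Weierstrass_m_test[OF _ sM])
      (use B in \<open>auto simp: f_def norm_mult norm_power intro!: mult_right_mono\<close>)
  moreover have "suminf (\<lambda>n. f n t) = br t * cnj (b (of_real \<rho> * cis t))" for t
  proof -
    have "(\<lambda>n. cnj (a n * (of_real \<rho> * cis t) ^ n)) sums cnj (b (of_real \<rho> * cis t))"
      using ser[of "of_real \<rho> * cis t"] \<rho> unfolding sums_cnj by (simp add: norm_mult)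
    then show ?thesis unfolding f_def by (intro sums_unique[symmetric] sums_mult)
  qed
  ultimately have "uniform_limit {0..2*pi} (\<lambda>N t. \<Sum>n<N. f n t) (\<lambda>t. br t * cnj (b (of_real \<rho> * cis t))) sequentially"
    by simp
  then obtain I J where IJ: "\<And>N. ((\<lambda>t. \<Sum>n<N. f n t) has_integral I N) {0..2*pi}"
      "((\<lambda>t. br t * cnj (b (of_real \<rho> * cis t))) has_integral J) {0..2*pi}" "(I \<longlongrightarrow> J) sequentially"
    by (rule uniform_limit_integral) (auto simp: f_def intro!: continuous_intros c)
  have fi: "(f n has_integral of_real (2 * pi * (cmod (a n))\<^sup>2 * (r * \<rho>) ^ n)) {0..2*pi}" for n
  proof -
    have "((\<lambda>t. cnj (a n) * of_real \<rho> ^ n * (br t * cis (- (of_nat n * t)))) has_integral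
       cnj (a n) * of_real \<rho> ^ n * (2 * pi * a n * of_real r ^ n)) {0..2*pi}"
      using circle_coefficient[OF b r, of n] unfolding br_def a_def by (intro has_integral_mult_right) simp
    moreover have "cnj (a n) * of_real \<rho> ^ n * (br t * cis (- (of_nat n * t))) = f n t" for t
      using Complex.DeMoivre[of "-t" n] by (simp add: f_def power_mult_distrib cis_cnj)
    moreover have "cnj (a n) * of_real \<rho> ^ n * (2 * pi * a n * of_real r ^ n) = of_real (2 * pi * (cmod (a n))\<^sup>2 * (r * \<rho>) ^ n)"
      by (simp add: complex_norm_square power_mult_distrib mult_ac del: of_real_power flip: of_real_power)
    ultimately show ?thesis by (simp only:)
  qed
  have "I N = of_real (\<Sum>n<N. 2 * pi * (cmod (a n))\<^sup>2 * (r * \<rho>) ^ n)" for N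
  proof -
    have "((\<lambda>t. \<Sum>n<N. f n t) has_integral (\<Sum>n<N. of_real (2 * pi * (cmod (a n))\<^sup>2 * (r * \<rho>) ^ n))) {0..2*pi}"
      by (intro has_integral_sum fi) auto
    from has_integral_unique[OF IJ(1) this] show ?thesis by (simp only: of_real_sum)
  qed
  then have "(\<lambda>N. Re (I N)) = (\<lambda>N. \<Sum>n<N. 2 * pi * (cmod (a n))\<^sup>2 * (r * \<rho>) ^ n)" by simp
  with tendsto_Re[OF IJ(3)] have "(\<lambda>n. 2 * pi * (cmod (a n))\<^sup>2 * (r * \<rho>) ^ n) sums Re J"
    by (simp add: sums_def)
  with IJ(2) show ?thesis by (simp add: integral_unique a_def br_def)
qed

text \<open>With \<open>Q x = \<Sum>2 \<pi> |a\<^sub>n|\<^sup>2 x\<^sup>n\<close> the square of the \<open>L\<^sup>2\<close> distance on the circle of radius \<open>r\<close> is \<open>Q(r\<^sup>2) + Q(s\<^sup>2 r\<^sup>2) - 2 Q(s r\<^sup>2)\<close>.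
  Since \<open>Q\<close> increases and is bounded, this is small once \<open>Q(s\<^sup>3)\<close> is close to the supremum of \<open>Q\<close>.\<close>

lemma bounded_dilation_L1:
  fixes b :: "complex \<Rightarrow> complex"
  assumes b: "b holomorphic_on ball 0 1" and bd: "\<And>z. cmod z < 1 \<Longrightarrow> cmod (b z) \<le> B" and e: "0 < e"
  obtains s where "0 < s" "s < 1"
    "\<And>r. s \<le> r \<Longrightarrow> r < 1 \<Longrightarrow> integral {0..2*pi} (\<lambda>t. cmod (b (of_real r * cis t) - b (of_real (s * r) * cis t))) \<le> e"
proof -
  define c where "c n = 2 * pi * (cmod ((deriv ^^ n) b 0 / fact n))\<^sup>2" for n
  define Q where "Q x = (\<Sum>n. c n * x ^ n)" for x :: real
  define P where "P r \<rho> = integral {0..2*pi} (\<lambda>t. b (of_real r * cis t) * cnj (b (of_real \<rho> * cis t)))" for r \<rho>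
  have bc: "continuous_on (ball 0 1) b" using b by (rule holomorphic_on_imp_continuous_on)
  have br: "continuous_on S (\<lambda>t. b (of_real r * cis t))" if "0 < r" "r < 1" for r S
    by (intro continuous_intros continuous_on_compose2[OF bc]) (use that in \<open>auto simp: norm_mult\<close>)
  have sums: "(\<lambda>n. c n * (r * \<rho>) ^ n) sums Re (P r \<rho>)" if "0 < r" "r < 1" "0 < \<rho>" "\<rho> < 1" for r \<rho>
    using circle_inner_product[OF b that] by (simp add: c_def P_def)
  have PQ: "Re (P r \<rho>) = Q (r * \<rho>)" if "0 < r" "r < 1" "0 < \<rho>" "\<rho> < 1" for r \<rho>
    using sums[OF that] by (simp add: Q_def sums_unique)
  have c0: "c n \<ge> 0" for n by (simp add: c_def)
  have sq: "summable (\<lambda>n. c n * x ^ n)" if "0 < x" "x < 1" for x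
    using sums[of "sqrt x" "sqrt x"] that by (auto simp: sums_iff)
  have Qmono: "Q x \<le> Q y" if "0 < x" "x \<le> y" "y < 1" for x y
    unfolding Q_def by (intro suminf_le sq mult_left_mono power_mono c0) (use that in auto)
  have Qb: "Q x \<le> 2 * pi * B\<^sup>2" if "0 < x" "x < 1" for x
  proof -
    have s: "0 < sqrt x" "sqrt x < 1" using that by auto
    have "norm (P (sqrt x) (sqrt x)) \<le> integral {0..2*pi} (\<lambda>t. B\<^sup>2)"
      unfolding P_def
    proof (rule integral_norm_bound_integral)
      show "norm (b (of_real (sqrt x) * cis t) * cnj (b (of_real (sqrt x) * cis t))) \<le> B\<^sup>2" for t
        unfolding norm_mult complex_mod_cnj power2_eq_square
        by (intro mult_mono bd) (use s order_trans[OF norm_ge_zero bd, of 0] in \<open>auto simp: norm_mult\<close>)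
    qed (use br[OF s] in \<open>auto intro!: integrable_continuous_real continuous_intros\<close>)
    then show ?thesis using PQ[OF s s] complex_Re_le_cmod[of "P (sqrt x) (sqrt x)"] that by simp
  qed
  define L where "L = Sup (Q ` {0<..<1})"
  have bdd: "bdd_above (Q ` {0<..<1})" using Qb by (auto intro!: bdd_aboveI2)
  have QL: "Q x \<le> L" if "0 < x" "x < 1" for x
    unfolding L_def by (rule cSup_upper) (use bdd that in auto)
  define \<eta> where "\<eta> = e / 4"
  have "\<eta> > 0" using e by (simp add: \<eta>_def)
  then obtain x0 where x0: "0 < x0" "x0 < 1" "L - \<eta>\<^sup>2 < Q x0"
    using less_cSup_iff[of "Q ` {0<..<1}" "L - \<eta>\<^sup>2"] bdd unfolding L_def[symmetric] by (auto simp: L_def)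
  \<comment> \<open>For \<open>s \<le> r\<close> the product \<open>s r\<^sup>2\<close> is at least \<open>s\<^sup>3 = x0\<close>.\<close>
  define s where "s = root 3 x0"
  have s: "0 < s" "s < 1" "s ^ 3 = x0" using x0 by (auto simp: s_def)
  show ?thesis
  proof (rule that[OF s(1,2)])
    fix r assume r: "s \<le> r" "r < 1"
    then have r0: "0 < r" and sr: "0 < s * r" "s * r < 1" using s by (auto intro!: mult_less_one)
    define h where "h t = b (of_real r * cis t) - b (of_real (s * r) * cis t)" for t
    have hc: "continuous_on {0..2*pi} h" unfolding h_def by (intro continuous_intros br r0 r sr)
    have "integral {0..2*pi} (\<lambda>t. (cmod (h t))\<^sup>2) = Re (P r r) + Re (P (s*r) (s*r)) - 2 * Re (P r (s*r))"
    proof -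
      have i: "(\<lambda>t. b (of_real u * cis t) * cnj (b (of_real v * cis t))) integrable_on {0..2*pi}"
        if "0 < u" "u < 1" "0 < v" "v < 1" for u v
        using that by (intro integrable_continuous_real continuous_intros br)
      have Pint: "((\<lambda>t. Re (b (of_real u * cis t) * cnj (b (of_real v * cis t)))) has_integral Re (P u v)) {0..2*pi}"
        if "0 < u" "u < 1" "0 < v" "v < 1" for u v
        unfolding P_def by (intro has_integral_Re integrable_integral i that)
      have "((\<lambda>t. (cmod (h t))\<^sup>2) has_integral Re (P r r) + Re (P (s*r) (s*r)) - 2 * Re (P r (s*r))) {0..2*pi}"
      proof (rule has_integral_eq)
        show "((\<lambda>t. Re (b (of_real r * cis t) * cnj (b (of_real r * cis t)))
           + Re (b (of_real (s*r) * cis t) * cnj (b (of_real (s*r) * cis t)))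
           - 2 * Re (b (of_real r * cis t) * cnj (b (of_real (s*r) * cis t)))) has_integral
            Re (P r r) + Re (P (s*r) (s*r)) - 2 * Re (P r (s*r))) {0..2*pi}"
          by (intro has_integral_diff has_integral_add has_integral_mult_right Pint r0 r sr)
        have "Re (u * cnj u) + Re (v * cnj v) - 2 * Re (u * cnj v) = (cmod (u - v))\<^sup>2" for u v
          unfolding cmod_power2 by (simp add: power2_eq_square algebra_simps)
        then show "Re (b (of_real r * cis t) * cnj (b (of_real r * cis t)))
           + Re (b (of_real (s*r) * cis t) * cnj (b (of_real (s*r) * cis t)))
           - 2 * Re (b (of_real r * cis t) * cnj (b (of_real (s*r) * cis t))) = (cmod (h t))\<^sup>2" for t
          unfolding h_def .
      qed
      then show ?thesis by (rule integral_unique)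
    qed
    also have "\<dots> = Q (r * r) + Q (s*r*(s*r)) - 2 * Q (r * (s*r))"
      by (simp add: PQ r0 r sr del: mult.assoc)
    also have "\<dots> \<le> L - Q x0"
    proof -
      have 1: "r * r < 1" "r * (s * r) < 1" "0 < r * (s * r)"
        using r0 r s sr by (auto intro!: mult_less_one)
      have 2: "s * r * (s * r) \<le> r * (s * r)" using s r0 by (intro mult_right_mono) auto
      have 3: "x0 \<le> r * (s * r)"
      proof -
        have "s * (s * s) \<le> r * (s * r)" using s r by (intro mult_mono) auto
        then show ?thesis using s(3) by (simp add: power3_eq_cube)
      qed
      have "Q (s*r*(s*r)) \<le> Q (r * (s*r))" by (rule Qmono) (use 1 2 sr in auto)
      moreover have "Q x0 \<le> Q (r * (s*r))" by (rule Qmono) (use 1 3 x0 in auto)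
      moreover have "Q (r * r) \<le> L" by (rule QL) (use 1 r0 in auto)
      ultimately show ?thesis by simp
    qed
    finally have h2: "integral {0..2*pi} (\<lambda>t. (cmod (h t))\<^sup>2) \<le> \<eta>\<^sup>2" using x0 by simp
    \<comment> \<open>The arithmetic-geometric mean inequality in place of Cauchy--Schwarz; \<open>1/2 + \<pi> < 4\<close> explains \<open>\<eta> = e / 4\<close>.\<close>
    have "integral {0..2*pi} (\<lambda>t. cmod (h t)) \<le> integral {0..2*pi} (\<lambda>t. (cmod (h t))\<^sup>2 / (2 * \<eta>) + \<eta> / 2)"
    proof (rule integral_le)
      show "cmod (h t) \<le> (cmod (h t))\<^sup>2 / (2 * \<eta>) + \<eta> / 2" for t
        using sum_squares_bound[of "cmod (h t)" \<eta>] \<open>\<eta> > 0\<close> by (simp add: field_simps power2_eq_square)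
    qed (intro integrable_continuous_real continuous_intros hc; use \<open>\<eta> > 0\<close> in simp)+
    also have "\<dots> = integral {0..2*pi} (\<lambda>t. (cmod (h t))\<^sup>2) / (2 * \<eta>) + pi * \<eta>"
    proof -
      have "(\<lambda>t. (cmod (h t))\<^sup>2 / (2 * \<eta>)) integrable_on {0..2*pi}"
        by (intro integrable_continuous_real continuous_intros hc; use \<open>\<eta> > 0\<close> in simp)
      then show ?thesis by (subst integral_add) (auto intro: integrable_continuous_real)
    qed
    also have "\<dots> \<le> \<eta>\<^sup>2 / (2 * \<eta>) + pi * \<eta>" using h2 \<open>\<eta> > 0\<close> by (intro add_mono divide_right_mono) auto
    also have "\<dots> \<le> e"
    proof -
      have "pi * \<eta> \<le> 3.5 * \<eta>" using pi_approx \<open>\<eta> > 0\<close> by (intro mult_right_mono) auto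
      moreover have "\<eta>\<^sup>2 / (2 * \<eta>) = \<eta> / 2" using \<open>\<eta> > 0\<close> by (simp add: power2_eq_square)
      ultimately show ?thesis unfolding \<eta>_def by linarith
    qed
    finally show "integral {0..2*pi} (\<lambda>t. cmod (b (of_real r * cis t) - b (of_real (s * r) * cis t))) \<le> e"
      by (simp add: h_def)
  qed
qed

lemma isCont_of_continuous_on_disc:
  "continuous_on (ball 0 1) g \<Longrightarrow> cmod z < 1 \<Longrightarrow> isCont g z"
  by (simp add: continuous_on_eq_continuous_at)

text \<open>The weak type inequality needs continuity up to the circle. It is applied to dilations
  of \<open>h\<close>, whose exceedance sets increase to that of \<open>h\<close>.\<close>

lemma emeasure_radial_exceedance_le:
  fixes h :: "complex \<Rightarrow> complex"
  assumes h: "h holomorphic_on ball 0 1" and m: "0 < m" and s: "0 < s" "s < 1"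
    and le: "\<And>r. s \<le> r \<Longrightarrow> r < 1 \<Longrightarrow> integral {0..2*pi} (\<lambda>t. cmod (h (of_real r * cis t))) \<le> e"
  shows "emeasure lborel (radial_exceedance h m) \<le> ennreal (15 / m * e)"
proof -
  have hc: "continuous_on (ball 0 1) h" using h by (rule holomorphic_on_imp_continuous_on)
  define R where "R k = 1 - (1 - s) / (real k + 1)" for k
  have R: "s \<le> R k" "R k < 1" "0 < R k" for k
  proof -
    have "(1 - s) / (real k + 1) \<le> 1 - s" "(1 - s) / (real k + 1) > 0"
      using s by (auto simp: divide_le_eq mult_le_cancel_left1)
    then show "s \<le> R k" "R k < 1" "0 < R k" using s by (auto simp: R_def)
  qed
  have R_mono: "R k \<le> R l" if "k \<le> l" for k l
    using that s by (simp add: R_def frac_le)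
  define E where "E k = radial_exceedance (\<lambda>z. h (of_real (R k) * z)) m" for k
  have sub: "(\<lambda>z::complex. of_real (R k) * z) ` cball 0 1 \<subseteq> ball 0 1" for k
  proof
    fix w assume "w \<in> (\<lambda>z::complex. of_real (R k) * z) ` cball 0 1"
    then obtain z where z: "cmod z \<le> 1" "w = of_real (R k) * z" by auto
    have "cmod w \<le> R k" using z R(3)[of k] by (simp add: norm_mult mult_left_le)
    then show "w \<in> ball 0 1" using R(2)[of k] by simp
  qed
  have cc: "continuous_on (cball 0 1) (\<lambda>z. h (of_real (R k) * z))" for k
    by (rule continuous_on_compose2[OF hc _ sub]) (auto intro!: continuous_intros)
  have hh: "(\<lambda>z. h (of_real (R k) * z)) holomorphic_on ball 0 1" for k
    by (rule holomorphic_on_dilation[OF h]) (use R[of k] in simp)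
  have E_mem: "x \<in> E k \<longleftrightarrow> x \<in> {0..2*pi} \<and> (\<exists>r. 0 \<le> r \<and> r < R k \<and> m < cmod (h (of_real r * cis x)))" for x k
  proof
    assume "x \<in> E k"
    then obtain r where "x \<in> {0..2*pi}" "0 \<le> r" "r < 1" "m < cmod (h (of_real (R k * r) * cis x))"
      by (auto simp: E_def radial_exceedance_def mult.assoc)
    then show "x \<in> {0..2*pi} \<and> (\<exists>r. 0 \<le> r \<and> r < R k \<and> m < cmod (h (of_real r * cis x)))"
      using R(3)[of k] by (intro conjI exI[of _ "R k * r"]) auto
  next
    assume "x \<in> {0..2*pi} \<and> (\<exists>r. 0 \<le> r \<and> r < R k \<and> m < cmod (h (of_real r * cis x)))"
    then obtain r where "x \<in> {0..2*pi}" "0 \<le> r" "r < R k" "m < cmod (h (of_real r * cis x))" by blast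
    then show "x \<in> E k" unfolding E_def radial_exceedance_def using R(3)[of k]
      by (auto intro!: exI[of _ "r / R k"])
  qed
  have union: "radial_exceedance h m = (\<Union>k. E k)"
  proof (intro set_eqI iffI)
    fix x assume "x \<in> radial_exceedance h m"
    then obtain r where r: "x \<in> {0..2*pi}" "0 \<le> r" "r < 1" "m < cmod (h (of_real r * cis x))"
      by (auto simp: radial_exceedance_def)
    obtain k where "inverse (real (Suc k)) < 1 - r" using reals_Archimedean[of "1 - r"] r by auto
    moreover have "(1 - s) / (real k + 1) \<le> inverse (real (Suc k))" using s by (auto simp: field_simps)
    ultimately have "r < R k" by (simp add: R_def)
    then show "x \<in> (\<Union>k. E k)" using r E_mem by blast
  next
    fix x assume "x \<in> (\<Union>k. E k)"
    then obtain k r where "x \<in> {0..2*pi}" "0 \<le> r" "r < R k" "m < cmod (h (of_real r * cis x))"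
      using E_mem by blast
    with R(2)[of k] show "x \<in> radial_exceedance h m" unfolding radial_exceedance_def
      by (intro CollectI conjI exI[of _ r]) auto
  qed
  have sup: "(SUP k. emeasure lborel (E k)) = emeasure lborel (\<Union>k. E k)"
  proof (rule SUP_emeasure_incseq)
    show "incseq E" unfolding incseq_def
    proof (intro allI impI subsetI)
      fix k l x assume "k \<le> l" "x \<in> E k"
      with E_mem R_mono[of k l] show "x \<in> E l" by (meson order.strict_trans2)
    qed
    have "E k \<in> sets borel" for k unfolding E_def
      by (rule borel_radial_exceedance[OF continuous_on_subset[OF cc ball_subset_cball]])
    then show "range E \<subseteq> sets lborel" by auto
  qed
  have "emeasure lborel (E k) \<le> ennreal (15 / m * e)" for k
  proof -
    have "emeasure lborel (E k) \<le> ennreal (15 / m * integral {0..2*pi} (\<lambda>t. cmod (h (of_real (R k) * cis t))))"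
      unfolding E_def by (rule radial_maximal_weak_type[OF cc hh m])
    also have "\<dots> \<le> ennreal (15 / m * e)" using m le[OF R(1,2)] by (intro ennreal_leI mult_left_mono) auto
    finally show ?thesis .
  qed
  then show ?thesis unfolding union sup[symmetric] by (rule SUP_least)
qed

text \<open>A dilation of \<open>b\<close> extends continuously to the circle, so the oscillation of \<open>b\<close> along a radius is at most
  twice the maximal function of \<open>b\<close> minus its dilation. The latter is small in mean, hence small outside
  a set of small measure.\<close>

theorem bounded_holomorphic_radial_limits:
  fixes b :: "complex \<Rightarrow> complex"
  assumes b: "b holomorphic_on ball 0 1" and bd: "\<And>z. cmod z < 1 \<Longrightarrow> cmod (b z) \<le> B"
  shows "AE t in lborel. t \<in> {0..2*pi} \<longrightarrow> (\<exists>l. ((\<lambda>r. b (of_real r * cis t)) \<longlongrightarrow> l) (at_left 1))"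
proof -
  have bc: "continuous_on (ball 0 1) b" using b by (rule holomorphic_on_imp_continuous_on)
  have null: "\<exists>N\<in>null_sets lborel. \<forall>t\<in>{0..2*pi} - N. \<exists>s. 0 < s \<and> s < 1 \<and> (\<forall>r. 0 \<le> r \<longrightarrow> r < 1 \<longrightarrow>
       cmod (b (of_real r * cis t) - b (of_real (s * r) * cis t)) \<le> m)" if m: "m > 0" for m
  proof -
    have "\<exists>s. 0 < s \<and> s < 1 \<and> emeasure lborel (radial_exceedance (\<lambda>z. b z - b (of_real s * z)) m) \<le> ennreal (1 / Suc j)
        \<and> radial_exceedance (\<lambda>z. b z - b (of_real s * z)) m \<in> sets borel" for j
    proof -
      obtain s where s: "0 < s" "s < 1" and le:
        "\<And>r. s \<le> r \<Longrightarrow> r < 1 \<Longrightarrow> integral {0..2*pi} (\<lambda>t. cmod (b (of_real r * cis t) - b (of_real (s * r) * cis t))) \<le> m / 15 * (1 / Suc j)"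
        using bounded_dilation_L1[where e = "m / 15 * (1 / Suc j)", OF b bd] m by (auto simp del: of_nat_Suc)
      have "(\<lambda>z. b (of_real s * z)) holomorphic_on ball 0 1"
        by (rule holomorphic_on_dilation[OF b]) (use s in simp)
      then have h: "(\<lambda>z. b z - b (of_real s * z)) holomorphic_on ball 0 1" by (intro holomorphic_intros b)
      have le': "integral {0..2*pi} (\<lambda>t. cmod (b (of_real r * cis t) - b (of_real s * (of_real r * cis t)))) \<le> m / 15 * (1 / Suc j)"
        if "s \<le> r" "r < 1" for r
        using le[OF that] by (simp only: of_real_mult mult.assoc)
      have cancel: "15 / m * (m / 15 * x) = x" for x using m by (simp add: field_simps)
      have "emeasure lborel (radial_exceedance (\<lambda>z. b z - b (of_real s * z)) m) \<le> ennreal (1 / Suc j)"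
        using emeasure_radial_exceedance_le[OF h m s le'] unfolding cancel .
      with s borel_radial_exceedance[OF holomorphic_on_imp_continuous_on[OF h]] show ?thesis
        by (intro exI[of _ s] conjI)
    qed
    then obtain s where s: "\<And>j. 0 < s j \<and> s j < 1 \<and> emeasure lborel (radial_exceedance (\<lambda>z. b z - b (of_real (s j) * z)) m) \<le> ennreal (1 / Suc j)
        \<and> radial_exceedance (\<lambda>z. b z - b (of_real (s j) * z)) m \<in> sets borel" by metis
    define E where "E j = radial_exceedance (\<lambda>z. b z - b (of_real (s j) * z)) m" for j
    have [measurable]: "E j \<in> sets borel" for j using s by (simp add: E_def)
    have "emeasure lborel (\<Inter>j. E j) \<le> 0"
    proof (rule LIMSEQ_le_const)
      show "(\<lambda>j. ennreal (1 / Suc j)) \<longlonglongrightarrow> 0"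
        using tendsto_ennrealI[OF LIMSEQ_inverse_real_of_nat] by (simp add: inverse_eq_divide)
      have "emeasure lborel (\<Inter>j. E j) \<le> ennreal (1 / Suc n)" for n
      proof -
        have "emeasure lborel (\<Inter>j. E j) \<le> emeasure lborel (E n)" by (rule emeasure_mono) auto
        also have "\<dots> \<le> ennreal (1 / Suc n)" using s[of n] unfolding E_def by blast
        finally show ?thesis .
      qed
      then show "\<exists>N. \<forall>n\<ge>N. emeasure lborel (\<Inter>j. E j) \<le> ennreal (1 / Suc n)" by blast
    qed
    then have "(\<Inter>j. E j) \<in> null_sets lborel" by (intro null_setsI) auto
    moreover have "\<exists>s. 0 < s \<and> s < 1 \<and> (\<forall>r. 0 \<le> r \<longrightarrow> r < 1 \<longrightarrow>
       cmod (b (of_real r * cis t) - b (of_real (s * r) * cis t)) \<le> m)" if t: "t \<in> {0..2*pi} - (\<Inter>j. E j)" for t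
    proof -
      obtain j where "t \<notin> E j" using t by blast
      with t have "\<forall>r. 0 \<le> r \<longrightarrow> r < 1 \<longrightarrow> cmod (b (of_real r * cis t) - b (of_real (s j * r) * cis t)) \<le> m"
        unfolding E_def radial_exceedance_def by (auto simp: mult.assoc not_less)
      with s[of j] show ?thesis by blast
    qed
    ultimately show ?thesis by blast
  qed
  then have "\<forall>n. \<exists>N\<in>null_sets lborel. \<forall>t\<in>{0..2*pi} - N. \<exists>s. 0 < s \<and> s < 1 \<and> (\<forall>r. 0 \<le> r \<longrightarrow> r < 1 \<longrightarrow>
       cmod (b (of_real r * cis t) - b (of_real (s * r) * cis t)) \<le> 1 / (3 * (real n + 1)))" by simp
  then obtain N where N: "\<And>n::nat. N n \<in> null_sets lborel" "\<And>n t. t \<in> {0..2*pi} - N n \<Longrightarrow> \<exists>s. 0 < s \<and> s < 1 \<and> (\<forall>r. 0 \<le> r \<longrightarrow> r < 1 \<longrightarrow>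
       cmod (b (of_real r * cis t) - b (of_real (s * r) * cis t)) \<le> 1 / (3 * (real n + 1)))" by metis
  have "AE t in lborel. t \<notin> (\<Union>n. N n)" using N(1) by (intro AE_not_in null_sets_UN) auto
  then show ?thesis
  proof (rule eventually_mono, intro impI)
    fix t assume t: "t \<notin> (\<Union>n. N n)" "t \<in> {0..2*pi}"
    show "\<exists>l. ((\<lambda>r. b (of_real r * cis t)) \<longlongrightarrow> l) (at_left 1)"
      unfolding ex_tendsto_at_left_iff
    proof
      fix n :: nat
      obtain s where s: "0 < s" "s < 1" and le: "\<And>r. 0 \<le> r \<Longrightarrow> r < 1 \<Longrightarrow>
         cmod (b (of_real r * cis t) - b (of_real (s * r) * cis t)) \<le> 1 / (3 * (real n + 1))"
        using N(2)[of t n] t by blast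
      have "isCont b (of_real (s * 1) * cis t)"
        by (rule isCont_of_continuous_on_disc[OF bc]) (use s in \<open>simp add: norm_mult\<close>)
      then have "((\<lambda>r. b (of_real (s * r) * cis t)) \<longlongrightarrow> b (of_real (s * 1) * cis t)) (at_left 1)"
        by (rule isCont_tendsto_compose) (intro tendsto_intros)
      then have "\<exists>l. ((\<lambda>r. b (of_real (s * r) * cis t)) \<longlongrightarrow> l) (at_left 1)" ..
      \<comment> \<open>The tolerance \<open>1 / (n + 1)\<close> is split into three parts; \<open>3 (n + 1) = (3 n + 2) + 1\<close>.\<close>
      then obtain k :: nat where k: "\<And>x y. 1 - 1 / (real k + 1) < x \<and> x < 1 \<and> 1 - 1 / (real k + 1) < y \<and> y < 1 \<Longrightarrow>
         dist (b (of_real (s * x) * cis t)) (b (of_real (s * y) * cis t)) \<le> 1 / (3 * (real n + 1))"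
        unfolding ex_tendsto_at_left_iff by (elim allE[of _ "3 * n + 2"]) (auto simp: algebra_simps)
      have "dist (b (of_real x * cis t)) (b (of_real y * cis t)) \<le> 1 / (real n + 1)"
        if "1 - 1 / (real k + 1) < x" "x < 1" "1 - 1 / (real k + 1) < y" "y < 1" for x y
      proof -
        have "1 / (real k + 1) \<le> 1" by simp
        then have "0 \<le> x" "0 \<le> y" using that by linarith+
        then have "dist (b (of_real x * cis t)) (b (of_real y * cis t)) \<le> 1 / (3 * (real n + 1)) + 1 / (3 * (real n + 1)) + 1 / (3 * (real n + 1))"
          using le[of x] le[of y] that k[of x y]
            dist_triangle[of "b (of_real x * cis t)" "b (of_real y * cis t)" "b (of_real (s * x) * cis t)"]
            dist_triangle[of "b (of_real (s * x) * cis t)" "b (of_real y * cis t)" "b (of_real (s * y) * cis t)"]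
            dist_commute[of "b (of_real (s * y) * cis t)" "b (of_real y * cis t)"]
          by (simp add: dist_norm)
        also have "\<dots> = 1 / (real n + 1)" by (simp add: field_simps)
        finally show ?thesis .
      qed
      then show "\<exists>k::nat. \<forall>x y. 1 - 1 / (real k + 1) < x \<and> x < 1 \<and> 1 - 1 / (real k + 1) < y \<and> y < 1 \<longrightarrow>
        dist (b (of_real x * cis t)) (b (of_real y * cis t)) \<le> 1 / (real n + 1)" by blast
    qed
  qed
qed

section \<open>Fatou's theorem for the Hardy space of the disc\<close>

lemma Re_poisson_kernel: "cmod z < 1 \<Longrightarrow> Re (2 * cis t / (cis t - z) - 1) = poisson z t"
proof -
  assume z: "cmod z < 1"
  have nz: "cis t - z \<noteq> 0" using cis_neq_of_cmod_less_one[OF z, of t] by simp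
  have "2 * cis t / (cis t - z) - 1 = (cis t + z) / (cis t - z)" using nz by (simp add: field_simps)
  also have "Re \<dots> = Re ((cis t + z) * cnj (cis t - z)) / (cmod (cis t - z))\<^sup>2"
    by (subst complex_div_cnj) (simp del: complex_cnj_diff)
  also have "Re ((cis t + z) * cnj (cis t - z)) = 1 - (cmod z)\<^sup>2"
    unfolding cmod_power2 using sin_cos_squared_add[of t] by (simp add: algebra_simps power2_eq_square)
  finally show ?thesis by (simp add: poisson_def)
qed

text \<open>The Herglotz kernel \<open>(w + z) / (w - z) = 2 w / (w - z) - 1\<close> has the Poisson kernel as its real part, and
  integrating it over the circle gives a Cauchy integral up to a constant.\<close>

lemma herglotz_integral:
  fixes \<psi> :: "complex \<Rightarrow> real"
  assumes \<psi>: "continuous_on (sphere 0 1) \<psi>" and nn: "\<And>w. 0 \<le> \<psi> w"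
  obtains F where "F holomorphic_on ball 0 1"
    "\<And>z. cmod z < 1 \<Longrightarrow> 2 * pi * Re (F z) = integral {0..2*pi} (\<lambda>t. poisson z t * \<psi> (cis t))"
    "\<And>z. cmod z < 1 \<Longrightarrow> 2 * pi * cmod (F z) \<le> (2 / (1 - cmod z) + 1) * integral {0..2*pi} (\<lambda>t. \<psi> (cis t))"
proof -
  define I where "I = integral {0..2*pi} (\<lambda>t. \<psi> (cis t))"
  define G where "G z = contour_integral (circlepath 0 1) (\<lambda>u. of_real (\<psi> u) / (u - z) ^ 1)" for z
  have c: "continuous_on {0..2*pi} (\<lambda>t. \<psi> (cis t))"
    by (rule continuous_on_compose2[OF \<psi>]) (auto intro!: continuous_intros)
  have kc: "continuous_on {0..2*pi} (\<lambda>t. of_real (\<psi> (cis t)) / (cis t - z) * \<i> * cis t)" if "cmod z < 1" for z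
    using cis_neq_of_cmod_less_one[OF that] by (intro continuous_intros c) auto
  have kint: "((\<lambda>u. of_real (\<psi> u) / (u - z) ^ 1) has_contour_integral
     integral {0..2*pi} (\<lambda>t. of_real (\<psi> (cis t)) / (cis t - z) * \<i> * cis t)) (circlepath 0 1)" if "cmod z < 1" for z
    unfolding circlepath_def
    by (subst has_contour_integral_part_circlepath_iff)
       (use integrable_integral[OF integrable_continuous_real[OF kc[OF that]]] in auto)
  then have Gint: "((\<lambda>u. of_real (\<psi> u) / (u - z) ^ 1) has_contour_integral G z) (circlepath 0 1)" if "cmod z < 1" for z
    using kint[OF that] contour_integral_unique[OF kint[OF that]] unfolding G_def by simp
  have Gval: "G z = integral {0..2*pi} (\<lambda>t. of_real (\<psi> (cis t)) / (cis t - z) * \<i> * cis t)" if "cmod z < 1" for z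
    unfolding G_def by (rule contour_integral_unique[OF kint[OF that]])
  have "continuous_on (path_image (circlepath 0 1)) (\<lambda>u. complex_of_real (\<psi> u))"
    by (intro continuous_intros) (use \<psi> in \<open>simp add: path_image_circlepath_nonneg\<close>)
  from Cauchy_next_derivative_circlepath(2)[OF this Gint]
  have "\<exists>d. (G has_field_derivative d) (at z)" if "cmod z < 1" for z
    using that by auto
  then have Gh: "G holomorphic_on ball 0 1" by (simp add: holomorphic_on_open)
  define F where "F z = (2 * (G z / \<i>) - of_real I) / (2 * pi)" for z
  have Fval: "((\<lambda>t. of_real (\<psi> (cis t)) * (2 * cis t / (cis t - z) - 1)) has_integral 2 * pi * F z) {0..2*pi}"
    if z: "cmod z < 1" for z
  proof -
    have "((\<lambda>t. of_real (\<psi> (cis t)) / (cis t - z) * \<i> * cis t) has_integral G z) {0..2*pi}"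
      using Gval[OF z] integrable_integral[OF integrable_continuous_real[OF kc[OF z]]] by simp
    moreover have "((\<lambda>t. complex_of_real (\<psi> (cis t))) has_integral of_real I) {0..2*pi}"
      unfolding I_def by (intro has_integral_of_real integrable_integral integrable_continuous_real c)
    ultimately have "((\<lambda>t. 2 * ((of_real (\<psi> (cis t)) / (cis t - z) * \<i> * cis t) / \<i>) - complex_of_real (\<psi> (cis t)))
         has_integral 2 * (G z / \<i>) - of_real I) {0..2*pi}"
      by (intro has_integral_diff has_integral_mult_right has_integral_divide)
    moreover have "2 * ((of_real (\<psi> (cis t)) / (cis t - z) * \<i> * cis t) / \<i>) - complex_of_real (\<psi> (cis t))
       = of_real (\<psi> (cis t)) * (2 * cis t / (cis t - z) - 1)" for t
      by (simp add: algebra_simps)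
    ultimately show ?thesis by (simp add: F_def)
  qed
  show ?thesis
  proof (rule that)
    show "F holomorphic_on ball 0 1" unfolding F_def by (intro holomorphic_intros Gh) auto
  next
    fix z :: complex assume z: "cmod z < 1"
    have "((\<lambda>t. Re (of_real (\<psi> (cis t)) * (2 * cis t / (cis t - z) - 1))) has_integral Re (2 * pi * F z)) {0..2*pi}"
      by (rule has_integral_Re[OF Fval[OF z]])
    moreover have "Re (of_real (\<psi> (cis t)) * (2 * cis t / (cis t - z) - 1)) = poisson z t * \<psi> (cis t)" for t
      using Re_poisson_kernel[OF z, of t] by simp
    ultimately have "((\<lambda>t. poisson z t * \<psi> (cis t)) has_integral Re (2 * pi * F z)) {0..2*pi}"
      by (simp only:)
    from integral_unique[OF this] show "2 * pi * Re (F z) = integral {0..2*pi} (\<lambda>t. poisson z t * \<psi> (cis t))"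
      by simp
    have "norm (2 * pi * F z) \<le> integral {0..2*pi} (\<lambda>t. (2 / (1 - cmod z) + 1) * \<psi> (cis t))"
      unfolding integral_unique[OF Fval[OF z], symmetric]
    proof (rule integral_norm_bound_integral)
      show "(\<lambda>t. of_real (\<psi> (cis t)) * (2 * cis t / (cis t - z) - 1)) integrable_on {0..2*pi}"
        using Fval[OF z] by blast
      show "(\<lambda>t. (2 / (1 - cmod z) + 1) * \<psi> (cis t)) integrable_on {0..2*pi}"
        by (intro integrable_continuous_real continuous_intros c)
      fix t
      have "1 - cmod z \<le> cmod (cis t - z)" using norm_triangle_ineq2[of "cis t" z] by simp
      then have "cmod (2 * cis t / (cis t - z)) \<le> 2 / (1 - cmod z)"
        using z by (auto simp: norm_divide norm_mult intro!: divide_left_mono mult_pos_pos)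
      then have "cmod (2 * cis t / (cis t - z) - 1) \<le> 2 / (1 - cmod z) + 1"
        using norm_triangle_ineq4[of "2 * cis t / (cis t - z)" 1] by simp
      from mult_right_mono[OF this nn[of "cis t"]]
      show "norm (of_real (\<psi> (cis t)) * (2 * cis t / (cis t - z) - 1)) \<le> (2 / (1 - cmod z) + 1) * \<psi> (cis t)"
        using nn by (simp add: norm_mult mult.commute)
    qed
    then show "2 * pi * cmod (F z) \<le> (2 / (1 - cmod z) + 1) * integral {0..2*pi} (\<lambda>t. \<psi> (cis t))"
      by (simp add: norm_mult)
  qed
qed

text \<open>The Poisson integrals of \<open>|g|\<close> on circles of radius tending to 1 majorise the dilations of \<open>|g|\<close>. They
  are real parts of Herglotz integrals, which are locally bounded because the means of \<open>|g|\<close> are; Montel's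
  theorem gives a limit.\<close>

lemma H1_holomorphic_majorant:
  fixes g :: "complex \<Rightarrow> complex"
  assumes g: "g holomorphic_on ball 0 1"
    and C: "\<And>r. 0 \<le> r \<Longrightarrow> r < 1 \<Longrightarrow> integral {0..2*pi} (\<lambda>t. cmod (g (of_real r * cis t))) \<le> C"
  obtains F where "F holomorphic_on ball 0 1" "\<And>z. cmod z < 1 \<Longrightarrow> cmod (g z) \<le> Re (F z)"
proof -
  have gc: "continuous_on (ball 0 1) g" using g by (rule holomorphic_on_imp_continuous_on)
  define s where "s k = 1 - 1 / (real k + 2)" for k :: nat
  have s: "0 < s k" "s k < 1" for k by (auto simp: s_def)
  have slim: "s \<longlonglongrightarrow> 1"
  proof -
    have "(\<lambda>j. 1 - inverse (real (Suc (Suc j)))) \<longlonglongrightarrow> 1 - 0"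
      by (intro tendsto_diff tendsto_const LIMSEQ_Suc[OF LIMSEQ_inverse_real_of_nat])
    then show ?thesis by (simp add: s_def[abs_def] inverse_eq_divide add.commute)
  qed
  define \<phi> where "\<phi> k F \<longleftrightarrow> F holomorphic_on ball 0 1 \<and> (\<forall>z. cmod z < 1 \<longrightarrow> cmod (g (of_real (s k) * z)) \<le> Re (F z)
     \<and> 2 * pi * cmod (F z) \<le> (2 / (1 - cmod z) + 1) * C)" for k F
  have "\<exists>F. \<phi> k F" for k
  proof -
    define h where "h z = g (of_real (s k) * z)" for z
    have hc: "continuous_on (cball 0 1) h" unfolding h_def
      by (intro continuous_intros continuous_on_compose2[OF gc])
         (use s[of k] in \<open>auto simp: norm_mult intro!: le_less_trans[OF mult_left_le]\<close>)
    have hh: "h holomorphic_on ball 0 1"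
      unfolding h_def by (rule holomorphic_on_dilation[OF g]) (use s[of k] in simp)
    obtain F where F: "F holomorphic_on ball 0 1"
      "\<And>z. cmod z < 1 \<Longrightarrow> 2 * pi * Re (F z) = integral {0..2*pi} (\<lambda>t. poisson z t * cmod (h (cis t)))"
      "\<And>z. cmod z < 1 \<Longrightarrow> 2 * pi * cmod (F z) \<le> (2 / (1 - cmod z) + 1) * integral {0..2*pi} (\<lambda>t. cmod (h (cis t)))"
      by (rule herglotz_integral[of "\<lambda>w. cmod (h w)"])
         (auto intro!: continuous_intros continuous_on_subset[OF hc])
    have "\<phi> k F"
      unfolding \<phi>_def
    proof (intro conjI allI impI F)
      fix z assume z: "cmod z < 1"
      have "2 * pi * cmod (h z) \<le> 2 * pi * Re (F z)"
        using norm_le_poisson_integral[OF hc hh z] F(2)[OF z] by simp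
      then show "cmod (g (of_real (s k) * z)) \<le> Re (F z)" by (simp add: h_def)
      have "2 * pi * cmod (F z) \<le> (2 / (1 - cmod z) + 1) * integral {0..2*pi} (\<lambda>t. cmod (h (cis t)))" by (rule F(3)[OF z])
      also have "\<dots> \<le> (2 / (1 - cmod z) + 1) * C"
        using C[of "s k"] s[of k] z by (intro mult_left_mono) (auto simp: h_def)
      finally show "2 * pi * cmod (F z) \<le> (2 / (1 - cmod z) + 1) * C" .
    qed
    then show ?thesis by blast
  qed
  then obtain F where F: "\<And>k. \<phi> k (F k)" by metis
  have bound: "\<exists>B. \<forall>h\<in>range F. \<forall>z\<in>K. cmod (h z) \<le> B" if K: "compact K" "K \<subseteq> ball 0 1" for K
  proof -
    have "continuous_on K (\<lambda>z. (2 / (1 - cmod z) + 1) * C / (2 * pi))"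
      using K(2) by (intro continuous_intros) auto
    then have "bounded ((\<lambda>z. (2 / (1 - cmod z) + 1) * C / (2 * pi)) ` K)"
      using K(1) compact_continuous_image compact_imp_bounded by blast
    then obtain B where B: "\<And>z. z \<in> K \<Longrightarrow> norm ((2 / (1 - cmod z) + 1) * C / (2 * pi)) \<le> B"
      unfolding bounded_iff by blast
    have "cmod (F k z) \<le> B" if "z \<in> K" for k z
    proof -
      have "cmod z < 1" using that K(2) by auto
      then have "cmod (F k z) \<le> (2 / (1 - cmod z) + 1) * C / (2 * pi)"
        using F[of k] unfolding \<phi>_def by (simp add: field_simps)
      also have "\<dots> \<le> B" using B[OF that] by (metis abs_ge_self order_trans real_norm_def)
      finally show ?thesis .
    qed
    then show ?thesis by blast
  qed
  obtain G \<sigma> where G: "G holomorphic_on ball 0 1" "strict_mono (\<sigma> :: nat \<Rightarrow> nat)"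
      "\<And>x. x \<in> ball 0 1 \<Longrightarrow> ((\<lambda>n. F (\<sigma> n) x) \<longlongrightarrow> G x) sequentially"
    by (rule Montel[of "ball 0 1" "range F" F])
       (use F bound in \<open>auto simp: \<phi>_def\<close>)
  show ?thesis
  proof (rule that[OF G(1)])
    fix z assume z: "cmod z < 1"
    have "(\<lambda>n. cmod (g (of_real (s (\<sigma> n)) * z))) \<longlonglongrightarrow> cmod (g (of_real 1 * z))"
    proof (intro tendsto_norm isCont_tendsto_compose[of _ g] tendsto_intros)
      show "isCont g (of_real 1 * z)"
        by (rule isCont_of_continuous_on_disc[OF gc]) (use z in simp)
      show "(\<lambda>n. s (\<sigma> n)) \<longlonglongrightarrow> 1"
        using LIMSEQ_subseq_LIMSEQ[OF slim G(2)] by (simp add: o_def)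
    qed
    moreover have "(\<lambda>n. Re (F (\<sigma> n) z)) \<longlonglongrightarrow> Re (G z)"
      using G(3)[of z] z by (intro tendsto_Re) auto
    ultimately show "cmod (g z) \<le> Re (G z)"
      using F z by (intro LIMSEQ_le[where X = "\<lambda>n. cmod (g (of_real (s (\<sigma> n)) * z))"]) (auto simp: \<phi>_def)
  qed
qed

text \<open>\<open>ln |F|\<close> is the real part of the holomorphic function \<open>Ln F\<close>, so its means over circles are constant;
  being nonnegative it has a finite lower limit along almost every radius, by Fatou's lemma.
  Where \<open>1 / F\<close> tends to 0 that lower limit would be infinite.\<close>

lemma radial_limits_inverse_nonzero:
  fixes F :: "complex \<Rightarrow> complex"
  assumes F: "F holomorphic_on ball 0 1" and Re: "\<And>z. cmod z < 1 \<Longrightarrow> 1 \<le> Re (F z)"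
  shows "AE t in lborel. t \<in> {0..2*pi} \<longrightarrow> \<not> ((\<lambda>r. 1 / F (of_real r * cis t)) \<longlongrightarrow> 0) (at_left 1)"
proof -
  have Fc: "continuous_on (ball 0 1) F" using F by (rule holomorphic_on_imp_continuous_on)
  define s where "s k = 1 - 1 / (real k + 2)" for k :: nat
  have s: "0 < s k" "s k < 1" for k by (auto simp: s_def)
  have slim: "filterlim s (at_left 1) sequentially"
  proof -
    have "(\<lambda>j. 1 - inverse (real (Suc (Suc j)))) \<longlonglongrightarrow> 1 - 0"
      by (intro tendsto_diff tendsto_const LIMSEQ_Suc[OF LIMSEQ_inverse_real_of_nat])
    then have "s \<longlonglongrightarrow> 1" by (simp add: s_def[abs_def] inverse_eq_divide add.commute)
    then show ?thesis using s by (simp add: filterlim_at less_imp_neq)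
  qed
  have F1: "1 \<le> cmod (F z)" if "cmod z < 1" for z using Re[OF that] complex_Re_le_cmod[of "F z"] by simp
  define u where "u k t = ln (cmod (F (of_real (s k) * cis t)))" for k t
  have u0: "0 \<le> u k t" for k t unfolding u_def using s[of k] by (intro ln_ge_zero F1) (simp add: norm_mult)
  have uc: "continuous_on S (u k)" for k S
  proof -
    have m: "cmod (of_real (s k) * cis t) < 1" for t using s[of k] by (simp add: norm_mult)
    have "cmod (F (of_real (s k) * cis t)) \<noteq> 0" for t using F1[OF m[of t]] by linarith
    then show ?thesis unfolding u_def
      by (intro continuous_intros continuous_on_compose2[OF Fc]) (use m in auto)
  qed
  have uint: "integral {0..2*pi} (u k) = 2 * pi * ln (cmod (F 0))" for k
  proof -
    define h where "h z = Ln (F (of_real (s k) * z))" for z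
    have pos: "F z \<notin> \<real>\<^sub>\<le>\<^sub>0" if "cmod z < 1" for z using Re[OF that] by (auto simp: complex_nonpos_Reals_iff)
    have sub: "cmod (of_real (s k) * z) < 1" if "cmod z \<le> 1" for z :: complex
      using that s[of k] by (auto simp: norm_mult intro!: le_less_trans[OF mult_left_le])
    have "continuous_on (cball 0 1) h" unfolding h_def
      by (intro continuous_intros continuous_on_compose2[OF Fc]) (use sub pos in auto)
    moreover have "h holomorphic_on ball 0 1" unfolding h_def
      by (intro holomorphic_intros holomorphic_on_dilation[OF F]) (use s[of k] sub pos in auto)
    ultimately have "((\<lambda>t. of_real (poisson 0 t) * h (cis t)) has_integral 2 * pi * h 0) {0..2*pi}"
      by (rule poisson_integral_formula) simp
    from has_integral_Re[OF this] have "((\<lambda>t. Re (h (cis t))) has_integral 2 * pi * Re (h 0)) {0..2*pi}"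
      by (simp add: poisson_def)
    moreover have "Re (h z) = ln (cmod (F (of_real (s k) * z)))" if "cmod z \<le> 1" for z
      unfolding h_def using F1[OF sub[OF that]] by (intro Re_Ln) auto
    ultimately show ?thesis by (simp add: integral_unique u_def[abs_def])
  qed
  have [measurable]: "(\<lambda>t. ennreal (u k t)) \<in> borel_measurable lborel" for k
    using borel_measurable_continuous_onI[OF uc[of UNIV k]] by simp
  have "(\<integral>\<^sup>+t. liminf (\<lambda>k. ennreal (u k t) * indicator {0..2*pi} t) \<partial>lborel)
     \<le> liminf (\<lambda>k. \<integral>\<^sup>+t. ennreal (u k t) * indicator {0..2*pi} t \<partial>lborel)"
    by (rule nn_integral_liminf) measurable
  also have "\<dots> = ennreal (2 * pi * ln (cmod (F 0)))"
    using nn_integral_Icc_continuous[OF uc u0] by (simp add: uint Liminf_const)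
  finally have "(\<integral>\<^sup>+t. liminf (\<lambda>k. ennreal (u k t) * indicator {0..2*pi} t) \<partial>lborel) \<noteq> \<infinity>"
    by (metis ennreal_neq_top infinity_ennreal_def neq_top_trans)
  then have "AE t in lborel. liminf (\<lambda>k. ennreal (u k t) * indicator {0..2*pi} t) \<noteq> \<infinity>"
    by (intro nn_integral_PInf_AE) measurable
  then show ?thesis
  proof (rule eventually_mono, intro impI notI)
    fix t assume t: "t \<in> {0..2*pi}" and fin: "liminf (\<lambda>k. ennreal (u k t) * indicator {0..2*pi} t) \<noteq> \<infinity>"
      and lim: "((\<lambda>r. 1 / F (of_real r * cis t)) \<longlongrightarrow> 0) (at_left 1)"
    have "(\<lambda>k. 1 / F (of_real (s k) * cis t)) \<longlonglongrightarrow> 0" using filterlim_compose[OF lim slim] .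
    moreover have "1 / F (of_real (s k) * cis t) \<noteq> 0" for k
      using F1[of "of_real (s k) * cis t"] s[of k] by (auto simp: norm_mult)
    ultimately have "filterlim (\<lambda>k. 1 / F (of_real (s k) * cis t)) (at 0) sequentially"
      by (simp add: filterlim_at)
    then have "filterlim (\<lambda>k. inverse (1 / F (of_real (s k) * cis t))) at_infinity sequentially"
      by (rule filterlim_compose[OF filterlim_inverse_at_infinity])
    then have "filterlim (\<lambda>k. cmod (F (of_real (s k) * cis t))) at_top sequentially"
      using filterlim_at_infinity_imp_norm_at_top by fastforce
    then have "filterlim (\<lambda>k. u k t) at_top sequentially"
      unfolding u_def by (rule filterlim_compose[OF ln_at_top])
    then have "(\<lambda>k. ennreal (u k t)) \<longlonglongrightarrow> \<infinity>"
      by (simp add: ennreal_tendsto_top_eq_at_top)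
    then have "liminf (\<lambda>k. ennreal (u k t) * indicator {0..2*pi} t) = \<infinity>"
      using t by (simp add: lim_imp_Liminf)
    with fin show False by simp
  qed
qed

text \<open>Fatou's theorem for \<open>H\<^sup>1\<close>. With a majorant \<open>F\<close> such that \<open>1 + |g| \<le> Re F\<close>, both \<open>g / F\<close> and \<open>1 / F\<close> are bounded by 1
  and \<open>g\<close> is their quotient.\<close>

theorem H1_radial_limits:
  fixes g :: "complex \<Rightarrow> complex"
  assumes g: "g holomorphic_on ball 0 1"
    and C: "\<And>r. 0 \<le> r \<Longrightarrow> r < 1 \<Longrightarrow> integral {0..2*pi} (\<lambda>t. cmod (g (of_real r * cis t))) \<le> C"
  shows "AE t in lborel. t \<in> {0..2*pi} \<longrightarrow> (\<exists>l. ((\<lambda>r. g (of_real r * cis t)) \<longlongrightarrow> l) (at_left 1))"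
proof -
  obtain F0 where F0: "F0 holomorphic_on ball 0 1" "\<And>z. cmod z < 1 \<Longrightarrow> cmod (g z) \<le> Re (F0 z)"
    using H1_holomorphic_majorant[of g C] g C by blast
  define F where "F z = F0 z + 1" for z
  have Fh: "F holomorphic_on ball 0 1" unfolding F_def by (intro holomorphic_intros F0)
  have Fg: "1 + cmod (g z) \<le> Re (F z)" if "cmod z < 1" for z using F0(2)[OF that] by (simp add: F_def)
  have FR: "1 \<le> Re (F z)" and Fn: "1 + cmod (g z) \<le> cmod (F z)" if "cmod z < 1" for z
    using Fg[OF that] complex_Re_le_cmod[of "F z"] norm_ge_zero[of "g z"] by linarith+
  have Fnz: "F z \<noteq> 0" if "cmod z < 1" for z using FR[OF that] by auto
  have 1: "AE t in lborel. t \<in> {0..2*pi} \<longrightarrow> (\<exists>l. ((\<lambda>r. 1 / F (of_real r * cis t)) \<longlongrightarrow> l) (at_left 1))"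
  proof (rule bounded_holomorphic_radial_limits)
    show "(\<lambda>z. 1 / F z) holomorphic_on ball 0 1" using Fnz by (intro holomorphic_intros Fh) auto
    show "cmod (1 / F z) \<le> 1" if "cmod z < 1" for z
      using Fn[OF that] norm_ge_zero[of "g z"] by (simp add: norm_divide divide_le_eq del: norm_ge_zero)
  qed
  have 2: "AE t in lborel. t \<in> {0..2*pi} \<longrightarrow> (\<exists>l. ((\<lambda>r. g (of_real r * cis t) / F (of_real r * cis t)) \<longlongrightarrow> l) (at_left 1))"
  proof (rule bounded_holomorphic_radial_limits)
    show "(\<lambda>z. g z / F z) holomorphic_on ball 0 1" using Fnz by (intro holomorphic_intros Fh g) auto
    show "cmod (g z / F z) \<le> 1" if "cmod z < 1" for z
      using Fn[OF that] by (simp add: norm_divide divide_le_eq)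
  qed
  have 3: "AE t in lborel. t \<in> {0..2*pi} \<longrightarrow> \<not> ((\<lambda>r. 1 / F (of_real r * cis t)) \<longlongrightarrow> 0) (at_left 1)"
    by (rule radial_limits_inverse_nonzero[OF Fh FR])
  show ?thesis
    using 1 2 3
  proof eventually_elim
    fix t
    assume 1: "t \<in> {0..2*pi} \<longrightarrow> (\<exists>l. ((\<lambda>r. 1 / F (of_real r * cis t)) \<longlongrightarrow> l) (at_left 1))"
      and 2: "t \<in> {0..2*pi} \<longrightarrow> (\<exists>l. ((\<lambda>r. g (of_real r * cis t) / F (of_real r * cis t)) \<longlongrightarrow> l) (at_left 1))"
      and 3: "t \<in> {0..2*pi} \<longrightarrow> \<not> ((\<lambda>r. 1 / F (of_real r * cis t)) \<longlongrightarrow> 0) (at_left 1)"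
    show "t \<in> {0..2*pi} \<longrightarrow> (\<exists>l. ((\<lambda>r. g (of_real r * cis t)) \<longlongrightarrow> l) (at_left 1))"
    proof
      assume t: "t \<in> {0..2*pi}"
      obtain l1 l2 where l: "((\<lambda>r. 1 / F (of_real r * cis t)) \<longlongrightarrow> l1) (at_left 1)" "l1 \<noteq> 0"
        "((\<lambda>r. g (of_real r * cis t) / F (of_real r * cis t)) \<longlongrightarrow> l2) (at_left 1)"
      proof -
        obtain l1 l2 where "((\<lambda>r. 1 / F (of_real r * cis t)) \<longlongrightarrow> l1) (at_left 1)"
          "((\<lambda>r. g (of_real r * cis t) / F (of_real r * cis t)) \<longlongrightarrow> l2) (at_left 1)"
          using 1 2 t by blast
        moreover from this have "l1 \<noteq> 0" using 3 t by blast
        ultimately show ?thesis using that by blast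
      qed
      have "((\<lambda>r. (g (of_real r * cis t) / F (of_real r * cis t)) / (1 / F (of_real r * cis t))) \<longlongrightarrow> l2 / l1) (at_left 1)"
        by (intro tendsto_intros l)
      moreover have "\<forall>\<^sub>F r in at_left 1. (g (of_real r * cis t) / F (of_real r * cis t)) / (1 / F (of_real r * cis t)) = g (of_real r * cis t)"
      proof -
        have "\<forall>\<^sub>F r in at_left (1::real). r \<in> {0<..<1}" by (rule eventually_at_left_real) simp
        then show ?thesis by eventually_elim (use Fnz in \<open>auto simp: norm_mult\<close>)
      qed
      ultimately show "\<exists>l. ((\<lambda>r. g (of_real r * cis t)) \<longlongrightarrow> l) (at_left 1)"
        by (intro exI[of _ "l2 / l1"]) (rule Lim_transform_eventually)
    qed
  qed
qed

section \<open>Density of test functions\<close>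

text \<open>The factor \<open>1 / t ^ m\<close> is what differentiation of \<open>exp (- 1 / t)\<close> produces. The whole family is kept because it is closed
  under differentiation up to linear combinations.\<close>

definition flat_exp :: "nat \<Rightarrow> real \<Rightarrow> real" where
  "flat_exp m t = (if t \<le> 0 then 0 else exp (- 1 / t) / t ^ m)"

lemma flat_exp_nonneg: "0 \<le> flat_exp m t" by (simp add: flat_exp_def)

lemma flat_exp_pos: "0 < t \<Longrightarrow> 0 < flat_exp m t" by (simp add: flat_exp_def)

lemma flat_exp_0_le_1: "flat_exp 0 t \<le> 1" by (simp add: flat_exp_def)

lemma flat_exp_tendsto_0: "(flat_exp m \<longlongrightarrow> 0) (at_right 0)"
proof -
  have "((\<lambda>t. inverse t ^ m / exp (inverse t)) \<longlongrightarrow> 0) (at_right (0::real))"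
    by (rule filterlim_compose[where g = "\<lambda>x. x ^ m / exp x" and f = inverse, OF tendsto_power_div_exp_0 filterlim_inverse_at_top_right])
  moreover have "\<forall>\<^sub>F t in at_right 0. inverse t ^ m / exp (inverse t) = flat_exp m (t::real)"
    by (intro eventually_at_rightI[of 0 1])
       (auto simp: flat_exp_def exp_minus field_simps power_inverse)
  ultimately show ?thesis by (rule Lim_transform_eventually)
qed

lemma flat_exp_has_derivative:
  "(flat_exp m has_real_derivative flat_exp (m + 2) t - m * flat_exp (m + 1) t) (at t)"
proof -
  consider "t < 0" | "t = 0" | "t > 0" by linarith
  then show ?thesis
  proof cases
    case 1
    have "((\<lambda>_. 0) has_real_derivative 0) (at t)" by simp
    then have "(flat_exp m has_real_derivative 0) (at t)"
      by (rule has_field_derivative_transform_within_open[where S = "{..<0}"]) (use 1 in \<open>auto simp: flat_exp_def\<close>)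
    then show ?thesis using 1 by (simp add: flat_exp_def)
  next
    case 2
    have "((\<lambda>h. (flat_exp m (0 + h) - flat_exp m 0) / h) \<longlongrightarrow> 0) (at 0)"
    proof (rule filterlim_split_at)
      have "\<forall>\<^sub>F h in at_left 0. 0 = (flat_exp m (0 + h) - flat_exp m 0) / h"
        by (intro eventually_at_leftI[of "-1"]) (auto simp: flat_exp_def)
      then show "((\<lambda>h. (flat_exp m (0 + h) - flat_exp m 0) / h) \<longlongrightarrow> 0) (at_left 0)"
        by (rule Lim_transform_eventually[OF tendsto_const])
      have "\<forall>\<^sub>F h in at_right 0. flat_exp (Suc m) h = (flat_exp m (0 + h) - flat_exp m 0) / h"
        by (intro eventually_at_rightI[of 0 1]) (auto simp: flat_exp_def field_simps)
      then show "((\<lambda>h. (flat_exp m (0 + h) - flat_exp m 0) / h) \<longlongrightarrow> 0) (at_right 0)"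
        by (rule Lim_transform_eventually[OF flat_exp_tendsto_0])
    qed
    then show ?thesis using 2 by (simp add: DERIV_def flat_exp_def)
  next
    case 3
    have "((\<lambda>t. exp (- 1 / t) / t ^ m) has_real_derivative
        (exp (- 1 / t) * (1 / t\<^sup>2) * t ^ m - exp (- 1 / t) * (m * t ^ (m - 1))) / (t ^ m * t ^ m)) (at t)"
      using 3 by (auto intro!: derivative_eq_intros simp: power2_eq_square)
    also have "(exp (- 1 / t) * (1 / t\<^sup>2) * t ^ m - exp (- 1 / t) * (m * t ^ (m - 1))) / (t ^ m * t ^ m)
       = flat_exp (m + 2) t - m * flat_exp (m + 1) t"
      using 3 by (cases m) (auto simp: flat_exp_def field_simps power2_eq_square)
    finally show ?thesis
      by (rule has_field_derivative_transform_within_open[where S = "{0<..}"]) (use 3 in \<open>auto simp: flat_exp_def\<close>)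
  qed
qed

lemma real_polynomial_function_derivative:
  fixes P :: "'a::real_normed_vector \<Rightarrow> real"
  assumes "real_polynomial_function P"
  shows "\<exists>D. (\<forall>z. (P has_derivative D z) (at z)) \<and> (\<forall>v. real_polynomial_function (\<lambda>z. D z v))"
  using assms
proof induction
  case (linear f)
  then show ?case by (intro exI[of _ "\<lambda>_. f"]) (auto simp: bounded_linear_imp_has_derivative)
next
  case (const c)
  show ?case by (intro exI[of _ "\<lambda>_ _. 0"]) auto
next
  case (add f g)
  then obtain D E where "\<And>z. (f has_derivative D z) (at z)" "\<And>v. real_polynomial_function (\<lambda>z. D z v)"
    "\<And>z. (g has_derivative E z) (at z)" "\<And>v. real_polynomial_function (\<lambda>z. E z v)" by auto
  then show ?case
    by (intro exI[of _ "\<lambda>z v. D z v + E z v"]) (auto intro!: has_derivative_add)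
next
  case (mult f g)
  then obtain D E where "\<And>z. (f has_derivative D z) (at z)" "\<And>v. real_polynomial_function (\<lambda>z. D z v)"
    "\<And>z. (g has_derivative E z) (at z)" "\<And>v. real_polynomial_function (\<lambda>z. E z v)" by auto
  moreover from this mult.hyps have "real_polynomial_function (\<lambda>z. f z * E z v + D z v * g z)" for v
    by (intro real_polynomial_function.intros(3,4)) simp_all
  ultimately show ?case
    by (intro exI[of _ "\<lambda>z v. f z * E z v + D z v * g z"]) (auto intro!: has_derivative_mult)
qed

lemma Ck_of_derivative_closed:
  assumes F: "\<And>f. f \<in> F \<Longrightarrow> (\<forall>z. f differentiable (at z)) \<and> (\<forall>v. (\<lambda>z. frechet_derivative f (at z) v) \<in> F)"
    and f: "f \<in> F"
  shows "Ck k f"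
  using f
proof (induction k arbitrary: f)
  case 0
  then show ?case using F by (auto intro!: continuous_at_imp_continuous_on differentiable_imp_continuous_within)
next
  case (Suc k)
  then show ?case using F by auto
qed

lemma frechet_derivative_add:
  assumes "f differentiable (at z)" "g differentiable (at z)"
  shows "frechet_derivative (\<lambda>z. f z + g z) (at z) = (\<lambda>v. frechet_derivative f (at z) v + frechet_derivative g (at z) v)"
  using frechet_derivative_at[OF has_derivative_add[OF assms[unfolded frechet_derivative_works]]] by simp

text \<open>Composing with polynomials and allowing polynomial factors gives a space of functions on complex n-space
  that is closed under directional derivatives, so that its members are smooth; bump functions and
  their products with polynomials are among them.\<close>

inductive_set flat_span :: "(complex ^ 'n \<Rightarrow> complex) set" where
  base: "real_polynomial_function P \<Longrightarrow> real_polynomial_function Q \<Longrightarrow> (\<lambda>z. c * of_real (P z * flat_exp m (Q z))) \<in> flat_span"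
| add: "f \<in> flat_span \<Longrightarrow> g \<in> flat_span \<Longrightarrow> (\<lambda>z. f z + g z) \<in> flat_span"

lemma flat_span_derivative:
  fixes f :: "complex ^ 'n \<Rightarrow> complex"
  assumes "f \<in> flat_span"
  shows "(\<forall>z. f differentiable (at z)) \<and> (\<forall>v. (\<lambda>z. frechet_derivative f (at z) v) \<in> flat_span)"
  using assms
proof induction
  case (base P Q c m)
  obtain D where D: "\<And>z. (P has_derivative D z) (at z)" "\<And>v. real_polynomial_function (\<lambda>z. D z v)"
    using real_polynomial_function_derivative[OF base(1)] by auto
  obtain E where E: "\<And>z. (Q has_derivative E z) (at z)" "\<And>v. real_polynomial_function (\<lambda>z. E z v)"
    using real_polynomial_function_derivative[OF base(2)] by auto
  define L where "L z v = c * of_real (D z v * flat_exp m (Q z)) + (c * of_real ((P z * E z v) * flat_exp (m + 2) (Q z))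
      + c * of_real ((- real m * (P z * E z v)) * flat_exp (m + 1) (Q z)))" for z v
  have "((\<lambda>z. flat_exp m (Q z)) has_derivative (\<lambda>v. (flat_exp (m + 2) (Q z) - m * flat_exp (m + 1) (Q z)) * E z v)) (at z)" for z
    using has_derivative_compose[OF E(1) flat_exp_has_derivative[THEN has_field_derivative_imp_has_derivative]] .
  from has_derivative_mult_right[OF has_derivative_of_real[OF has_derivative_mult[OF D(1) this]]]
  have L: "((\<lambda>z. c * of_real (P z * flat_exp m (Q z))) has_derivative L z) (at z)" for z
    by (rule has_derivative_eq_rhs) (auto simp: L_def fun_eq_iff algebra_simps)
  have "(\<lambda>z. L z v) \<in> flat_span" for v
    unfolding L_def by (intro flat_span.intros real_polynomial_function.intros base D E real_polynomial_function_minus)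
  then show ?case
    using L frechet_derivative_at[OF L] by (auto simp: differentiable_def)
next
  case (add f g)
  then show ?case
    by (auto simp: frechet_derivative_add intro!: flat_span.add differentiable_add)
qed

lemma Ck_flat_span: "f \<in> flat_span \<Longrightarrow> Ck k f"
  by (rule Ck_of_derivative_closed[OF flat_span_derivative])

lemma flat_span_sum:
  assumes "finite T" "\<And>x. x \<in> T \<Longrightarrow> f x \<in> flat_span"
  shows "(\<lambda>z. \<Sum>x\<in>T. f x z) \<in> flat_span"
  using assms
proof (induction T)
  case empty
  show ?case using flat_span.base[OF real_polynomial_function.intros(2) real_polynomial_function.intros(2), of 0] by simp
next
  case (insert x T)
  then show ?case by (simp add: flat_span.add)
qed

lemma real_polynomial_function_sq_dist:
  fixes x :: "'a::euclidean_space"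
  shows "real_polynomial_function (\<lambda>z. r - (norm (z - x))\<^sup>2)"
proof -
  have "(norm (z - x))\<^sup>2 = (\<Sum>b\<in>Basis. (z \<bullet> b - x \<bullet> b) * (z \<bullet> b - x \<bullet> b))" for z :: 'a
    unfolding power2_norm_eq_inner by (subst euclidean_inner) (simp add: inner_diff_left)
  moreover have "real_polynomial_function (\<lambda>z. r - (\<Sum>b\<in>Basis. (z \<bullet> b - x \<bullet> b) * (z \<bullet> b - x \<bullet> b)))"
    by (intro real_polynomial_function_diff real_polynomial_function_sum real_polynomial_function.intros
        bounded_linear_inner_left finite_Basis)
  ultimately show ?thesis by simp
qed

text \<open>A sum \<open>\<eta>\<close> of bumps is positive on the support of \<open>\<phi>\<close>, so \<open>\<phi> = \<eta> \<xi>\<close> with \<open>\<xi>\<close> continuous. Approximating \<open>\<xi>\<close> by polynomials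
  (Stone--Weierstrass) approximates \<open>\<phi>\<close> by members of \<open>flat_span\<close>, all supported in the support of \<open>\<eta>\<close>.
  The common compact set is what estimates of functionals of order zero require.\<close>

theorem test_functions_dense:
  fixes \<phi> :: "complex ^ 'n \<Rightarrow> complex"
  assumes \<Omega>: "open \<Omega>" and \<phi>: "\<phi> \<in> Cc \<Omega>"
  obtains K where "compact K" "K \<subseteq> \<Omega>" "{z. \<phi> z \<noteq> 0} \<subseteq> K"
    "\<And>e. 0 < e \<Longrightarrow> \<exists>\<psi>\<in>test_functions \<Omega>. {z. \<psi> z \<noteq> 0} \<subseteq> K \<and> (\<forall>z. cmod (\<phi> z - \<psi> z) \<le> e)"
proof -
  define S where "S = closure {z. \<phi> z \<noteq> 0}"
  have S: "compact S" "S \<subseteq> \<Omega>" "\<And>z. z \<notin> S \<Longrightarrow> \<phi> z = 0" and \<phi>c: "continuous_on UNIV \<phi>"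
    using \<phi> closure_subset[of "{z. \<phi> z \<noteq> 0}"] by (auto simp: Cc_def S_def)
  have "\<exists>r>0. cball x r \<subseteq> \<Omega>" if "x \<in> S" for x
    using \<Omega> S(2) that open_contains_cball by blast
  then obtain r where r: "\<And>x. x \<in> S \<Longrightarrow> 0 < r x \<and> cball x (r x) \<subseteq> \<Omega>" by metis
  obtain T where T: "T \<subseteq> S" "finite T" "S \<subseteq> (\<Union>x\<in>T. ball x (r x))"
    by (rule compactE_image[OF S(1), of S "\<lambda>x. ball x (r x)"]) (use r in force)+
  define K where "K = (\<Union>x\<in>T. cball x (r x))"
  have K: "compact K" "K \<subseteq> \<Omega>" using T r by (auto simp: K_def intro!: compact_UN)
  define q where "q x z = (r x)\<^sup>2 - (norm (z - x))\<^sup>2" for x z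
  have q: "q x z > 0 \<longleftrightarrow> z \<in> ball x (r x)" if "x \<in> T" for x z
    using r[of x] that T(1) by (auto simp: q_def dist_norm norm_minus_commute abs_less_iff power2_less_imp_less
        intro!: power_strict_mono dest!: power2_less_imp_less)
  define \<eta> where "\<eta> z = (\<Sum>x\<in>T. flat_exp 0 (q x z))" for z
  have qc: "continuous_on UNIV (\<lambda>z. flat_exp 0 (q x z))" for x
  proof -
    have "continuous_on UNIV (flat_exp 0)"
      by (intro continuous_at_imp_continuous_on ballI DERIV_isCont[OF flat_exp_has_derivative])
    then show ?thesis unfolding q_def by (rule continuous_on_compose2) (auto intro!: continuous_intros)
  qed
  have \<eta>c: "continuous_on UNIV \<eta>" unfolding \<eta>_def by (intro continuous_intros qc)
  have \<eta>0: "0 \<le> \<eta> z" and \<eta>1: "\<eta> z \<le> card T" for z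
    using sum_bounded_above[of T "\<lambda>x. flat_exp 0 (q x z)" 1]
    by (auto simp: \<eta>_def intro!: sum_nonneg flat_exp_nonneg flat_exp_0_le_1)
  have \<eta>pos: "0 < \<eta> z" if "z \<in> S" for z
  proof -
    obtain x where x: "x \<in> T" "z \<in> ball x (r x)" using T(3) \<open>z \<in> S\<close> by blast
    show ?thesis unfolding \<eta>_def
      by (rule sum_pos2[OF T(2) x(1)]) (use x q in \<open>auto intro: flat_exp_pos flat_exp_nonneg\<close>)
  qed
  have \<eta>K: "\<eta> z = 0" if "z \<notin> K" for z
  proof -
    have "flat_exp 0 (q x z) = 0" if "x \<in> T" for x
    proof -
      have "z \<notin> ball x (r x)" using \<open>z \<notin> K\<close> that by (auto simp: K_def)
      with q[OF that, of z] show ?thesis by (simp add: flat_exp_def)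
    qed
    then show ?thesis by (simp add: \<eta>_def)
  qed
  define \<xi> where "\<xi> z = \<phi> z / of_real (\<eta> z)" for z
  have "continuous_on ({z. 0 < \<eta> z} \<union> - S) \<xi>"
  proof (rule continuous_on_open_Un)
    show "open {z. 0 < \<eta> z}" by (intro open_Collect_less continuous_intros \<eta>c)
    show "open (- S)" using S(1) by (simp add: compact_imp_closed open_Compl)
    show "continuous_on {z. 0 < \<eta> z} \<xi>" unfolding \<xi>_def
      by (intro continuous_intros continuous_on_subset[OF \<phi>c] continuous_on_subset[OF \<eta>c]) auto
    show "continuous_on (- S) \<xi>"
      by (rule continuous_on_eq[OF continuous_on_const[of _ 0]]) (use S(3) in \<open>auto simp: \<xi>_def\<close>)
  qed
  moreover have "{z. 0 < \<eta> z} \<union> - S = UNIV" using \<eta>pos by auto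
  ultimately have \<xi>c: "continuous_on K \<xi>" by (metis continuous_on_subset subset_UNIV)
  have \<phi>\<xi>: "\<phi> z = of_real (\<eta> z) * \<xi> z" for z
    using S(3)[of z] \<eta>pos[of z] by (cases "z \<in> S") (auto simp: \<xi>_def)
  show ?thesis
  proof (rule that[OF K])
    show "{z. \<phi> z \<noteq> 0} \<subseteq> K" using \<phi>\<xi> \<eta>K by auto
    fix e :: real assume e: "0 < e"
    define d where "d = e / (2 * (card T + 1))"
    have d: "d > 0" using e by (simp add: d_def)
    obtain p1 where p1: "real_polynomial_function p1" "\<And>z. z \<in> K \<Longrightarrow> \<bar>Re (\<xi> z) - p1 z\<bar> < d"
      using Stone_Weierstrass_real_polynomial_function[OF K(1) _ d, of "\<lambda>z. Re (\<xi> z)"] \<xi>c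
      by (auto intro!: continuous_intros)
    obtain p2 where p2: "real_polynomial_function p2" "\<And>z. z \<in> K \<Longrightarrow> \<bar>Im (\<xi> z) - p2 z\<bar> < d"
      using Stone_Weierstrass_real_polynomial_function[OF K(1) _ d, of "\<lambda>z. Im (\<xi> z)"] \<xi>c
      by (auto intro!: continuous_intros)
    define \<psi> where "\<psi> z = (\<Sum>x\<in>T. 1 * of_real (p1 z * flat_exp 0 (q x z)) + \<i> * of_real (p2 z * flat_exp 0 (q x z)))" for z
    have \<psi>: "\<psi> z = of_real (\<eta> z) * Complex (p1 z) (p2 z)" for z
      by (simp add: \<psi>_def \<eta>_def Complex_eq sum_distrib_right sum_distrib_left sum.distrib algebra_simps)
    have span: "\<psi> \<in> flat_span" unfolding \<psi>_def[abs_def]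
      by (intro flat_span_sum T flat_span.intros p1 p2) (auto simp: q_def[abs_def] intro: real_polynomial_function_sq_dist)
    have \<psi>K: "{z. \<psi> z \<noteq> 0} \<subseteq> K" using \<psi> \<eta>K by auto
    have "closure {z. \<psi> z \<noteq> 0} \<subseteq> K" using \<psi>K K(1) by (simp add: closure_minimal compact_imp_closed)
    then have "compact (closure {z. \<psi> z \<noteq> 0})" "closure {z. \<psi> z \<noteq> 0} \<subseteq> \<Omega>"
      using K compact_closure bounded_subset[OF compact_imp_bounded[OF K(1)] \<psi>K] by auto
    moreover have "continuous_on UNIV \<psi>" using Ck_flat_span[OF span, of 0] by simp
    ultimately have "\<psi> \<in> test_functions \<Omega>" using Ck_flat_span[OF span] by (simp add: test_functions_def Cc_def)
    moreover have "cmod (\<phi> z - \<psi> z) \<le> e" for z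
    proof (cases "z \<in> K")
      case True
      have "cmod (\<xi> z - Complex (p1 z) (p2 z)) \<le> \<bar>Re (\<xi> z) - p1 z\<bar> + \<bar>Im (\<xi> z) - p2 z\<bar>"
        using cmod_le[of "\<xi> z - Complex (p1 z) (p2 z)"] by simp
      also have "\<dots> \<le> 2 * d" using p1(2)[OF True] p2(2)[OF True] by simp
      finally have "cmod (of_real (\<eta> z) * (\<xi> z - Complex (p1 z) (p2 z))) \<le> card T * (2 * d)"
        unfolding norm_mult using \<eta>0[of z] \<eta>1[of z] by (intro mult_mono) auto
      also have "\<dots> \<le> e" using e by (simp add: d_def field_simps)
      finally show ?thesis by (simp add: \<phi>\<xi> \<psi> algebra_simps)
    next
      case False
      then show ?thesis using \<psi>[of z] \<phi>\<xi>[of z] \<eta>K[of z] e by simp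
    qed
    ultimately show "\<exists>\<psi>\<in>test_functions \<Omega>. {z. \<psi> z \<noteq> 0} \<subseteq> K \<and> (\<forall>z. cmod (\<phi> z - \<psi> z) \<le> e)"
      using \<psi>K by blast
  qed
qed

section \<open>Uniqueness and locality of Bedford--Taylor chains\<close>

lemma Ck_imp_continuous: "Ck k f \<Longrightarrow> continuous_on S f"
  by (cases k) (auto intro: continuous_on_subset continuous_at_imp_continuous_on differentiable_imp_continuous_within)

lemma Ck_add: "Ck k f \<Longrightarrow> Ck k g \<Longrightarrow> Ck k (\<lambda>z. f z + g z)"
proof (induction k arbitrary: f g)
  case 0 then show ?case by (auto intro: continuous_intros)
next
  case (Suc k) then show ?case by (auto simp: frechet_derivative_add)
qed

lemma Ck_cmult: "Ck k f \<Longrightarrow> Ck k (\<lambda>z. c * f z)"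
proof (induction k arbitrary: f)
  case 0 then show ?case by (auto intro: continuous_intros)
next
  case (Suc k)
  have "((\<lambda>z. c * f z) has_derivative (\<lambda>v. c * frechet_derivative f (at z) v)) (at z)" for z
    using Suc.prems frechet_derivative_works by (intro has_derivative_mult_right) auto
  from frechet_derivative_at[OF this, symmetric] this show ?case
    using Suc by (auto simp: differentiable_def)
qed

lemma Ck_dz: "Ck (Suc k) f \<Longrightarrow> Ck k (dz a f)"
  and Ck_dzbar: "Ck (Suc k) f \<Longrightarrow> Ck k (dzbar a f)"
proof -
  assume f: "Ck (Suc k) f"
  have 1: "dz a f = (\<lambda>z. (1/2) * frechet_derivative f (at z) (axis a 1) + (- \<i>/2) * frechet_derivative f (at z) (axis a \<i>))"
    and 2: "dzbar a f = (\<lambda>z. (1/2) * frechet_derivative f (at z) (axis a 1) + (\<i>/2) * frechet_derivative f (at z) (axis a \<i>))"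
    by (auto simp: dz_def dzbar_def fun_eq_iff field_simps)
  show "Ck k (dz a f)" "Ck k (dzbar a f)"
    unfolding 1 2 using f by (intro Ck_add Ck_cmult; simp)+
qed

lemma frechet_derivative_eq_0_outside:
  assumes "z \<notin> closure {z. f z \<noteq> 0}"
  shows "frechet_derivative f (at z) = (\<lambda>_. 0)"
proof -
  have "(f has_derivative (\<lambda>_. 0)) (at z)"
    by (rule has_derivative_transform_within_open[of "\<lambda>_. 0" _ _ _ "- closure {z. f z \<noteq> 0}"])
       (use assms closure_subset[of "{z. f z \<noteq> 0}"] in auto)
  then show ?thesis by (metis frechet_derivative_at)
qed

lemma dz_eq_0_outside: "z \<notin> closure {z. f z \<noteq> 0} \<Longrightarrow> dz a f z = 0"
  and dzbar_eq_0_outside: "z \<notin> closure {z. f z \<noteq> 0} \<Longrightarrow> dzbar a f z = 0"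
  by (simp_all add: dz_def dzbar_def frechet_derivative_eq_0_outside)

lemma dz_dzbar_eq_0_outside: "z \<notin> closure {z. f z \<noteq> 0} \<Longrightarrow> dz a (dzbar b f) z = 0"
proof -
  assume z: "z \<notin> closure {z. f z \<noteq> 0}"
  have "closure {z. dzbar b f z \<noteq> 0} \<subseteq> closure {z. f z \<noteq> 0}"
    by (rule closure_minimal) (use dzbar_eq_0_outside in blast)+
  with z show ?thesis by (intro dz_eq_0_outside) blast
qed

lemma mult_in_Cc:
  fixes v :: "complex ^ 'n \<Rightarrow> real"
  assumes \<Omega>: "open \<Omega>" and v: "continuous_on \<Omega> v" and g: "continuous_on UNIV g"
    and S: "compact S" "S \<subseteq> \<Omega>" "\<And>z. z \<notin> S \<Longrightarrow> g z = 0"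
  shows "(\<lambda>z. of_real (v z) * g z) \<in> Cc \<Omega>"
proof -
  have cl: "closed S" using S(1) by (rule compact_imp_closed)
  have "continuous_on (\<Omega> \<union> - S) (\<lambda>z. of_real (v z) * g z)"
  proof (rule continuous_on_open_Un[OF \<Omega>])
    show "open (- S)" using cl by (simp add: open_Compl)
    show "continuous_on \<Omega> (\<lambda>z. of_real (v z) * g z)"
      by (intro continuous_intros v continuous_on_subset[OF g]) auto
    show "continuous_on (- S) (\<lambda>z. of_real (v z) * g z)"
      by (rule continuous_on_eq[OF continuous_on_const[of _ 0]]) (use S(3) in auto)
  qed
  moreover have "\<Omega> \<union> - S = UNIV" using S(2) by auto
  moreover have sub: "closure {z. of_real (v z) * g z \<noteq> 0} \<subseteq> S"
    by (rule closure_minimal[OF _ cl]) (use S(3) in auto)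
  moreover have "compact (closure {z. of_real (v z) * g z \<noteq> 0})"
    using sub S(1) by (meson closed_closure compact_Int_closed compact_eq_bounded_closed bounded_subset)
  ultimately show ?thesis using S(2) by (auto simp: Cc_def)
qed

lemma test_functions_Cc: "\<phi> \<in> test_functions \<Omega> \<Longrightarrow> \<phi> \<in> Cc \<Omega>"
  by (simp add: test_functions_def)

lemma dz_dzbar_mult_in_Cc:
  fixes v :: "complex ^ 'n \<Rightarrow> real"
  assumes "open \<Omega>" "continuous_on \<Omega> v" and \<phi>: "\<phi> \<in> test_functions \<Omega>"
  shows "(\<lambda>z. of_real (v z) * dz a (dzbar b \<phi>) z) \<in> Cc \<Omega>"
proof (rule mult_in_Cc[OF assms(1,2)])
  have "Ck 2 \<phi>" using \<phi> by (simp add: test_functions_def)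
  then have "Ck 0 (dz a (dzbar b \<phi>))" by (intro Ck_dz Ck_dzbar) (simp only: numeral_2_eq_2)
  then show "continuous_on UNIV (dz a (dzbar b \<phi>))" by (rule Ck_imp_continuous)
  show "compact (closure {z. \<phi> z \<noteq> 0})" "closure {z. \<phi> z \<noteq> 0} \<subseteq> \<Omega>"
    using \<phi> by (auto simp: test_functions_def Cc_def)
qed (rule dz_dzbar_eq_0_outside)

lemma Cc_lincomb:
  assumes "\<phi> \<in> Cc \<Omega>" "\<psi> \<in> Cc \<Omega>"
  shows "(\<lambda>z. a * \<phi> z + b * \<psi> z) \<in> Cc \<Omega>"
proof -
  have sub: "closure {z. a * \<phi> z + b * \<psi> z \<noteq> 0} \<subseteq> closure {z. \<phi> z \<noteq> 0} \<union> closure {z. \<psi> z \<noteq> 0}"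
  proof (rule closure_minimal)
    have "{z. a * \<phi> z + b * \<psi> z \<noteq> 0} \<subseteq> {z. \<phi> z \<noteq> 0} \<union> {z. \<psi> z \<noteq> 0}" by auto
    also have "\<dots> \<subseteq> closure {z. \<phi> z \<noteq> 0} \<union> closure {z. \<psi> z \<noteq> 0}"
      by (intro Un_mono closure_subset)
    finally show "{z. a * \<phi> z + b * \<psi> z \<noteq> 0} \<subseteq> closure {z. \<phi> z \<noteq> 0} \<union> closure {z. \<psi> z \<noteq> 0}" .
  qed (intro closed_Un closed_closure)
  moreover have "compact (closure {z. \<phi> z \<noteq> 0} \<union> closure {z. \<psi> z \<noteq> 0})"
    using assms by (auto simp: Cc_def)
  ultimately have "compact (closure {z. a * \<phi> z + b * \<psi> z \<noteq> 0})"
    by (meson closed_closure compact_eq_bounded_closed bounded_subset)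
  with sub show ?thesis using assms by (auto simp: Cc_def intro!: continuous_intros)
qed

lemma order_zero_lincomb:
  assumes "order_zero \<Omega> T" "\<phi> \<in> Cc \<Omega>" "\<psi> \<in> Cc \<Omega>"
  shows "T (\<lambda>z. a * \<phi> z + b * \<psi> z) = a * T \<phi> + b * T \<psi>"
proof -
  have "\<forall>\<phi>\<in>Cc \<Omega>. \<forall>\<psi>\<in>Cc \<Omega>. \<forall>a b. T (\<lambda>z. a * \<phi> z + b * \<psi> z) = a * T \<phi> + b * T \<psi>"
    using assms(1) unfolding order_zero_def by (rule conjunct1)
  then show ?thesis using assms(2,3) by (elim ballE allE) auto
qed

text \<open>A functional of order zero is continuous for uniform convergence with supports in a fixed compact set.\<close>

lemma order_zero_eq_on_Cc:
  assumes \<Omega>: "open \<Omega>" and T: "order_zero \<Omega> T" "order_zero \<Omega> T'"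
    and eq: "\<And>\<phi>. \<phi> \<in> test_functions \<Omega> \<Longrightarrow> T \<phi> = T' \<phi>" and \<phi>: "\<phi> \<in> Cc \<Omega>"
  shows "T \<phi> = T' \<phi>"
proof -
  obtain K where K: "compact K" "K \<subseteq> \<Omega>" "{z. \<phi> z \<noteq> 0} \<subseteq> K"
    "\<And>e. 0 < e \<Longrightarrow> \<exists>\<psi>\<in>test_functions \<Omega>. {z. \<psi> z \<noteq> 0} \<subseteq> K \<and> (\<forall>z. cmod (\<phi> z - \<psi> z) \<le> e)"
    using test_functions_dense[OF \<Omega> \<phi>] by blast
  obtain C where C: "\<And>\<phi> B. \<phi> \<in> Cc \<Omega> \<Longrightarrow> {z. \<phi> z \<noteq> 0} \<subseteq> K \<Longrightarrow> (\<And>z. cmod (\<phi> z) \<le> B) \<Longrightarrow> cmod (T \<phi>) \<le> C * B"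
    using T(1) K(1,2) unfolding order_zero_def by meson
  obtain C' where C': "\<And>\<phi> B. \<phi> \<in> Cc \<Omega> \<Longrightarrow> {z. \<phi> z \<noteq> 0} \<subseteq> K \<Longrightarrow> (\<And>z. cmod (\<phi> z) \<le> B) \<Longrightarrow> cmod (T' \<phi>) \<le> C' * B"
    using T(2) K(1,2) unfolding order_zero_def by meson
  have le: "cmod (T \<phi> - T' \<phi>) \<le> (\<bar>C\<bar> + \<bar>C'\<bar>) * e" if e: "e > 0" for e
  proof -
    obtain \<psi> where \<psi>: "\<psi> \<in> test_functions \<Omega>" "{z. \<psi> z \<noteq> 0} \<subseteq> K" "\<And>z. cmod (\<phi> z - \<psi> z) \<le> e"
      using K(4)[OF e] by blast
    define d where "d z = 1 * \<phi> z + (- 1) * \<psi> z" for z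
    have d: "d \<in> Cc \<Omega>" unfolding d_def by (intro Cc_lincomb \<phi> test_functions_Cc \<psi>)
    have dK: "{z. d z \<noteq> 0} \<subseteq> K"
    proof
      fix z assume z: "z \<in> {z. d z \<noteq> 0}"
      show "z \<in> K"
      proof (rule ccontr)
        assume "z \<notin> K"
        then have "\<phi> z = 0" "\<psi> z = 0" using K(3) \<psi>(2) by blast+
        with z show False by (simp add: d_def)
      qed
    qed
    have de: "cmod (d z) \<le> e" for z using \<psi>(3)[of z] by (simp add: d_def)
    have "T d = 1 * T \<phi> + (- 1) * T \<psi>" "T' d = 1 * T' \<phi> + (- 1) * T' \<psi>"
      unfolding d_def by (rule order_zero_lincomb[OF T(1) \<phi> test_functions_Cc[OF \<psi>(1)]],
        rule order_zero_lincomb[OF T(2) \<phi> test_functions_Cc[OF \<psi>(1)]])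
    then have "T \<phi> - T' \<phi> = T d - T' d" using eq[OF \<psi>(1)] by simp
    also have "cmod \<dots> \<le> C * e + C' * e"
      using C[OF d dK de] C'[OF d dK de] norm_triangle_ineq4[of "T d" "T' d"] by linarith
    also have "\<dots> \<le> (\<bar>C\<bar> + \<bar>C'\<bar>) * e"
      using e by (auto simp: distrib_right intro!: add_mono mult_right_mono)
    finally show ?thesis .
  qed
  have "cmod (T \<phi> - T' \<phi>) \<le> 0"
  proof (rule field_le_epsilon)
    fix e :: real assume "e > 0"
    then have "cmod (T \<phi> - T' \<phi>) \<le> (\<bar>C\<bar> + \<bar>C'\<bar>) * (e / (\<bar>C\<bar> + \<bar>C'\<bar> + 1))" by (intro le) auto
    also have "\<dots> \<le> e" using \<open>e > 0\<close> by (auto simp: field_simps)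
    finally show "cmod (T \<phi> - T' \<phi>) \<le> 0 + e" by simp
  qed
  then show ?thesis by simp
qed

text \<open>By induction on \<open>k\<close>: the recursion determines the \<open>k\<close>-th functional on test functions, and density determines it
  on all continuous functions with compact support, where the next step of the recursion evaluates it.\<close>

theorem bedford_taylor_chain_unique:
  fixes v :: "complex ^ 'n \<Rightarrow> real"
  assumes \<Omega>: "open \<Omega>" and v: "continuous_on \<Omega> v"
    and M: "bedford_taylor_chain c \<Omega> v M" "bedford_taylor_chain c \<Omega> v M'"
    and "k + length L = CARD('n)" and "\<phi> \<in> Cc \<Omega>"
  shows "M k L \<phi> = M' k L \<phi>"
  using assms(5,6)
proof (induction k arbitrary: L \<phi>)
  case 0
  then show ?case using M unfolding bedford_taylor_chain_def by auto
next
  case (Suc k)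
  show ?case
  proof (rule order_zero_eq_on_Cc[OF \<Omega> _ _ _ Suc.prems(2)])
    show "order_zero \<Omega> (M (Suc k) L)" "order_zero \<Omega> (M' (Suc k) L)"
      using M Suc.prems(1) unfolding bedford_taylor_chain_def by blast+
    fix \<phi> assume \<phi>: "\<phi> \<in> test_functions \<Omega>"
    have "M k ((a, b) # L) (\<lambda>z. of_real (v z) * dz a (dzbar b \<phi>) z) = M' k ((a, b) # L) (\<lambda>z. of_real (v z) * dz a (dzbar b \<phi>) z)" for a b
      using Suc.prems(1) by (intro Suc.IH dz_dzbar_mult_in_Cc[OF \<Omega> v \<phi>]) simp
    then show "M (Suc k) L \<phi> = M' (Suc k) L \<phi>"
      using M \<phi> Suc.prems(1) unfolding bedford_taylor_chain_def by simp
  qed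
qed

lemma Cc_mono: "\<Omega>' \<subseteq> \<Omega> \<Longrightarrow> Cc \<Omega>' \<subseteq> Cc \<Omega>" by (auto simp: Cc_def)

lemma test_functions_mono: "\<Omega>' \<subseteq> \<Omega> \<Longrightarrow> test_functions \<Omega>' \<subseteq> test_functions \<Omega>"
  using Cc_mono by (auto simp: test_functions_def)

lemma bedford_taylor_chain_local:
  assumes M: "bedford_taylor_chain c \<Omega> v M" and sub: "\<Omega>' \<subseteq> \<Omega>" and v: "\<And>z. z \<in> \<Omega>' \<Longrightarrow> v' z = v z"
  shows "bedford_taylor_chain c \<Omega>' v' M"
  unfolding bedford_taylor_chain_def
proof (intro conjI allI impI ballI)
  fix k and L :: "('a \<times> 'a) list" assume "k + length L = CARD('a)"
  then have "order_zero \<Omega> (M k L)" using M unfolding bedford_taylor_chain_def by blast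
  then show "order_zero \<Omega>' (M k L)" unfolding order_zero_def
    using Cc_mono[OF sub] sub by (meson order_trans subsetD)
next
  fix L :: "('a \<times> 'a) list" and \<phi> assume "length L = CARD('a)" "\<phi> \<in> Cc \<Omega>'"
  then show "M 0 L \<phi> = of_real (volume_coeff L) * (LINT z|lborel. \<phi> z)"
    using M Cc_mono[OF sub] unfolding bedford_taylor_chain_def by blast
next
  fix k and L :: "('a \<times> 'a) list" and \<phi> assume kL: "Suc k + length L = CARD('a)" and \<phi>: "\<phi> \<in> test_functions \<Omega>'"
  have "(\<lambda>z. of_real (v z) * dz a (dzbar b \<phi>) z) = (\<lambda>z. complex_of_real (v' z) * dz a (dzbar b \<phi>) z)" for a b
  proof
    fix z
    show "of_real (v z) * dz a (dzbar b \<phi>) z = complex_of_real (v' z) * dz a (dzbar b \<phi>) z"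
    proof (cases "z \<in> closure {z. \<phi> z \<noteq> 0}")
      case True
      then have "z \<in> \<Omega>'" using \<phi> by (auto simp: test_functions_def Cc_def)
      then show ?thesis by (simp add: v)
    qed (simp add: dz_dzbar_eq_0_outside)
  qed
  then show "M (Suc k) L \<phi> = of_real (4 * c) * (\<Sum>a\<in>UNIV. \<Sum>b\<in>UNIV.
             M k ((a, b) # L) (\<lambda>z. of_real (v' z) * dz a (dzbar b \<phi>) z))"
    using M kL \<phi> test_functions_mono[OF sub] unfolding bedford_taylor_chain_def by auto
qed

lemma integrable_compact_support:
  fixes g :: "'a::euclidean_space \<Rightarrow> complex"
  assumes "continuous_on UNIV g" "compact S" "\<And>z. z \<notin> S \<Longrightarrow> g z = 0"
  shows "integrable lborel g"
proof -
  have "integrable lborel (\<lambda>x. indicator S x *\<^sub>R g x)"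
    by (rule borel_integrable_compact[OF assms(2) continuous_on_subset[OF assms(1)]]) simp
  moreover have "(\<lambda>x. indicator S x *\<^sub>R g x) = g" using assms(3) by (auto simp: indicator_def fun_eq_iff)
  ultimately show ?thesis by simp
qed

lemma lborel_integral_translate:
  fixes g :: "'a::euclidean_space \<Rightarrow> complex"
  assumes [measurable]: "g \<in> borel_measurable borel"
  shows "(LINT z|lborel. g (w + z)) = (LINT z|lborel. g z)"
  using integral_distr[of "(+) w" lborel borel g] lborel_distr_plus[of w] by simp

text \<open>Difference quotients have integral 0 by translation invariance, and they converge
  dominatedly to the derivative.\<close>

lemma integral_derivative_compact_support:
  fixes g :: "complex ^ 'n \<Rightarrow> complex"
  assumes g: "Ck 1 g" and S: "compact S" "\<And>z. z \<notin> S \<Longrightarrow> g z = 0"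
  shows "(LINT z|lborel. frechet_derivative g (at z) v) = 0"
proof -
  define D where "D z = frechet_derivative g (at z) v" for z
  have gd: "(g has_derivative frechet_derivative g (at z)) (at z)" for z
    using g frechet_derivative_works by auto
  have Dc: "continuous_on UNIV D" using g by (auto simp: D_def[abs_def])
  have gc: "continuous_on UNIV g" using g by (rule Ck_imp_continuous)
  have [measurable]: "g \<in> borel_measurable borel" using gc by (rule borel_measurable_continuous_onI)
  have [measurable]: "D \<in> borel_measurable borel" using Dc by (rule borel_measurable_continuous_onI)
  have "closure {z. g z \<noteq> 0} \<subseteq> S" using S by (intro closure_minimal compact_imp_closed) auto
  then have "z \<notin> closure {z. g z \<noteq> 0}" if "z \<notin> S" for z using that by blast
  then have D0: "D z = 0" if "z \<notin> S" for z
    using that by (simp add: frechet_derivative_eq_0_outside D_def)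
  have "bounded (D ` S)" using S(1) Dc by (meson compact_continuous_image compact_imp_bounded continuous_on_subset subset_UNIV)
  then obtain B where B0: "\<And>z. z \<in> S \<Longrightarrow> cmod (D z) \<le> B" unfolding bounded_iff by blast
  have B: "cmod (D z) \<le> \<bar>B\<bar>" for z using B0[of z] D0[of z] by (cases "z \<in> S") auto
  define S' where "S' = (\<lambda>(x, t). x - t *\<^sub>R v) ` (S \<times> {0..1::real})"
  have S': "compact S'" unfolding S'_def split_beta
    by (intro compact_continuous_image continuous_intros compact_Times S) auto
  define q where "q k z = (g (z + (1 / real (Suc k)) *\<^sub>R v) - g z) * of_nat (Suc k)" for k z
  have line: "((\<lambda>t. g (z + t *\<^sub>R v)) has_vector_derivative D (z + t *\<^sub>R v)) (at t)" for z t
  proof -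
    have "((\<lambda>t. g (z + t *\<^sub>R v)) has_derivative (\<lambda>h. frechet_derivative g (at (z + t *\<^sub>R v)) (h *\<^sub>R v))) (at t)"
      by (rule has_derivative_compose[OF _ gd]) (auto intro!: derivative_eq_intros)
    moreover have "frechet_derivative g (at y) (h *\<^sub>R v) = h *\<^sub>R D y" for y h
      using has_derivative_linear[OF gd] by (simp add: D_def linear_scale)
    ultimately show ?thesis by (simp add: has_vector_derivative_def)
  qed
  have qle: "cmod (q k z) \<le> \<bar>B\<bar> * indicator S' z" for k z
  proof (cases "z \<in> S'")
    case True
    let ?t = "1 / real (Suc k)"
    have "norm (g (z + ?t *\<^sub>R v) - g (z + 0 *\<^sub>R v)) \<le> \<bar>B\<bar> * norm (?t - 0)"
    proof (rule differentiable_bound[where S = UNIV and f = "\<lambda>t. g (z + t *\<^sub>R v)" and f' = "\<lambda>t h. h *\<^sub>R D (z + t *\<^sub>R v)"])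
      show "onorm (\<lambda>h. h *\<^sub>R D (z + t *\<^sub>R v)) \<le> \<bar>B\<bar>" for t
      proof (rule onorm_bound)
        show "norm (h *\<^sub>R D (z + t *\<^sub>R v)) \<le> \<bar>B\<bar> * norm h" for h
          using mult_right_mono[OF B[of "z + t *\<^sub>R v"] norm_ge_zero[of h]] by (simp add: mult.commute)
      qed simp
    qed (use line in \<open>auto simp: has_vector_derivative_def\<close>)
    then have "cmod (g (z + ?t *\<^sub>R v) - g z) * real (Suc k) \<le> \<bar>B\<bar> * ?t * real (Suc k)"
      by (intro mult_right_mono) auto
    then show ?thesis using True by (simp add: q_def norm_mult del: of_nat_Suc)
  next
    case False
    have "z + t *\<^sub>R v \<notin> S" if "t \<in> {0..1}" for t
    proof
      assume "z + t *\<^sub>R v \<in> S"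
      then have "(\<lambda>(x, t). x - t *\<^sub>R v) (z + t *\<^sub>R v, t) \<in> S'" unfolding S'_def using that by (intro imageI) simp
      then show False using False by simp
    qed
    from this[of 0] this[of "1 / real (Suc k)"] show ?thesis using S(2) by (simp add: q_def)
  qed
  have "(\<lambda>k. LINT z|lborel. q k z) \<longlonglongrightarrow> (LINT z|lborel. D z)"
  proof (rule integral_dominated_convergence[where w = "\<lambda>z. \<bar>B\<bar> * indicator S' z"])
    show "integrable lborel (\<lambda>z. \<bar>B\<bar> * indicator S' z)"
      using S' by (intro integrable_mult_right integrable_real_indicator emeasure_compact_finite) (auto simp: borel_compact)
    show "AE z in lborel. (\<lambda>k. q k z) \<longlonglongrightarrow> D z"
    proof (rule AE_I2)
      fix z
      have "((\<lambda>h. norm (g (z + (0 + h) *\<^sub>R v) - g (z + 0 *\<^sub>R v) - h *\<^sub>R D (z + 0 *\<^sub>R v)) / norm h) \<longlongrightarrow> 0) (at 0)"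
        using line[of z 0] unfolding has_vector_derivative_def has_derivative_at by blast
      moreover have "\<forall>\<^sub>F h in at 0. norm (g (z + (0 + h) *\<^sub>R v) - g (z + 0 *\<^sub>R v) - h *\<^sub>R D (z + 0 *\<^sub>R v)) / norm h
          = norm ((1 / h) *\<^sub>R (g (z + h *\<^sub>R v) - g z) - D z)"
        unfolding eventually_at_filter
      proof (intro always_eventually allI impI)
        fix h :: real assume "h \<noteq> 0"
        then have "(1 / h) *\<^sub>R (g (z + h *\<^sub>R v) - g z) - D z = (1 / h) *\<^sub>R (g (z + h *\<^sub>R v) - g z - h *\<^sub>R D z)"
          by (simp add: scaleR_diff_right)
        then show "norm (g (z + (0 + h) *\<^sub>R v) - g (z + 0 *\<^sub>R v) - h *\<^sub>R D (z + 0 *\<^sub>R v)) / norm h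
          = norm ((1 / h) *\<^sub>R (g (z + h *\<^sub>R v) - g z) - D z)" by simp
      qed
      ultimately have "((\<lambda>h. norm ((1 / h) *\<^sub>R (g (z + h *\<^sub>R v) - g z) - D z)) \<longlongrightarrow> 0) (at 0)"
        by (rule Lim_transform_eventually)
      then have "((\<lambda>h. (1 / h) *\<^sub>R (g (z + h *\<^sub>R v) - g z)) \<longlongrightarrow> D z) (at 0)"
        by (rule LIM_zero_cancel[OF tendsto_norm_zero_cancel])
      moreover have "filterlim (\<lambda>k. 1 / real (Suc k)) (at 0) sequentially"
        using LIMSEQ_inverse_real_of_nat by (auto simp: filterlim_at inverse_eq_divide)
      ultimately have "(\<lambda>k. (1 / (1 / real (Suc k))) *\<^sub>R (g (z + (1 / real (Suc k)) *\<^sub>R v) - g z)) \<longlonglongrightarrow> D z"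
        by (rule filterlim_compose)
      then show "(\<lambda>k. q k z) \<longlonglongrightarrow> D z"
        by (simp add: q_def[abs_def] scaleR_conv_of_real mult.commute del: of_nat_Suc)
    qed
  qed (use qle in \<open>auto simp: q_def\<close>)
  moreover have "(LINT z|lborel. q k z) = 0" for k
  proof -
    have gi: "integrable lborel g" by (rule integrable_compact_support[OF gc S])
    have gi': "integrable lborel (\<lambda>z. g (w + z))" for w
    proof (rule integrable_compact_support)
      show "continuous_on UNIV (\<lambda>z. g (w + z))" by (intro continuous_on_compose2[OF gc] continuous_intros) auto
      show "compact ((\<lambda>x. x - w) ` S)" by (intro compact_continuous_image continuous_intros S)
      show "g (w + z) = 0" if "z \<notin> (\<lambda>x. x - w) ` S" for z
      proof (rule S(2), rule notI)
        assume "w + z \<in> S"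
        then have "(w + z) - w \<in> (\<lambda>x. x - w) ` S" by (rule imageI)
        with that show False by simp
      qed
    qed
    show ?thesis
      using gi gi' lborel_integral_translate[of g] by (simp add: q_def add.commute[of _ "_ *\<^sub>R v"] del: of_nat_Suc)
  qed
  ultimately show ?thesis by (simp add: D_def LIMSEQ_const_iff)
qed

text \<open>For constant \<open>v\<close> the first functional is a combination of integrals of second derivatives of a test function,
  which are 0; the recursion then propagates 0.\<close>

lemma bedford_taylor_chain_const:
  fixes v :: "complex ^ 'n \<Rightarrow> real"
  assumes \<Omega>: "open \<Omega>" and v: "\<And>z. z \<in> \<Omega> \<Longrightarrow> v z = r" and M: "bedford_taylor_chain c \<Omega> v M"
    and "Suc k + length L = CARD('n)" and "\<phi> \<in> Cc \<Omega>"
  shows "M (Suc k) L \<phi> = 0"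
  using assms(4,5)
proof (induction k arbitrary: L \<phi>)
  case (0 L \<phi>)
  show ?case
  proof (rule order_zero_eq_on_Cc[OF \<Omega> _ _ _ 0(2)])
    show "order_zero \<Omega> (M (Suc 0) L)" using M 0(1) unfolding bedford_taylor_chain_def by blast
    show "order_zero \<Omega> (\<lambda>_. 0)" unfolding order_zero_def by (auto intro!: exI[of _ 0])
    fix \<phi> assume \<phi>: "\<phi> \<in> test_functions \<Omega>"
    have Ck: "Ck k \<phi>" for k using \<phi> by (simp add: test_functions_def)
    have "M 0 ((a, b) # L) (\<lambda>z. of_real (v z) * dz a (dzbar b \<phi>) z) = 0" for a b
    proof -
      let ?S = "closure {z. \<phi> z \<noteq> 0}"
      have vd: "of_real (v z) * dz a (dzbar b \<phi>) z = of_real r * dz a (dzbar b \<phi>) z" for z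
        using \<phi> v[of z] dz_dzbar_eq_0_outside[of z \<phi>] by (cases "z \<in> ?S") (auto simp: test_functions_def Cc_def)
      have vc: "continuous_on \<Omega> v" by (rule continuous_on_eq[OF continuous_on_const[of _ r]]) (use v in auto)
      have S: "compact ?S" using \<phi> by (auto simp: test_functions_def Cc_def)
      have g1: "Ck 1 (dzbar b \<phi>)" using Ck_dzbar[OF Ck[of "Suc 1"]] .
      have I0: "(LINT z|lborel. frechet_derivative (dzbar b \<phi>) (at z) w) = 0" for w
        by (rule integral_derivative_compact_support[OF g1 S]) (rule dzbar_eq_0_outside)
      have Ii: "integrable lborel (\<lambda>z. frechet_derivative (dzbar b \<phi>) (at z) w)" for w
      proof (rule integrable_compact_support[OF _ S])
        show "continuous_on UNIV (\<lambda>z. frechet_derivative (dzbar b \<phi>) (at z) w)" using g1 by auto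
        have "closure {z. dzbar b \<phi> z \<noteq> 0} \<subseteq> ?S"
          by (rule closure_minimal) (use dzbar_eq_0_outside in blast)+
        then have "z \<notin> closure {z. dzbar b \<phi> z \<noteq> 0}" if "z \<notin> ?S" for z using that by blast
        then show "frechet_derivative (dzbar b \<phi>) (at z) w = 0" if "z \<notin> ?S" for z
          using that by (simp add: frechet_derivative_eq_0_outside)
      qed
      have "(LINT z|lborel. of_real (v z) * dz a (dzbar b \<phi>) z) = of_real r * (LINT z|lborel. dz a (dzbar b \<phi>) z)"
        unfolding vd by simp
      also have "(LINT z|lborel. dz a (dzbar b \<phi>) z) = 0"
        unfolding dz_def using I0 Ii by simp
      finally have "(LINT z|lborel. of_real (v z) * dz a (dzbar b \<phi>) z) = 0" by simp
      moreover have "M 0 ((a, b) # L) (\<lambda>z. of_real (v z) * dz a (dzbar b \<phi>) z) =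
         of_real (volume_coeff ((a, b) # L)) * (LINT z|lborel. of_real (v z) * dz a (dzbar b \<phi>) z)"
        using M 0(1) dz_dzbar_mult_in_Cc[OF \<Omega> vc \<phi>] unfolding bedford_taylor_chain_def by simp
      ultimately show ?thesis by simp
    qed
    then show "M (Suc 0) L \<phi> = 0"
      using M \<phi> 0(1) unfolding bedford_taylor_chain_def by simp
  qed
next
  case (Suc k L \<phi>)
  have vc: "continuous_on \<Omega> v" by (rule continuous_on_eq[OF continuous_on_const[of _ r]]) (use v in auto)
  show ?case
  proof (rule order_zero_eq_on_Cc[OF \<Omega> _ _ _ Suc.prems(2)])
    show "order_zero \<Omega> (M (Suc (Suc k)) L)" using M Suc.prems(1) unfolding bedford_taylor_chain_def by blast
    show "order_zero \<Omega> (\<lambda>_. 0)" unfolding order_zero_def by (auto intro!: exI[of _ 0])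
    fix \<phi> assume \<phi>: "\<phi> \<in> test_functions \<Omega>"
    have "M (Suc k) ((a, b) # L) (\<lambda>z. of_real (v z) * dz a (dzbar b \<phi>) z) = 0" for a b
      using Suc.prems(1) by (intro Suc.IH dz_dzbar_mult_in_Cc[OF \<Omega> vc \<phi>]) simp
    then show "M (Suc (Suc k)) L \<phi> = 0"
      using M \<phi> Suc.prems(1) unfolding bedford_taylor_chain_def by simp
  qed
qed

section \<open>Invariance under rotations\<close>

lemma nn_integral_lborel_translate:
  fixes f :: "'a::euclidean_space \<Rightarrow> ennreal"
  assumes [measurable]: "f \<in> borel_measurable borel"
  shows "(\<integral>\<^sup>+z. f (w + z) \<partial>lborel) = (\<integral>\<^sup>+z. f z \<partial>lborel)"
  using nn_integral_distr[of "(+) w" lborel borel f] lborel_distr_plus[of w] by simp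

text \<open>The image measure is translation invariant. Comparing it with Lebesgue measure through Tonelli's
  theorem, the two agree up to a factor, and the factor is 1 since the unit ball is preserved.\<close>

theorem lborel_distr_linear_isometry:
  fixes T S :: "'a::euclidean_space \<Rightarrow> 'a"
  assumes lin: "linear T" and iso: "\<And>x. norm (T x) = norm x" and inv: "\<And>y. T (S y) = y"
  shows "distr lborel borel T = lborel"
proof (rule measure_eqI)
  have "continuous_on UNIV T" using lin by (simp add: linear_continuous_on linear_conv_bounded_linear)
  then have T[measurable]: "T \<in> borel_measurable borel" by (rule borel_measurable_continuous_onI)
  show "sets (distr lborel borel T) = sets lborel" by simp
  fix A assume "A \<in> sets (distr lborel borel T)"
  then have A[measurable]: "A \<in> sets borel" by simp
  define B where "B = ball (0::'a) 1"
  have B[measurable]: "B \<in> sets borel" by (simp add: B_def)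
  define \<beta> where "\<beta> = emeasure lborel B"
  have "\<beta> \<noteq> \<infinity>" unfolding \<beta>_def B_def using emeasure_lborel_ball_finite[of "0::'a" 1] by simp
  have "\<beta> \<noteq> 0"
    unfolding \<beta>_def B_def using open_not_negligible[of "ball (0::'a) 1"]
    by (auto simp: negligible_iff_null_sets null_sets_def emeasure_lborel_ball_finite null_sets_completion_iff)
  \<comment> \<open>Both sides are compared through the double integral of \<open>indicator A (T x) * indicator B (y - T x)\<close>.\<close>
  have "emeasure (distr lborel borel T) A * \<beta> = (\<integral>\<^sup>+x. indicator A (T x) * (\<integral>\<^sup>+y. indicator B y \<partial>lborel) \<partial>lborel)"
  proof -
    have "emeasure (distr lborel borel T) A = (\<integral>\<^sup>+x. indicator A (T x) \<partial>lborel)"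
      using nn_integral_distr[of T lborel borel "indicator A"] by simp
    then show ?thesis by (simp add: nn_integral_multc \<beta>_def)
  qed
  also have "\<dots> = (\<integral>\<^sup>+x. (\<integral>\<^sup>+y. indicator A (T x) * indicator B (- T x + y) \<partial>lborel) \<partial>lborel)"
  proof (rule nn_integral_cong)
    fix x
    have "(\<integral>\<^sup>+y. indicator B y \<partial>lborel) = (\<integral>\<^sup>+y. indicator B (- T x + y) \<partial>lborel)"
      by (rule nn_integral_lborel_translate[symmetric]) measurable
    then show "indicator A (T x) * (\<integral>\<^sup>+y. indicator B y \<partial>lborel) = (\<integral>\<^sup>+y. indicator A (T x) * indicator B (- T x + y) \<partial>lborel)"
      by (subst nn_integral_cmult) simp_all
  qed
  also have "\<dots> = (\<integral>\<^sup>+y. (\<integral>\<^sup>+x. indicator A (T x) * indicator B (- T x + y) \<partial>lborel) \<partial>lborel)"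
    by (rule lborel_pair.Fubini') measurable
  also have "\<dots> = (\<integral>\<^sup>+y. (\<integral>\<^sup>+x. indicator A (T (S y + x)) * indicator B (- T (S y + x) + y) \<partial>lborel) \<partial>lborel)"
    by (intro nn_integral_cong nn_integral_lborel_translate[symmetric]) measurable
  also have "\<dots> = (\<integral>\<^sup>+y. (\<integral>\<^sup>+x. indicator A (T x + y) * indicator B (- T x) \<partial>lborel) \<partial>lborel)"
    using inv by (simp add: linear_add[OF lin] add.commute)
  also have "\<dots> = (\<integral>\<^sup>+x. (\<integral>\<^sup>+y. indicator A (T x + y) * indicator B (- T x) \<partial>lborel) \<partial>lborel)"
    by (rule lborel_pair.Fubini') measurable
  also have "\<dots> = (\<integral>\<^sup>+x. (\<integral>\<^sup>+y. indicator A (T x + y) \<partial>lborel) * indicator B x \<partial>lborel)"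
    by (auto simp: nn_integral_multc B_def indicator_def iso intro!: nn_integral_cong)
  also have "\<dots> = (\<integral>\<^sup>+x. emeasure lborel A * indicator B x \<partial>lborel)"
  proof (rule nn_integral_cong)
    fix x
    have "(\<integral>\<^sup>+y. indicator A (T x + y) \<partial>lborel) = (\<integral>\<^sup>+y. indicator A y \<partial>lborel)"
      by (rule nn_integral_lborel_translate) measurable
    then show "(\<integral>\<^sup>+y. indicator A (T x + y) \<partial>lborel) * indicator B x = emeasure lborel A * indicator B x"
      by simp
  qed
  also have "\<dots> = emeasure lborel A * \<beta>" by (simp add: nn_integral_cmult \<beta>_def)
  finally have "emeasure (distr lborel borel T) A * \<beta> / \<beta> = emeasure lborel A * \<beta> / \<beta>" by simp
  then show "emeasure (distr lborel borel T) A = emeasure lborel A"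
    using \<open>\<beta> \<noteq> 0\<close> \<open>\<beta> \<noteq> \<infinity>\<close> by (simp add: mult_divide_eq_ennreal)
qed

lemma linear_vector_scalar_mult: "linear ((*s) (w::complex) :: complex ^ 'n \<Rightarrow> _)"
  by (rule linearI) (auto simp: vec_eq_iff algebra_simps)

lemma continuous_on_vector_scalar_mult [continuous_intros]:
  fixes f :: "'a::topological_space \<Rightarrow> complex" and g :: "'a \<Rightarrow> complex ^ 'n"
  assumes "continuous_on S f" "continuous_on S g"
  shows "continuous_on S (\<lambda>x. f x *s g x)"
  unfolding vector_scalar_mult_def by (intro continuous_intros assms)

lemma measurable_rotation [measurable]:
  "(*s) w \<in> borel \<rightarrow>\<^sub>M (borel :: (complex ^ 'n) measure)"
  by (intro borel_measurable_continuous_onI linear_continuous_on)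
     (simp add: linear_vector_scalar_mult linear_conv_bounded_linear[symmetric])

lemma norm_vector_scalar_mult: "cmod w = 1 \<Longrightarrow> norm (w *s z) = norm (z :: complex ^ 'n)"
  by (simp add: norm_vec_def norm_mult)

lemma rotation_cancel:
  fixes z :: "complex ^ 'n"
  assumes "cmod w = 1"
  shows "w *s (cnj w *s z) = z" "cnj w *s (w *s z) = z" "w * cnj w = 1" "cnj w * w = 1"
proof -
  show 1: "w * cnj w = 1" using assms by (simp add: complex_norm_square[symmetric])
  then show 2: "cnj w * w = 1" by (simp add: mult.commute)
  show "w *s (cnj w *s z) = z" "cnj w *s (w *s z) = z"
    by (simp_all add: vector_smult_assoc 1 2)
qed

lemma lborel_distr_rotation:
  assumes "cmod w = 1"
  shows "distr lborel borel ((*s) w :: complex ^ 'n \<Rightarrow> _) = lborel"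
  by (rule lborel_distr_linear_isometry[where S = "(*s) (cnj w)"])
     (use assms in \<open>simp_all add: linear_vector_scalar_mult norm_vector_scalar_mult rotation_cancel\<close>)

lemma frechet_derivative_rotation:
  fixes f :: "complex ^ 'n \<Rightarrow> complex"
  assumes "\<And>z. f differentiable (at z)"
  shows "frechet_derivative (\<lambda>z. f (w *s z)) (at z) v = frechet_derivative f (at (w *s z)) (w *s v)"
    and "(\<lambda>z. f (w *s z)) differentiable (at z)"
proof -
  have "((*s) w has_derivative (*s) w) (at z)"
    by (intro linear_imp_has_derivative linear_vector_scalar_mult)
  then have "((\<lambda>z. f (w *s z)) has_derivative (\<lambda>v. frechet_derivative f (at (w *s z)) (w *s v))) (at z)"
    using has_derivative_compose assms frechet_derivative_works by blast
  then show "frechet_derivative (\<lambda>z. f (w *s z)) (at z) v = frechet_derivative f (at (w *s z)) (w *s v)"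
    "(\<lambda>z. f (w *s z)) differentiable (at z)"
    using frechet_derivative_at by (metis, auto simp: differentiable_def)
qed

lemma Ck_rotation: "Ck k f \<Longrightarrow> Ck k (\<lambda>z. f (w *s z))"
proof (induction k arbitrary: f)
  case 0
  then show ?case by (auto intro!: continuous_on_compose2[of UNIV f] continuous_intros)
next
  case (Suc k)
  then show ?case by (auto simp: frechet_derivative_rotation)
qed

lemma frechet_derivative_axis:
  fixes f :: "complex ^ 'n \<Rightarrow> complex"
  assumes "f differentiable (at z)"
  shows "frechet_derivative f (at z) (axis a c)
    = of_real (Re c) * frechet_derivative f (at z) (axis a 1) + of_real (Im c) * frechet_derivative f (at z) (axis a \<i>)"
proof -
  have lin: "linear (frechet_derivative f (at z))" using assms by (rule linear_frechet_derivative)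
  have "axis a c = Re c *\<^sub>R axis a 1 + Im c *\<^sub>R axis a \<i>"
    by (simp add: vec_eq_iff axis_def complex_eq_iff)
  then have "frechet_derivative f (at z) (axis a c) = Re c *\<^sub>R frechet_derivative f (at z) (axis a 1) + Im c *\<^sub>R frechet_derivative f (at z) (axis a \<i>)"
    by (simp only: linear_add[OF lin] linear_scale[OF lin])
  then show ?thesis by (simp only: scaleR_conv_of_real)
qed

lemma dz_rotation:
  fixes f :: "complex ^ 'n \<Rightarrow> complex"
  assumes "\<And>z. f differentiable (at z)"
  shows "dz a (\<lambda>z. f (w *s z)) z = w * dz a f (w *s z)"
    and "dzbar a (\<lambda>z. f (w *s z)) z = cnj w * dzbar a f (w *s z)"
proof -
  have ax: "w *s axis a c = axis a (w * c)" for c by (simp add: vec_eq_iff axis_def)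
  note d = frechet_derivative_axis[OF assms]
  define X Y where "X = frechet_derivative f (at (w *s z)) (axis a 1)" and "Y = frechet_derivative f (at (w *s z)) (axis a \<i>)"
  have w: "w = of_real (Re w) + \<i> * of_real (Im w)" by (simp add: complex_eq mult.commute)
  have cw: "cnj w = of_real (Re w) - \<i> * of_real (Im w)" by (simp add: complex_eq_iff)
  have e: "frechet_derivative (\<lambda>z. f (w *s z)) (at z) (axis a 1) = of_real (Re w) * X + of_real (Im w) * Y"
      "frechet_derivative (\<lambda>z. f (w *s z)) (at z) (axis a \<i>) = - of_real (Im w) * X + of_real (Re w) * Y"
    unfolding frechet_derivative_rotation(1)[OF assms] ax
    using d[of "w *s z" a w] d[of "w *s z" a "w * \<i>"] by (simp_all add: X_def Y_def)
  have i2: "\<i> * (\<i> * x) = - x" for x by (simp add: mult.assoc[symmetric])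
  show "dz a (\<lambda>z. f (w *s z)) z = w * dz a f (w *s z)"
    unfolding dz_def e X_def[symmetric] Y_def[symmetric] by (subst (3) w) (simp add: algebra_simps add_divide_distrib diff_divide_distrib i2)
  show "dzbar a (\<lambda>z. f (w *s z)) z = cnj w * dzbar a f (w *s z)"
    unfolding dzbar_def e X_def[symmetric] Y_def[symmetric] cw by (simp add: algebra_simps add_divide_distrib diff_divide_distrib i2)
qed

lemma Ck_imp_differentiable: "Ck (Suc k) f \<Longrightarrow> f differentiable (at z)" by simp

lemma dz_cmult:
  fixes f :: "complex ^ 'n \<Rightarrow> complex"
  assumes "f differentiable (at z)"
  shows "dz a (\<lambda>z. c * f z) z = c * dz a f z"
proof -
  have "frechet_derivative (\<lambda>z. c * f z) (at z) = (\<lambda>v. c * frechet_derivative f (at z) v)"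
    using assms by (intro frechet_derivative_at[symmetric] has_derivative_mult_right) (simp add: frechet_derivative_works)
  then show ?thesis by (simp add: dz_def algebra_simps)
qed

text \<open>The factors \<open>w\<close> and \<open>cnj w\<close> produced by the two derivatives cancel.\<close>

lemma dz_dzbar_rotation:
  fixes f :: "complex ^ 'n \<Rightarrow> complex"
  assumes f: "Ck 2 f" and w: "cmod w = 1"
  shows "dz a (dzbar b (\<lambda>z. f (w *s z))) z = dz a (dzbar b f) (w *s z)"
proof -
  have f': "Ck (Suc (Suc 0)) f" using f by (simp only: numeral_2_eq_2)
  have d1: "f differentiable (at z)" for z using Ck_imp_differentiable[OF f'] .
  have d2: "dzbar b f differentiable (at z)" for z using Ck_imp_differentiable[OF Ck_dzbar[OF f']] .
  have "dzbar b (\<lambda>z. f (w *s z)) = (\<lambda>z. cnj w * dzbar b f (w *s z))"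
    using dz_rotation(2)[OF d1] by (simp add: fun_eq_iff)
  then have "dz a (dzbar b (\<lambda>z. f (w *s z))) z = cnj w * (w * dz a (dzbar b f) (w *s z))"
    using dz_cmult[OF frechet_derivative_rotation(2)[OF d2]] dz_rotation(1)[OF d2] by simp
  also have "cnj w * w = 1" using w by (simp add: complex_norm_square[symmetric] mult.commute[of "cnj w"])
  then have "cnj w * (w * dz a (dzbar b f) (w *s z)) = dz a (dzbar b f) (w *s z)" by (simp flip: mult.assoc)
  finally show ?thesis .
qed

lemma compact_rotation:
  fixes K :: "(complex ^ 'n) set"
  assumes "compact K" shows "compact ((*s) w ` K)"
  by (intro compact_continuous_image continuous_intros assms)

lemma Cc_rotation:
  fixes \<Omega> :: "(complex ^ 'n) set"
  assumes w: "cmod w = 1" and \<Omega>: "\<And>z. w *s z \<in> \<Omega> \<longleftrightarrow> z \<in> \<Omega>" and \<phi>: "\<phi> \<in> Cc \<Omega>"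
  shows "(\<lambda>z. \<phi> (w *s z)) \<in> Cc \<Omega>"
proof -
  let ?K = "(*s) (cnj w) ` closure {z. \<phi> z \<noteq> 0}"
  have K: "compact ?K" using \<phi> by (intro compact_rotation) (auto simp: Cc_def)
  have "{z. \<phi> (w *s z) \<noteq> 0} \<subseteq> ?K"
  proof
    fix z assume "z \<in> {z. \<phi> (w *s z) \<noteq> 0}"
    then have "w *s z \<in> closure {z. \<phi> z \<noteq> 0}" using closure_subset by fastforce
    then have "cnj w *s (w *s z) \<in> ?K" by (rule imageI)
    then show "z \<in> ?K" by (simp add: rotation_cancel[OF w])
  qed
  then have sub: "closure {z. \<phi> (w *s z) \<noteq> 0} \<subseteq> ?K"
    using K by (intro closure_minimal compact_imp_closed)
  have "?K \<subseteq> \<Omega>"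
  proof
    fix y assume "y \<in> ?K"
    then obtain x where x: "x \<in> closure {z. \<phi> z \<noteq> 0}" "y = cnj w *s x" by blast
    then have "w *s y \<in> \<Omega>" using \<phi> by (auto simp: Cc_def rotation_cancel[OF w])
    then show "y \<in> \<Omega>" using \<Omega> by blast
  qed
  moreover have "compact (closure {z. \<phi> (w *s z) \<noteq> 0})"
    using compact_Int_closed[OF K closed_closure, of "{z. \<phi> (w *s z) \<noteq> 0}"] by (simp only: Int_absorb1[OF sub])
  moreover have "continuous_on UNIV (\<lambda>z. \<phi> (w *s z))"
    by (rule continuous_on_compose2[of UNIV \<phi>]) (use \<phi> in \<open>auto simp: Cc_def intro!: continuous_on_vector_scalar_mult\<close>)
  ultimately show ?thesis using sub by (auto simp: Cc_def)
qed

text \<open>The forms \<open>\<omega>\<^sub>a\<^sub>b\<close> are invariant under \<open>z \<mapsto> w z\<close>, as \<open>w cnj w = 1\<close>, so the pullback of a chain needs no coefficients.\<close>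

lemma bedford_taylor_chain_rotation:
  fixes \<Omega> :: "(complex ^ 'n) set"
  assumes w: "cmod w = 1" and \<Omega>: "\<And>z. w *s z \<in> \<Omega> \<longleftrightarrow> z \<in> \<Omega>" and v: "\<And>z. v (w *s z) = v z"
    and M: "bedford_taylor_chain c \<Omega> v M"
  shows "bedford_taylor_chain c \<Omega> v (\<lambda>k L \<phi>. M k L (\<lambda>z. \<phi> (w *s z)))"
  unfolding bedford_taylor_chain_def
proof (intro conjI allI impI ballI)
  fix k and L :: "('n \<times> 'n) list" assume "k + length L = CARD('n)"
  then have o: "order_zero \<Omega> (M k L)" using M unfolding bedford_taylor_chain_def by blast
  show "order_zero \<Omega> (\<lambda>\<phi>. M k L (\<lambda>z. \<phi> (w *s z)))"
    unfolding order_zero_def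
  proof (intro conjI; intro ballI allI impI)
    fix \<phi> \<psi> a b assume p: "\<phi> \<in> Cc \<Omega>" "\<psi> \<in> Cc \<Omega>"
    show "M k L (\<lambda>z. a * \<phi> (w *s z) + b * \<psi> (w *s z)) = a * M k L (\<lambda>z. \<phi> (w *s z)) + b * M k L (\<lambda>z. \<psi> (w *s z))"
      using order_zero_lincomb[OF o Cc_rotation[OF w \<Omega> p(1)] Cc_rotation[OF w \<Omega> p(2)]] .
  next
    fix K assume K: "compact K \<and> K \<subseteq> \<Omega>"
    let ?K = "(*s) (cnj w) ` K"
    have mem: "z \<in> ?K" if "w *s z \<in> K" for z
    proof -
      have "cnj w *s (w *s z) \<in> ?K" using that by (rule imageI)
      then show ?thesis by (simp add: rotation_cancel[OF w])
    qed
    have "?K \<subseteq> \<Omega>"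
    proof
      fix y assume "y \<in> ?K"
      then have "w *s y \<in> \<Omega>" using K by (auto simp: rotation_cancel[OF w])
      then show "y \<in> \<Omega>" using \<Omega> by blast
    qed
    moreover have "compact ?K" using K by (intro compact_rotation) auto
    ultimately obtain C where C: "\<And>\<phi> B. \<phi> \<in> Cc \<Omega> \<Longrightarrow> {z. \<phi> z \<noteq> 0} \<subseteq> ?K \<Longrightarrow> (\<And>z. cmod (\<phi> z) \<le> B) \<Longrightarrow> cmod (M k L \<phi>) \<le> C * B"
      using o unfolding order_zero_def by meson
    show "\<exists>C. \<forall>\<phi>\<in>Cc \<Omega>. \<forall>B. {z. \<phi> z \<noteq> 0} \<subseteq> K \<and> (\<forall>z. cmod (\<phi> z) \<le> B) \<longrightarrow> cmod (M k L (\<lambda>z. \<phi> (w *s z))) \<le> C * B"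
    proof (intro exI[of _ C] ballI allI impI)
      fix \<phi> B assume p: "\<phi> \<in> Cc \<Omega>" and q: "{z. \<phi> z \<noteq> 0} \<subseteq> K \<and> (\<forall>z. cmod (\<phi> z) \<le> B)"
      show "cmod (M k L (\<lambda>z. \<phi> (w *s z))) \<le> C * B"
        by (rule C[OF Cc_rotation[OF w \<Omega> p]]) (use q mem in blast)+
    qed
  qed
next
  fix L :: "('n \<times> 'n) list" and \<phi> assume L: "length L = CARD('n)" and \<phi>: "\<phi> \<in> Cc \<Omega>"
  have [measurable]: "\<phi> \<in> borel_measurable borel"
    using \<phi> by (auto simp: Cc_def intro: borel_measurable_continuous_onI)
  have "(LINT z|lborel. \<phi> (w *s z)) = (LINT z|distr lborel borel ((*s) w). \<phi> z)"
    by (subst integral_distr) auto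
  also have "\<dots> = (LINT z|lborel. \<phi> z)" by (simp add: lborel_distr_rotation[OF w])
  finally show "M 0 L (\<lambda>z. \<phi> (w *s z)) = of_real (volume_coeff L) * (LINT z|lborel. \<phi> z)"
    using M L Cc_rotation[OF w \<Omega> \<phi>] unfolding bedford_taylor_chain_def by auto
next
  fix k and L :: "('n \<times> 'n) list" and \<phi> assume kL: "Suc k + length L = CARD('n)" and \<phi>: "\<phi> \<in> test_functions \<Omega>"
  have Ck: "Ck k \<phi>" for k using \<phi> by (simp add: test_functions_def)
  have "(\<lambda>z. \<phi> (w *s z)) \<in> test_functions \<Omega>"
    using \<phi> by (auto simp: test_functions_def intro!: Cc_rotation[OF w \<Omega>] Ck_rotation)
  then have "M (Suc k) L (\<lambda>z. \<phi> (w *s z)) = of_real (4 * c) * (\<Sum>a\<in>UNIV. \<Sum>b\<in>UNIV.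
             M k ((a, b) # L) (\<lambda>z. of_real (v z) * dz a (dzbar b (\<lambda>z. \<phi> (w *s z))) z))"
    using M kL unfolding bedford_taylor_chain_def by simp
  then show "M (Suc k) L (\<lambda>z. \<phi> (w *s z)) = of_real (4 * c) * (\<Sum>a\<in>UNIV. \<Sum>b\<in>UNIV.
             M k ((a, b) # L) (\<lambda>z. of_real (v (w *s z)) * dz a (dzbar b \<phi>) (w *s z)))"
    by (simp add: dz_dzbar_rotation[OF Ck w] v)
qed

lemma vimage_rotation:
  fixes A :: "(complex ^ 'n) set"
  assumes w: "cmod w = 1" shows "(*s) w -` A = (*s) (cnj w) ` A"
proof (intro set_eqI iffI)
  fix z assume "z \<in> (*s) w -` A"
  then have "cnj w *s (w *s z) \<in> (*s) (cnj w) ` A" by (intro imageI) simp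
  then show "z \<in> (*s) (cnj w) ` A" by (simp add: rotation_cancel[OF w])
qed (auto simp: rotation_cancel[OF w])

lemma is_monge_ampere_measure_rotation:
  fixes \<Omega> :: "(complex ^ 'n) set"
  assumes w: "cmod w = 1" and \<Omega>: "\<And>z. w *s z \<in> \<Omega> \<longleftrightarrow> z \<in> \<Omega>" and v: "\<And>z. v (w *s z) = v z"
    and \<mu>: "is_monge_ampere_measure c \<Omega> v \<mu>"
  shows "is_monge_ampere_measure c \<Omega> v (distr \<mu> borel ((*s) w))"
proof -
  have sets[simp, measurable_cong]: "sets \<mu> = sets borel" and null: "emeasure \<mu> (- \<Omega>) = 0"
    and fin: "\<And>K. compact K \<Longrightarrow> K \<subseteq> \<Omega> \<Longrightarrow> emeasure \<mu> K < \<infinity>"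
    using \<mu> by (auto simp: is_monge_ampere_measure_def)
  obtain M where M: "bedford_taylor_chain c \<Omega> v M" "\<And>\<phi>. \<phi> \<in> Cc \<Omega> \<Longrightarrow> M CARD('n) [] \<phi> = (LINT z|\<mu>. \<phi> z)"
    using \<mu> by (auto simp: is_monge_ampere_measure_def)
  have sp: "space \<mu> = UNIV" using sets_eq_imp_space_eq[OF sets] by simp
  show ?thesis unfolding is_monge_ampere_measure_def
  proof (intro conjI allI impI exI)
    show "sets (distr \<mu> borel ((*s) w)) = sets borel" by simp
    show "emeasure (distr \<mu> borel ((*s) w)) (- \<Omega>) = 0"
    proof (cases "- \<Omega> \<in> sets borel")
      case True
      have "(*s) w -` (- \<Omega>) = - \<Omega>" using \<Omega> by auto
      then show ?thesis using True null by (subst emeasure_distr) (simp_all add: sp)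
    qed (simp add: emeasure_notin_sets)
    fix K assume K: "compact K \<and> K \<subseteq> \<Omega>"
    have "emeasure (distr \<mu> borel ((*s) w)) K = emeasure \<mu> ((*s) (cnj w) ` K)"
      using K by (subst emeasure_distr) (simp_all add: borel_compact vimage_rotation[OF w] sp)
    moreover have "(*s) (cnj w) ` K \<subseteq> \<Omega>" using K \<Omega> by (metis image_subset_iff rotation_cancel(1)[OF w] subsetD)
    ultimately show "emeasure (distr \<mu> borel ((*s) w)) K < \<infinity>"
      using K fin compact_rotation by metis
  next
    show "bedford_taylor_chain c \<Omega> v (\<lambda>k L \<phi>. M k L (\<lambda>z. \<phi> (w *s z)))"
      by (rule bedford_taylor_chain_rotation[OF w \<Omega> v M(1)])
    show "\<forall>\<phi>\<in>Cc \<Omega>. M CARD('n) [] (\<lambda>z. \<phi> (w *s z)) = (LINT z|distr \<mu> borel ((*s) w). \<phi> z)"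
    proof
      fix \<phi> assume \<phi>: "\<phi> \<in> Cc \<Omega>"
      have [measurable]: "\<phi> \<in> borel_measurable borel"
        using \<phi> by (auto simp: Cc_def intro: borel_measurable_continuous_onI)
      show "M CARD('n) [] (\<lambda>z. \<phi> (w *s z)) = (LINT z|distr \<mu> borel ((*s) w). \<phi> z)"
        using M(2)[OF Cc_rotation[OF w \<Omega> \<phi>]] by (subst integral_distr) auto
    qed
  qed
qed

section \<open>Uniqueness and locality of Monge--Ampere measures\<close>

lemma Cc_cutoff:
  fixes W :: "(complex ^ 'n) set"
  assumes W: "open W" and K: "compact K" "K \<subseteq> W" "K \<noteq> {}"
  obtains K' where "compact K'" "K' \<subseteq> W"
    "\<forall>\<^sub>F m in sequentially. (\<lambda>z. complex_of_real (max 0 (1 - real m * infdist z K))) \<in> Cc W \<and>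
        (\<forall>z. max 0 (1 - real m * infdist z K) \<le> indicator K' z)"
proof -
  obtain e where e: "e > 0" "(\<Union>x\<in>K. cball x e) \<subseteq> W"
    using compact_subset_open_imp_cball_epsilon_subset[OF K(1) W K(2)] .
  define K' where "K' = {z. infdist z K \<le> e}"
  have near: "\<exists>x\<in>K. dist x z \<le> e" if "z \<in> K'" for z
  proof -
    obtain x where "x \<in> K" "infdist z K = dist z x"
      by (rule infdist_attains_inf[OF compact_imp_closed[OF K(1)] K(3)])
    with that show ?thesis by (intro bexI[of _ x]) (simp_all add: K'_def dist_commute)
  qed
  have cl: "closed K'" unfolding K'_def by (intro closed_Collect_le continuous_intros)
  obtain B where B: "\<And>x. x \<in> K \<Longrightarrow> norm x \<le> B" using compact_imp_bounded[OF K(1)] bounded_iff by blast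
  have "norm z \<le> B + e" if "z \<in> K'" for z
  proof -
    obtain x where x: "x \<in> K" "dist x z \<le> e" using near[OF \<open>z \<in> K'\<close>] by blast
    then show ?thesis using B[OF x(1)] norm_triangle_ineq2[of z x] by (simp add: dist_norm norm_minus_commute)
  qed
  then have cK': "compact K'" using cl by (auto simp: compact_eq_bounded_closed bounded_iff)
  have K'W: "K' \<subseteq> W" using near e(2) by fastforce
  have "\<forall>\<^sub>F m in sequentially. 1 / e < real m"
    using filterlim_real_sequentially by (rule filterlim_at_top_dense[THEN iffD1, rule_format])
  then have "\<forall>\<^sub>F m in sequentially. (\<lambda>z. complex_of_real (max 0 (1 - real m * infdist z K))) \<in> Cc W \<and>
        (\<forall>z. max 0 (1 - real m * infdist z K) \<le> indicator K' z)"
  proof eventually_elim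
    fix m assume m: "1 / e < real m"
    have off: "max 0 (1 - real m * infdist z K) = 0" if "z \<notin> K'" for z
    proof -
      have "1 < real m * e" using m e(1) by (simp add: field_simps)
      also have "\<dots> \<le> real m * infdist z K" using that by (intro mult_left_mono) (auto simp: K'_def)
      finally show ?thesis by simp
    qed
    have sub: "closure {z. complex_of_real (max 0 (1 - real m * infdist z K)) \<noteq> 0} \<subseteq> K'"
      by (rule closure_minimal[OF _ cl]) (use off in auto)
    have "compact (closure {z. complex_of_real (max 0 (1 - real m * infdist z K)) \<noteq> 0})"
      using compact_Int_closed[OF cK' closed_closure, of "{z. complex_of_real (max 0 (1 - real m * infdist z K)) \<noteq> 0}"]
      by (simp only: Int_absorb1[OF sub])
    moreover have "continuous_on UNIV (\<lambda>z. complex_of_real (max 0 (1 - real m * infdist z K)))"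
      by (intro continuous_intros)
    moreover have "max 0 (1 - real m * infdist z K) \<le> indicator K' z" for z
      using off[of z] infdist_nonneg[of z K] by (auto simp: indicator_def)
    ultimately show "(\<lambda>z. complex_of_real (max 0 (1 - real m * infdist z K))) \<in> Cc W \<and>
        (\<forall>z. max 0 (1 - real m * infdist z K) \<le> indicator K' z)"
      using sub K'W by (auto simp: Cc_def)
  qed
  then show ?thesis by (rule that[OF cK' K'W])
qed

lemma cutoff_tendsto_indicator:
  assumes "closed K" "K \<noteq> {}"
  shows "(\<lambda>m. max 0 (1 - real m * infdist z K)) \<longlonglongrightarrow> indicator K z"
proof (cases "z \<in> K")
  case False
  then have pos: "infdist z K > 0"
    using assms in_closed_iff_infdist_zero[of K z] infdist_nonneg[of z K] by auto
  have "\<forall>\<^sub>F m in sequentially. 1 / infdist z K < real m"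
    using filterlim_real_sequentially by (rule filterlim_at_top_dense[THEN iffD1, rule_format])
  then have "\<forall>\<^sub>F m in sequentially. max 0 (1 - real m * infdist z K) = indicator K z"
    by eventually_elim (use pos False in \<open>simp add: field_simps\<close>)
  then show ?thesis by (rule tendsto_eventually)
qed simp

lemma compact_exhaustion:
  fixes W :: "'a::euclidean_space set"
  assumes "open W"
  shows "\<exists>C :: nat \<Rightarrow> 'a set. (\<forall>n. compact (C n)) \<and> (\<forall>n. C n \<subseteq> W) \<and> (\<forall>n. C n \<subseteq> interior (C (Suc n))) \<and> \<Union> (range C) = W"
proof (rule open_Union_compact_subsets[OF assms])
  fix C :: "nat \<Rightarrow> 'a set"
  assume "\<And>n. compact (C n)" "\<And>n. C n \<subseteq> W" "\<And>n. C n \<subseteq> interior (C (Suc n))" "\<Union> (range C) = W"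
  then show ?thesis by (intro exI[of _ C]) simp
qed

text \<open>Cutoff functions decreasing to the indicator of a compact set determine the measure of that set. On each
  member of a compact exhaustion the measures are finite and closed sets generate; continuity from below finishes.\<close>

theorem measure_eq_on_open_of_Cc:
  fixes \<mu> \<nu> :: "(complex ^ 'n) measure"
  assumes W: "open W" and sets[simp]: "sets \<mu> = sets borel" "sets \<nu> = sets borel"
    and fin: "\<And>K. compact K \<Longrightarrow> K \<subseteq> W \<Longrightarrow> emeasure \<mu> K < \<infinity>" "\<And>K. compact K \<Longrightarrow> K \<subseteq> W \<Longrightarrow> emeasure \<nu> K < \<infinity>"
    and eq: "\<And>\<phi> :: complex ^ 'n \<Rightarrow> real. (\<lambda>z. complex_of_real (\<phi> z)) \<in> Cc W \<Longrightarrow> (LINT z|\<mu>. \<phi> z) = (LINT z|\<nu>. \<phi> z)"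
    and A: "A \<in> sets borel" "A \<subseteq> W"
  shows "emeasure \<mu> A = emeasure \<nu> A"
proof -
  have eqK: "emeasure \<mu> K = emeasure \<nu> K" if K: "compact K" "K \<subseteq> W" for K
  proof (cases "K = {}")
    case False
    obtain K' where K': "compact K'" "K' \<subseteq> W" and ev:
      "\<forall>\<^sub>F m in sequentially. (\<lambda>z. complex_of_real (max 0 (1 - real m * infdist z K))) \<in> Cc W \<and>
        (\<forall>z. max 0 (1 - real m * infdist z K) \<le> indicator K' z)"
      using Cc_cutoff[OF W K False] by blast
    then obtain N where N: "\<And>m. m \<ge> N \<Longrightarrow> (\<lambda>z. complex_of_real (max 0 (1 - real m * infdist z K))) \<in> Cc W"
      "\<And>m z. m \<ge> N \<Longrightarrow> max 0 (1 - real m * infdist z K) \<le> indicator K' z"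
      unfolding eventually_sequentially by blast
    define \<phi> where "\<phi> m z = max 0 (1 - real (m + N) * infdist z K)" for m z
    have lim: "(\<lambda>m. LINT z|\<rho>. \<phi> m z) \<longlonglongrightarrow> measure \<rho> K"
      if [simp, measurable_cong]: "sets \<rho> = sets borel" and f: "\<And>K. compact K \<Longrightarrow> K \<subseteq> W \<Longrightarrow> emeasure \<rho> K < \<infinity>" for \<rho> :: "(complex ^ 'n) measure"
    proof -
      have "(\<lambda>m. LINT z|\<rho>. \<phi> m z) \<longlonglongrightarrow> (LINT z|\<rho>. indicator K z)"
      proof (rule integral_dominated_convergence[where w = "indicator K'"])
        show "integrable \<rho> (indicator K' :: _ \<Rightarrow> real)"
          using f[OF K'] K'(1) by (intro integrable_real_indicator) (auto simp: borel_compact)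
        show "AE z in \<rho>. (\<lambda>m. \<phi> m z) \<longlonglongrightarrow> indicator K z"
          unfolding \<phi>_def using K(1) False
          by (intro AE_I2 LIMSEQ_ignore_initial_segment cutoff_tendsto_indicator compact_imp_closed)
        show "AE z in \<rho>. norm (\<phi> m z) \<le> indicator K' z" for m
          using N(2)[of "m + N"] by (intro AE_I2) (simp add: \<phi>_def)
        show "\<phi> m \<in> borel_measurable \<rho>" for m
        proof -
          have "\<phi> m \<in> borel_measurable borel" unfolding \<phi>_def
            by (intro borel_measurable_continuous_onI continuous_intros)
          then show ?thesis by simp
        qed
        show "indicat_real K \<in> borel_measurable \<rho>"
          using borel_compact[OF K(1)] by (intro borel_measurable_indicator) simp
      qed
      then show ?thesis using K(1) by (simp add: sets_eq_imp_space_eq[OF that(1)])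
    qed
    have "(LINT z|\<mu>. \<phi> m z) = (LINT z|\<nu>. \<phi> m z)" for m
      using N(1)[of "m + N"] unfolding \<phi>_def by (intro eq) simp
    then have "measure \<mu> K = measure \<nu> K"
      using LIMSEQ_unique[OF lim[OF sets(1) fin(1)]] lim[OF sets(2) fin(2)] by simp
    then show ?thesis using fin[OF K] by (simp add: emeasure_eq_ennreal_measure less_top)
  qed simp
  obtain C where C: "\<And>n. compact (C n)" "\<And>n. C n \<subseteq> W" "\<And>n. C n \<subseteq> interior (C (Suc n))" "\<Union> (range C) = W"
    using compact_exhaustion[OF W] by blast
  have inc: "incseq (\<lambda>n. A \<inter> C n)"
    using C(3) interior_subset by (intro incseq_SucI) blast
  have eqn: "emeasure \<mu> (A \<inter> C n) = emeasure \<nu> (A \<inter> C n)" for n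
  proof -
    have Cb[measurable]: "C n \<in> sets borel" using C(1) by (rule borel_compact)
    have d: "emeasure (density \<rho> (indicator (C n))) X = emeasure \<rho> (X \<inter> C n)"
      if "sets \<rho> = sets borel" "X \<in> sets borel" for \<rho> X
      using that by (subst emeasure_density) (auto simp: nn_integral_indicator[symmetric] indicator_inter_arith
         intro!: nn_integral_cong simp del: nn_integral_indicator simp: mult.commute indicator_def)
    have "density \<mu> (indicator (C n)) = density \<nu> (indicator (C n))"
    proof (rule measure_eqI_generator_eq[where E = "Collect closed" and \<Omega> = UNIV and A = "\<lambda>_. UNIV"])
      show "Int_stable (Collect (closed :: (complex ^ 'n) set \<Rightarrow> bool))" by (auto simp: Int_stable_def)
      show "sets (density \<mu> (indicator (C n))) = sigma_sets UNIV (Collect closed)"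
        "sets (density \<nu> (indicator (C n))) = sigma_sets UNIV (Collect closed)"
        by (simp_all add: borel_eq_closed)
      fix X :: "(complex ^ 'n) set" assume "X \<in> Collect closed"
      then have X: "closed X" "X \<in> sets borel" by auto
      have "compact (X \<inter> C n)" "X \<inter> C n \<subseteq> W" using X(1) C(1,2)[of n] by (auto simp: closed_Int_compact)
      then show "emeasure (density \<mu> (indicator (C n))) X = emeasure (density \<nu> (indicator (C n))) X"
        using X(2) by (simp add: d eqK)
    next
      show "emeasure (density \<mu> (indicator (C n))) UNIV \<noteq> \<infinity>"
        using fin(1)[OF C(1,2), of n] by (simp add: d)
    qed auto
    then show ?thesis using A(1) d[of \<mu> A] d[of \<nu> A] by simp
  qed
  have un: "(\<Union>n. A \<inter> C n) = A" using C(4) A(2) by blast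
  have ms: "range (\<lambda>n. A \<inter> C n) \<subseteq> sets borel" using A(1) C(1) by (auto intro: borel_compact)
  have sup: "(SUP n. emeasure \<mu> (A \<inter> C n)) = emeasure \<mu> (\<Union>n. A \<inter> C n)"
    "(SUP n. emeasure \<nu> (A \<inter> C n)) = emeasure \<nu> (\<Union>n. A \<inter> C n)"
    by (rule SUP_emeasure_incseq[OF _ inc], simp only: sets ms)+
  show ?thesis by (rule trans[OF sym[OF sup(1)[unfolded un eqn]] sup(2)[unfolded un]])
qed

lemma emeasure_null_of_compact_null:
  fixes \<mu> :: "(complex ^ 'n) measure"
  assumes W: "open W" and sets: "sets \<mu> = sets borel"
    and null: "\<And>K. compact K \<Longrightarrow> K \<subseteq> W \<Longrightarrow> emeasure \<mu> K = 0"
  shows "emeasure \<mu> W = 0"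
proof -
  obtain C where C: "\<And>n. compact (C n)" "\<And>n. C n \<subseteq> W" "\<And>n. C n \<subseteq> interior (C (Suc n))" "\<Union> (range C) = W"
    using compact_exhaustion[OF W] by blast
  have "(\<Union>n. C n) \<in> null_sets \<mu>"
    by (intro null_sets_UN null_setsI) (simp_all add: sets borel_compact C(1) null[OF C(1,2)])
  then show ?thesis unfolding C(4) by (rule null_setsD1)
qed

text \<open>A chain restricts to a chain on a smaller open set, where uniqueness applies.\<close>

lemma monge_ampere_measure_local:
  fixes \<Omega> \<Omega>' :: "(complex ^ 'n) set"
  assumes \<mu>: "is_monge_ampere_measure c \<Omega> v \<mu>" and \<nu>: "is_monge_ampere_measure c \<Omega>' v' \<nu>"
    and W: "open W" "W \<subseteq> \<Omega>" "W \<subseteq> \<Omega>'" and v: "continuous_on W v" "\<And>z. z \<in> W \<Longrightarrow> v' z = v z"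
    and A: "A \<in> sets borel" "A \<subseteq> W"
  shows "emeasure \<mu> A = emeasure \<nu> A"
proof -
  obtain M where M: "bedford_taylor_chain c \<Omega> v M" "\<And>\<phi>. \<phi> \<in> Cc \<Omega> \<Longrightarrow> M CARD('n) [] \<phi> = (LINT z|\<mu>. \<phi> z)"
    using \<mu> by (auto simp: is_monge_ampere_measure_def)
  obtain N where N: "bedford_taylor_chain c \<Omega>' v' N" "\<And>\<phi>. \<phi> \<in> Cc \<Omega>' \<Longrightarrow> N CARD('n) [] \<phi> = (LINT z|\<nu>. \<phi> z)"
    using \<nu> by (auto simp: is_monge_ampere_measure_def)
  have M': "bedford_taylor_chain c W v M" by (rule bedford_taylor_chain_local[OF M(1) W(2)]) simp
  have N': "bedford_taylor_chain c W v N" by (rule bedford_taylor_chain_local[OF N(1) W(3)]) (simp add: v)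
  show ?thesis
  proof (rule measure_eq_on_open_of_Cc[OF W(1) _ _ _ _ _ A])
    fix \<phi> :: "complex ^ 'n \<Rightarrow> real" assume \<phi>: "(\<lambda>z. complex_of_real (\<phi> z)) \<in> Cc W"
    then have "(LINT z|\<mu>. complex_of_real (\<phi> z)) = (LINT z|\<nu>. complex_of_real (\<phi> z))"
      using bedford_taylor_chain_unique[OF W(1) v(1) M' N' _ \<phi>, of "CARD('n)" "[]"]
        M(2) N(2) Cc_mono[OF W(2)] Cc_mono[OF W(3)] by (metis add.right_neutral list.size(3) subsetD)
    then show "(LINT z|\<mu>. \<phi> z) = (LINT z|\<nu>. \<phi> z)" by simp
  qed (use \<mu> \<nu> W(2,3) in \<open>auto simp: is_monge_ampere_measure_def\<close>)
qed

lemma monge_ampere_measure_const: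
  fixes \<Omega> :: "(complex ^ 'n) set"
  assumes \<mu>: "is_monge_ampere_measure c \<Omega> v \<mu>"
    and W: "open W" "W \<subseteq> \<Omega>" and v: "\<And>z. z \<in> W \<Longrightarrow> v z = r"
  shows "emeasure \<mu> W = 0"
proof -
  obtain M where M: "bedford_taylor_chain c \<Omega> v M" "\<And>\<phi>. \<phi> \<in> Cc \<Omega> \<Longrightarrow> M CARD('n) [] \<phi> = (LINT z|\<mu>. \<phi> z)"
    using \<mu> by (auto simp: is_monge_ampere_measure_def)
  have M': "bedford_taylor_chain c W v M" by (rule bedford_taylor_chain_local[OF M(1) W(2)]) simp
  obtain k where k: "CARD('n) = Suc k" using gr0_implies_Suc[OF zero_less_card_finite] by blast
  have "emeasure \<mu> W = emeasure (null_measure borel) W"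
  proof (rule measure_eq_on_open_of_Cc[OF W(1)])
    fix \<phi> :: "complex ^ 'n \<Rightarrow> real" assume \<phi>: "(\<lambda>z. complex_of_real (\<phi> z)) \<in> Cc W"
    have "(LINT z|\<mu>. complex_of_real (\<phi> z)) = 0"
      using bedford_taylor_chain_const[OF W(1) v M' _ \<phi>, of k "[]"] M(2) Cc_mono[OF W(2)] \<phi> k by auto
    then show "(LINT z|\<mu>. \<phi> z) = (LINT z|null_measure borel. \<phi> z)" by simp
  qed (use \<mu> W in \<open>auto simp: is_monge_ampere_measure_def\<close>)
  then show ?thesis by simp
qed

section \<open>Demailly measures of the ellipsoid\<close>

lemma continuous_on_ellipsoid_sum [continuous_intros]:
  "continuous_on S f \<Longrightarrow> continuous_on S (\<lambda>x. ellipsoid_sum p (f x))"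
  unfolding ellipsoid_sum_def by (intro continuous_intros)

lemma ellipsoid_sum_nonneg: "0 \<le> ellipsoid_sum p z"
  unfolding ellipsoid_sum_def by (intro sum_nonneg) simp

lemma ellipsoid_sum_rotation: "cmod w = 1 \<Longrightarrow> ellipsoid_sum p (w *s z) = ellipsoid_sum p z"
  by (simp add: ellipsoid_sum_def norm_mult)

lemma open_ellipsoid: "open (ellipsoid p)"
  unfolding ellipsoid_def by (intro open_Collect_less continuous_intros)

lemma compact_ellipsoid_sum_le:
  assumes p: "\<And>j. 0 < p j" and s: "s \<le> 1"
  shows "compact {z. ellipsoid_sum p z \<le> s}"
proof -
  have "norm z \<le> CARD('a)" if "ellipsoid_sum p z \<le> s" for z :: "complex ^ 'a"
  proof -
    have "norm (z $ j) \<le> 1" for j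
    proof (rule ccontr)
      assume "\<not> norm (z $ j) \<le> 1"
      then have "1 < norm (z $ j) ^ (2 * p j)" using p[of j] by (intro one_less_power) auto
      also have "\<dots> \<le> ellipsoid_sum p z" unfolding ellipsoid_sum_def by (rule member_le_sum) auto
      finally show False using that s by simp
    qed
    then have "(\<Sum>j\<in>UNIV. norm (z $ j)) \<le> (\<Sum>j\<in>(UNIV :: 'a set). 1)" by (intro sum_mono)
    with L2_set_le_sum[of UNIV "\<lambda>j. norm (z $ j)"] show ?thesis by (simp add: norm_vec_def)
  qed
  then have "bounded {z. ellipsoid_sum p z \<le> s}" by (auto simp: bounded_iff)
  moreover have "closed {z. ellipsoid_sum p z \<le> s}" by (intro closed_Collect_le continuous_intros)
  ultimately show ?thesis by (simp add: compact_eq_bounded_closed)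
qed

lemma log_exhaustion_less_iff: "log_exhaustion p z < ereal r \<longleftrightarrow> ellipsoid_sum p z < exp r"
  using ellipsoid_sum_nonneg[of p z] ln_less_cancel_iff[of "ellipsoid_sum p z" "exp r"] by (auto simp: log_exhaustion_def)

lemma log_exhaustion_eq_iff: "log_exhaustion p z = ereal r \<longleftrightarrow> ellipsoid_sum p z = exp r"
  using ellipsoid_sum_nonneg[of p z] by (auto simp: log_exhaustion_def)

lemma sublevel_log_exhaustion:
  "r < 0 \<Longrightarrow> sublevel (ellipsoid p) (log_exhaustion p) r = {z. ellipsoid_sum p z < exp r}"
  by (auto simp: sublevel_def log_exhaustion_less_iff ellipsoid_def intro: less_trans)

lemma level_log_exhaustion:
  "r < 0 \<Longrightarrow> level (ellipsoid p) (log_exhaustion p) r = {z. ellipsoid_sum p z = exp r}"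
  by (auto simp: level_def log_exhaustion_eq_iff ellipsoid_def)

lemma trunc_log_exhaustion: "trunc (log_exhaustion p) r z = ln (max (ellipsoid_sum p z) (exp r))"
proof (cases "ellipsoid_sum p z < exp r")
  case True
  then have "max (log_exhaustion p z) (ereal r) = ereal r"
    using log_exhaustion_less_iff[of p z r] by (simp add: max_absorb2 less_imp_le)
  with True show ?thesis by (simp add: trunc_def max_def)
next
  case False
  then have "0 < ellipsoid_sum p z" by (smt (verit) exp_gt_zero)
  moreover have "r \<le> ln (ellipsoid_sum p z)" using False \<open>0 < ellipsoid_sum p z\<close> by (simp add: ln_ge_iff)
  ultimately show ?thesis using False by (simp add: trunc_def log_exhaustion_def max_def)
qed

lemma log_exhaustion_finite:
  "{z \<in> ellipsoid p. log_exhaustion p z > -\<infinity>} = {z \<in> ellipsoid p. 0 < ellipsoid_sum p z}"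
  using ellipsoid_sum_nonneg[of p] by (auto simp: log_exhaustion_def less_le)

lemma compact_level_log_exhaustion:
  assumes "\<And>j. 0 < p j" "r < 0"
  shows "compact (level (ellipsoid p) (log_exhaustion p) r)"
proof -
  have "{z. ellipsoid_sum p z = exp r} = {z. ellipsoid_sum p z \<le> exp r} \<inter> {z. exp r \<le> ellipsoid_sum p z}" by auto
  moreover have "compact {z. ellipsoid_sum p z \<le> exp r}" using assms by (intro compact_ellipsoid_sum_le) auto
  moreover have "closed {z. exp r \<le> ellipsoid_sum p z}" by (intro closed_Collect_le continuous_intros)
  ultimately show ?thesis using assms(2) by (simp add: level_log_exhaustion compact_Int_closed)
qed

lemma demailly_measure_obtain:
  assumes "is_demailly_measure c (ellipsoid p) (log_exhaustion p) r \<mu>"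
  obtains \<alpha> \<nu> where
    "is_monge_ampere_measure c (ellipsoid p) (trunc (log_exhaustion p) r) \<alpha>"
    "is_monge_ampere_measure c {z \<in> ellipsoid p. 0 < ellipsoid_sum p z} (\<lambda>z. real_of_ereal (log_exhaustion p z)) \<nu>"
    "\<And>A. A \<in> sets borel \<Longrightarrow> A \<subseteq> ellipsoid p \<Longrightarrow>
       emeasure \<mu> A + emeasure \<nu> (A - sublevel (ellipsoid p) (log_exhaustion p) r) = emeasure \<alpha> A"
  using assms unfolding is_demailly_measure_def log_exhaustion_finite by blast

text \<open>Below the level the truncation is constant, so \<open>(dd\<^sup>c u\<^sub>r)\<^sup>n\<close> vanishes; above it \<open>u\<^sub>r = u\<close>, and the two
  Monge--Ampere measures cancel by locality.\<close>

lemma demailly_measure_null_off_level: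
  fixes p :: "'n::finite \<Rightarrow> nat"
  assumes \<mu>: "is_demailly_measure c (ellipsoid p) (log_exhaustion p) r \<mu>" and r: "r < 0"
  shows "emeasure \<mu> (- level (ellipsoid p) (log_exhaustion p) r) = 0"
proof -
  let ?B = "ellipsoid p"
  have sets[simp]: "sets \<mu> = sets borel" and off: "emeasure \<mu> (- ?B) = 0"
    using \<mu> by (auto simp: is_demailly_measure_def)
  obtain \<alpha> \<nu> where \<alpha>: "is_monge_ampere_measure c ?B (trunc (log_exhaustion p) r) \<alpha>"
    and \<nu>: "is_monge_ampere_measure c {z \<in> ?B. 0 < ellipsoid_sum p z} (\<lambda>z. real_of_ereal (log_exhaustion p z)) \<nu>"
    and sum: "\<And>A. A \<in> sets borel \<Longrightarrow> A \<subseteq> ?B \<Longrightarrow>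
       emeasure \<mu> A + emeasure \<nu> (A - sublevel ?B (log_exhaustion p) r) = emeasure \<alpha> A"
    using demailly_measure_obtain[OF \<mu>] by blast
  define V where "V = {z. ellipsoid_sum p z < exp r}"
  define W where "W = {z \<in> ?B. exp r < ellipsoid_sum p z}"
  have V: "open V" "V \<subseteq> ?B" "V = sublevel ?B (log_exhaustion p) r"
    using r sublevel_log_exhaustion[OF r, of p] unfolding V_def
    by (auto intro!: open_Collect_less continuous_intros simp: sublevel_def)
  have "open {z. exp r < ellipsoid_sum p z}" by (intro open_Collect_less continuous_intros)
  then have W: "open W" unfolding W_def using open_Int[OF open_ellipsoid] by (simp add: Collect_conj_eq)
  have "emeasure \<alpha> V = 0"
    by (rule monge_ampere_measure_const[OF \<alpha> V(1,2), of r]) (auto simp: trunc_log_exhaustion V_def max_def)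
  then have \<mu>V: "emeasure \<mu> V = 0" using sum[of V] V by simp
  have WB: "W \<subseteq> ?B" "W \<subseteq> {z \<in> ?B. 0 < ellipsoid_sum p z}"
    unfolding W_def by (auto intro: less_trans[OF exp_gt_zero])
  have "emeasure \<mu> W = 0"
  proof (rule emeasure_null_of_compact_null[OF W sets])
    fix K assume K: "compact K" "K \<subseteq> W"
    have Kb: "K \<in> sets borel" using K(1) by (rule borel_compact)
    have "emeasure \<alpha> K = emeasure \<nu> K"
    proof (rule monge_ampere_measure_local[OF \<alpha> \<nu> W WB _ _ Kb K(2)])
      show "continuous_on W (trunc (log_exhaustion p) r)"
        unfolding trunc_log_exhaustion[abs_def] by (intro continuous_intros) (auto simp: max_def)
      fix z assume z: "z \<in> W"
      then have "0 < ellipsoid_sum p z" using WB by auto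
      with z show "real_of_ereal (log_exhaustion p z) = trunc (log_exhaustion p) r z"
        by (auto simp: trunc_log_exhaustion log_exhaustion_def W_def max_def)
    qed
    moreover have "K - sublevel ?B (log_exhaustion p) r = K"
      using K(2) by (auto simp: W_def sublevel_log_exhaustion[OF r])
    ultimately have "emeasure \<mu> K + emeasure \<nu> K = emeasure \<nu> K"
      using sum[of K] Kb K(2) WB by auto
    moreover have "emeasure \<nu> K < \<infinity>" using \<nu> K WB by (auto simp: is_monge_ampere_measure_def)
    ultimately show "emeasure \<mu> K = 0"
      by (metis add.left_neutral ennreal_add_left_cancel add.commute infinity_ennreal_def less_irrefl)
  qed
  then have "W \<in> null_sets \<mu>" "V \<in> null_sets \<mu>" "- ?B \<in> null_sets \<mu>"
    using W V(1) \<mu>V off open_ellipsoid[of p] by (auto simp: null_sets_def)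
  then have "W \<union> V \<union> (- ?B) \<in> null_sets \<mu>" by (intro null_sets.Un)
  moreover have "- level ?B (log_exhaustion p) r = W \<union> V \<union> (- ?B)"
    unfolding level_log_exhaustion[OF r] unfolding W_def V_def ellipsoid_def using r exp_less_one_iff[of r] by auto
  ultimately show ?thesis by auto
qed

lemma finite_demailly_measure:
  fixes p :: "'n::finite \<Rightarrow> nat"
  assumes p: "\<And>j. 0 < p j" and \<mu>: "is_demailly_measure c (ellipsoid p) (log_exhaustion p) r \<mu>" and r: "r < 0"
  shows "finite_measure \<mu>"
proof
  let ?L = "level (ellipsoid p) (log_exhaustion p) r"
  have sets[simp]: "sets \<mu> = sets borel" using \<mu> by (auto simp: is_demailly_measure_def)
  obtain \<alpha> \<nu> where \<alpha>: "is_monge_ampere_measure c (ellipsoid p) (trunc (log_exhaustion p) r) \<alpha>"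
    and sum: "\<And>A. A \<in> sets borel \<Longrightarrow> A \<subseteq> ellipsoid p \<Longrightarrow>
       emeasure \<mu> A + emeasure \<nu> (A - sublevel (ellipsoid p) (log_exhaustion p) r) = emeasure \<alpha> A"
    using demailly_measure_obtain[OF \<mu>] by metis
  have L: "compact ?L" "?L \<subseteq> ellipsoid p" using compact_level_log_exhaustion[OF p r] by (auto simp: level_def)
  have Lb: "?L \<in> sets borel" using L(1) by (rule borel_compact)
  have "emeasure \<mu> ?L \<le> emeasure \<alpha> ?L" using sum[OF Lb L(2)] by (metis add_increasing2 order_refl zero_le)
  also have "\<dots> < \<infinity>" using \<alpha> L by (auto simp: is_monge_ampere_measure_def)
  finally have "emeasure \<mu> ?L < \<infinity>" .
  moreover have "emeasure \<mu> (?L \<union> - ?L) \<le> emeasure \<mu> ?L + emeasure \<mu> (- ?L)"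
    by (rule emeasure_subadditive) (use Lb in auto)
  ultimately have "emeasure \<mu> UNIV < \<infinity>" using demailly_measure_null_off_level[OF \<mu> r] by auto
  then show "emeasure \<mu> (space \<mu>) \<noteq> \<infinity>" using sets_eq_imp_space_eq[OF sets] by simp
qed

text \<open>All the mass sits on the compact level set, where the subtracted measure is finite and
  the defining identity can be solved for the Demailly measure.\<close>

theorem demailly_measure_unique:
  fixes p :: "'n::finite \<Rightarrow> nat"
  assumes p: "\<And>j. 0 < p j" and r: "r < 0"
    and \<mu>: "is_demailly_measure c (ellipsoid p) (log_exhaustion p) r \<mu>"
    and \<mu>': "is_demailly_measure c (ellipsoid p) (log_exhaustion p) r \<mu>'"
  shows "\<mu> = \<mu>'"
proof (rule measure_eqI)
  let ?B = "ellipsoid p" and ?L = "level (ellipsoid p) (log_exhaustion p) r" and ?V = "sublevel (ellipsoid p) (log_exhaustion p) r"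
  have s[simp]: "sets \<mu> = sets borel" "sets \<mu>' = sets borel" using \<mu> \<mu>' by (auto simp: is_demailly_measure_def)
  show "sets \<mu> = sets \<mu>'" by simp
  fix A assume "A \<in> sets \<mu>"
  then have A: "A \<in> sets borel" by simp
  obtain \<alpha> \<nu> where \<alpha>: "is_monge_ampere_measure c ?B (trunc (log_exhaustion p) r) \<alpha>"
    and \<nu>: "is_monge_ampere_measure c {z \<in> ?B. 0 < ellipsoid_sum p z} (\<lambda>z. real_of_ereal (log_exhaustion p z)) \<nu>"
    and sum: "\<And>A. A \<in> sets borel \<Longrightarrow> A \<subseteq> ?B \<Longrightarrow> emeasure \<mu> A + emeasure \<nu> (A - ?V) = emeasure \<alpha> A"
    using demailly_measure_obtain[OF \<mu>] by blast
  obtain \<alpha>' \<nu>' where \<alpha>': "is_monge_ampere_measure c ?B (trunc (log_exhaustion p) r) \<alpha>'"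
    and \<nu>': "is_monge_ampere_measure c {z \<in> ?B. 0 < ellipsoid_sum p z} (\<lambda>z. real_of_ereal (log_exhaustion p z)) \<nu>'"
    and sum': "\<And>A. A \<in> sets borel \<Longrightarrow> A \<subseteq> ?B \<Longrightarrow> emeasure \<mu>' A + emeasure \<nu>' (A - ?V) = emeasure \<alpha>' A"
    using demailly_measure_obtain[OF \<mu>'] by blast
  have L: "compact ?L" "?L \<subseteq> ?B" using compact_level_log_exhaustion[OF p r] by (auto simp: level_def)
  have Lb: "?L \<in> sets borel" using L(1) by (rule borel_compact)
  have AL: "A \<inter> ?L \<in> sets borel" "A \<inter> ?L \<subseteq> ?B" "A \<inter> ?L - ?V = A \<inter> ?L"
    using A Lb L(2) by (auto simp: level_def sublevel_def)
  have Lpos: "?L \<subseteq> {z \<in> ?B. 0 < ellipsoid_sum p z}"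
    using L(2) by (auto simp: level_log_exhaustion[OF r])
  have op: "open {z \<in> ?B. 0 < ellipsoid_sum p z}"
  proof -
    have "open {z. 0 < ellipsoid_sum p z}" by (intro open_Collect_less continuous_intros)
    then show ?thesis using open_Int[OF open_ellipsoid] by (simp add: Collect_conj_eq)
  qed
  have "continuous_on ?B (trunc (log_exhaustion p) r)"
    unfolding trunc_log_exhaustion[abs_def] by (intro continuous_intros) (auto simp: max_def)
  then have e1: "emeasure \<alpha> (A \<inter> ?L) = emeasure \<alpha>' (A \<inter> ?L)"
    by (rule monge_ampere_measure_local[OF \<alpha> \<alpha>' open_ellipsoid subset_refl subset_refl _ _ AL(1,2)]) simp
  have "continuous_on {z \<in> ?B. 0 < ellipsoid_sum p z} (\<lambda>z. ln (ellipsoid_sum p z))"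
    by (intro continuous_intros) auto
  then have "continuous_on {z \<in> ?B. 0 < ellipsoid_sum p z} (\<lambda>z. real_of_ereal (log_exhaustion p z))"
    by (rule continuous_on_eq) (auto simp: log_exhaustion_def)
  then have e2: "emeasure \<nu> (A \<inter> ?L) = emeasure \<nu>' (A \<inter> ?L)"
    by (rule monge_ampere_measure_local[OF \<nu> \<nu>' op subset_refl subset_refl _ _ AL(1)]) (use Lpos in auto)
  have "emeasure \<nu> (A \<inter> ?L) \<le> emeasure \<nu> ?L"
    using \<nu> Lb by (intro emeasure_mono) (auto simp: is_monge_ampere_measure_def)
  also have "\<dots> < \<infinity>" using \<nu> L(1) Lpos by (auto simp: is_monge_ampere_measure_def)
  finally have fin: "emeasure \<nu> (A \<inter> ?L) \<noteq> \<infinity>" by simp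
  have "emeasure \<mu> (A \<inter> ?L) + emeasure \<nu> (A \<inter> ?L) = emeasure \<mu>' (A \<inter> ?L) + emeasure \<nu> (A \<inter> ?L)"
    using sum[OF AL(1,2)] sum'[OF AL(1,2)] e1 e2 AL(3) by simp
  then have eqL: "emeasure \<mu> (A \<inter> ?L) = emeasure \<mu>' (A \<inter> ?L)"
    using fin by (simp add: ennreal_add_left_cancel add.commute)
  have "emeasure \<rho> A = emeasure \<rho> (A \<inter> ?L)" if "sets \<rho> = sets borel" "emeasure \<rho> (- ?L) = 0" for \<rho>
  proof -
    have "- ?L \<in> null_sets \<rho>" using that Lb by (auto simp: null_sets_def)
    then have "emeasure \<rho> (A - (- ?L)) = emeasure \<rho> A" by (rule emeasure_Diff_null_set) (use A that in simp)
    then show ?thesis by (simp add: Diff_eq)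
  qed
  then show "emeasure \<mu> A = emeasure \<mu>' A"
    using eqL demailly_measure_null_off_level[OF \<mu> r] demailly_measure_null_off_level[OF \<mu>' r] by simp
qed

text \<open>The rotated measure satisfies the defining identity with the rotated Monge--Ampere measures.\<close>

theorem demailly_measure_rotation:
  fixes p :: "'n::finite \<Rightarrow> nat"
  assumes p: "\<And>j. 0 < p j" and r: "r < 0" and w: "cmod w = 1"
    and \<mu>: "is_demailly_measure c (ellipsoid p) (log_exhaustion p) r \<mu>"
  shows "distr \<mu> borel ((*s) w) = \<mu>"
proof (rule demailly_measure_unique[OF p r _ \<mu>])
  let ?B = "ellipsoid p" and ?V = "sublevel (ellipsoid p) (log_exhaustion p) r"
  have s[simp, measurable_cong]: "sets \<mu> = sets borel" and off: "emeasure \<mu> (- ?B) = 0" using \<mu> by (auto simp: is_demailly_measure_def)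
  have B: "w *s z \<in> ?B \<longleftrightarrow> z \<in> ?B" for z by (simp add: ellipsoid_def ellipsoid_sum_rotation[OF w])
  have u: "log_exhaustion p (w *s z) = log_exhaustion p z" for z by (simp add: log_exhaustion_def ellipsoid_sum_rotation[OF w])
  obtain \<alpha> \<nu> where \<alpha>: "is_monge_ampere_measure c ?B (trunc (log_exhaustion p) r) \<alpha>"
    and \<nu>: "is_monge_ampere_measure c {z \<in> ?B. log_exhaustion p z > -\<infinity>} (\<lambda>z. real_of_ereal (log_exhaustion p z)) \<nu>"
    and sum: "\<And>A. A \<in> sets borel \<Longrightarrow> A \<subseteq> ?B \<Longrightarrow> emeasure \<mu> A + emeasure \<nu> (A - ?V) = emeasure \<alpha> A"
    using \<mu> unfolding is_demailly_measure_def by blast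
  have sa: "sets \<alpha> = sets borel" "sets \<nu> = sets borel" using \<alpha> \<nu> by (auto simp: is_monge_ampere_measure_def)
  have Vb: "?V \<in> sets borel"
    unfolding sublevel_log_exhaustion[OF r] by (intro borel_open open_Collect_less continuous_intros)
  have di: "emeasure (distr \<rho> borel ((*s) w)) A = emeasure \<rho> ((*s) w -` A)"
    if "sets \<rho> = sets borel" "A \<in> sets borel" for \<rho> :: "(complex ^ 'n) measure" and A :: "(complex ^ 'n) set"
  proof -
    have "(*s) w \<in> \<rho> \<rightarrow>\<^sub>M borel"
      using measurable_rotation unfolding measurable_cong_sets[OF that(1) refl] .
    from emeasure_distr[OF this that(2)] show ?thesis
      using sets_eq_imp_space_eq[OF that(1)] by simp
  qed
  show "is_demailly_measure c ?B (log_exhaustion p) r (distr \<mu> borel ((*s) w))"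
    unfolding is_demailly_measure_def
  proof (intro conjI exI ballI impI)
    have "(*s) w -` (- ?B) = - ?B" using B by auto
    then show "emeasure (distr \<mu> borel ((*s) w)) (- ?B) = 0"
      using off open_ellipsoid[of p] by (simp add: di)
    show "is_monge_ampere_measure c ?B (trunc (log_exhaustion p) r) (distr \<alpha> borel ((*s) w))"
      by (rule is_monge_ampere_measure_rotation[OF w _ _ \<alpha>]) (simp_all add: B trunc_def u)
    show "is_monge_ampere_measure c {z \<in> ?B. log_exhaustion p z > -\<infinity>} (\<lambda>z. real_of_ereal (log_exhaustion p z)) (distr \<nu> borel ((*s) w))"
      by (rule is_monge_ampere_measure_rotation[OF w _ _ \<nu>]) (simp_all add: B u)
    fix A assume A: "A \<in> sets (borel :: (complex ^ 'n) measure)" "A \<subseteq> ?B"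
    have "(*s) w -` A \<in> sets borel"
      using measurable_sets[OF measurable_rotation A(1)] by simp
    moreover have "(*s) w -` A \<subseteq> ?B" using A(2) B by auto
    moreover have "(*s) w -` (A - ?V) = (*s) w -` A - ?V" using B u by (auto simp: sublevel_def)
    ultimately show "emeasure (distr \<mu> borel ((*s) w)) A + emeasure (distr \<nu> borel ((*s) w)) (A - ?V) = emeasure (distr \<alpha> borel ((*s) w)) A"
      using A(1) Vb sum[of "(*s) w -` A"] sa by (simp add: di)
  qed simp
qed

section \<open>Dilations and slices\<close>

lemma ellipsoid_sum_smult_le:
  assumes p: "\<And>j. 0 < p j" and l: "cmod l \<le> 1"
  shows "ellipsoid_sum p (l *s z) \<le> (cmod l)\<^sup>2 * ellipsoid_sum p z"
proof -
  have "cmod ((l *s z) $ j) ^ (2 * p j) \<le> (cmod l)\<^sup>2 * cmod (z $ j) ^ (2 * p j)" for j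
  proof -
    have "cmod l ^ (2 * p j) \<le> (cmod l)\<^sup>2" using p[of j] l by (intro power_decreasing) auto
    then show ?thesis by (simp add: norm_mult power_mult_distrib mult_right_mono)
  qed
  then show ?thesis unfolding ellipsoid_sum_def sum_distrib_left by (rule sum_mono)
qed

lemma smult_in_ellipsoid:
  assumes p: "\<And>j. 0 < p j" and "cmod l < 1 \<and> ellipsoid_sum p z \<le> 1 \<or> cmod l \<le> 1 \<and> ellipsoid_sum p z < 1"
  shows "l *s z \<in> ellipsoid p"
proof -
  have l: "cmod l \<le> 1" using assms(2) by auto
  have "(cmod l)\<^sup>2 * ellipsoid_sum p z < 1"
  proof (cases "cmod l < 1")
    case True
    then have "(cmod l)\<^sup>2 < 1" by (simp add: abs_square_less_1)
    moreover have "ellipsoid_sum p z \<le> 1" using assms(2) by auto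
    ultimately show ?thesis
      using mult_less_one[of "ellipsoid_sum p z" "(cmod l)\<^sup>2"] ellipsoid_sum_nonneg[of p z] by (simp add: mult.commute)
  next
    case False
    then show ?thesis
      using assms(2) l ellipsoid_sum_nonneg[of p z] by (intro mult_less_one) (auto simp: power_le_one)
  qed
  with ellipsoid_sum_smult_le[of p l z, OF p l] show ?thesis by (simp add: ellipsoid_def)
qed

lemma closed_ellipsoid_sum_le: "closed {z. ellipsoid_sum p z \<le> s}"
  by (intro closed_Collect_le continuous_intros)

lemma closure_ellipsoid_subset: "closure (ellipsoid p) \<subseteq> {z. ellipsoid_sum p z \<le> 1}"
  by (rule closure_minimal[OF _ closed_ellipsoid_sum_le]) (auto simp: ellipsoid_def)

lemma borel_level: "r < 0 \<Longrightarrow> level (ellipsoid p) (log_exhaustion p) r \<in> sets borel"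
  unfolding level_log_exhaustion by (intro borel_closed closed_Collect_eq continuous_intros)

lemma scaleR_eq_smult: "r *\<^sub>R z = complex_of_real r *s (z :: complex ^ 'n)"
  by (simp add: vec_eq_iff scaleR_conv_of_real[where 'a = complex])

lemma holomorphic_cn_continuous_on:
  assumes "holomorphic_cn f \<Omega>" shows "continuous_on \<Omega> f"
  using assms unfolding holomorphic_cn_def
  by (intro continuous_at_imp_continuous_on ballI) (meson has_derivative_continuous)

text \<open>Complex linearity of the derivative makes the slice complex differentiable.\<close>

lemma holomorphic_slice:
  fixes f :: "complex ^ 'n \<Rightarrow> complex"
  assumes f: "holomorphic_cn f \<Omega>" and U: "open U" and sub: "\<And>l. l \<in> U \<Longrightarrow> l *s \<xi> \<in> \<Omega>"
  shows "(\<lambda>l. f (l *s \<xi>)) holomorphic_on U"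
proof -
  have "\<exists>d. ((\<lambda>l. f (l *s \<xi>)) has_field_derivative d) (at l)" if l: "l \<in> U" for l
  proof -
    obtain L where L: "(f has_derivative L) (at (l *s \<xi>))" "\<And>a v. L (a *s v) = a * L v"
      using f sub[OF l] unfolding holomorphic_cn_def by blast
    have "linear (\<lambda>l. l *s \<xi>)" by (rule linearI) (auto simp: vec_eq_iff algebra_simps scaleR_conv_of_real[where 'a = complex])
    then have "((\<lambda>l. l *s \<xi>) has_derivative (\<lambda>l. l *s \<xi>)) (at l)" by (rule linear_imp_has_derivative)
    from has_derivative_compose[OF this L(1)] have "((\<lambda>l. f (l *s \<xi>)) has_derivative (\<lambda>h. h * L \<xi>)) (at l)"
      unfolding L(2) .
    then have "((\<lambda>l. f (l *s \<xi>)) has_field_derivative L \<xi>) (at l)"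
    proof -
      have "(\<lambda>h. h * L \<xi>) = (*) (L \<xi>)" by (simp add: fun_eq_iff mult.commute)
      with \<open>((\<lambda>l. f (l *s \<xi>)) has_derivative (\<lambda>h. h * L \<xi>)) (at l)\<close> show ?thesis
        by (simp only: has_field_derivative_def)
    qed
    then show ?thesis ..
  qed
  then show ?thesis by (simp add: holomorphic_on_open[OF U])
qed

lemma measurable_circle_action [measurable]:
  "(\<lambda>(z, t). cis t *s z) \<in> borel \<Otimes>\<^sub>M borel \<rightarrow>\<^sub>M (borel :: (complex ^ 'n) measure)"
proof -
  have "continuous_on UNIV (\<lambda>x :: (complex ^ 'n) \<times> real. cis (snd x) *s fst x)"
    by (intro continuous_intros)
  then show ?thesis unfolding borel_prod split_beta by (rule borel_measurable_continuous_onI)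
qed

text \<open>Tonelli's theorem: integrating an invariant measure is the same as first averaging over orbits.\<close>

lemma nn_integral_circle_average:
  fixes m :: "(complex ^ 'n) measure" and g :: "complex ^ 'n \<Rightarrow> ennreal"
  assumes fin: "finite_measure m" and s[measurable_cong]: "sets m = sets borel"
    and inv: "\<And>t. distr m borel ((*s) (cis t)) = m" and g[measurable]: "g \<in> borel_measurable borel"
  shows "(\<integral>\<^sup>+z. (\<integral>\<^sup>+t. g (cis t *s z) * indicator {0..2*pi} t \<partial>lborel) \<partial>m) = ennreal (2 * pi) * (\<integral>\<^sup>+z. g z \<partial>m)"
proof -
  interpret finite_measure m by fact
  interpret pair_sigma_finite m lborel ..
  have "(\<lambda>x. g ((\<lambda>(z, t). cis t *s z) x)) \<in> borel_measurable (borel \<Otimes>\<^sub>M borel)" by measurable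
  then have meas[measurable]: "(\<lambda>(z, t). g (cis t *s z)) \<in> borel_measurable (m \<Otimes>\<^sub>M lborel)"
    by (simp add: split_beta' measurable_cong_sets[OF sets_pair_measure_cong[OF s sets_lborel] refl])
  have ms: "(*s) w \<in> m \<rightarrow>\<^sub>M borel" for w
    using measurable_rotation unfolding measurable_cong_sets[OF s refl] .
  have "(\<integral>\<^sup>+z. (\<integral>\<^sup>+t. g (cis t *s z) * indicator {0..2*pi} t \<partial>lborel) \<partial>m)
     = (\<integral>\<^sup>+t. (\<integral>\<^sup>+z. g (cis t *s z) * indicator {0..2*pi} t \<partial>m) \<partial>lborel)"
    by (rule Fubini'[symmetric]) (use meas in \<open>simp add: split_beta'\<close>)
  also have "\<dots> = (\<integral>\<^sup>+t. (\<integral>\<^sup>+z. g z \<partial>m) * indicator {0..2*pi} t \<partial>lborel)"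
  proof (rule nn_integral_cong)
    fix t :: real
    have "(\<integral>\<^sup>+z. g (cis t *s z) \<partial>m) = (\<integral>\<^sup>+z. g z \<partial>m)"
    proof -
      have "(\<integral>\<^sup>+z. g z \<partial>distr m borel ((*s) (cis t))) = (\<integral>\<^sup>+z. g (cis t *s z) \<partial>m)"
        by (rule nn_integral_distr[OF ms]) simp
      then show ?thesis by (simp only: inv)
    qed
    moreover have "(\<lambda>z. g (cis t *s z)) \<in> borel_measurable m" using ms[of "cis t"] by (rule measurable_compose) simp
    ultimately show "(\<integral>\<^sup>+z. g (cis t *s z) * indicator {0..2*pi} t \<partial>m) = (\<integral>\<^sup>+z. g z \<partial>m) * indicator {0..2*pi} t"
      by (simp add: nn_integral_multc)
  qed
  also have "\<dots> = ennreal (2 * pi) * (\<integral>\<^sup>+z. g z \<partial>m)" by (simp add: nn_integral_cmult mult.commute)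
  finally show ?thesis .
qed

lemma borel_measurable_on_closed:
  fixes \<phi> :: "'a::topological_space \<Rightarrow> real"
  assumes "closed A" "continuous_on A \<phi>"
  shows "(\<lambda>z. ennreal (\<phi> z) * indicator A z) \<in> borel_measurable borel"
proof -
  have "(\<lambda>z. indicator A z *\<^sub>R \<phi> z) \<in> borel_measurable borel"
    using assms by (intro borel_measurable_continuous_on_indicator) auto
  then have "(\<lambda>z. ennreal (indicator A z *\<^sub>R \<phi> z)) \<in> borel_measurable borel" by measurable
  also have "(\<lambda>z. ennreal (indicator A z *\<^sub>R \<phi> z)) = (\<lambda>z. ennreal (\<phi> z) * indicator A z)"
    by (auto simp: indicator_def fun_eq_iff)
  finally show ?thesis .
qed

lemma continuous_on_dilated_powr:
  fixes f :: "complex ^ 'n \<Rightarrow> complex"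
  assumes f: "continuous_on \<Omega> f" and sub: "\<And>z. z \<in> A \<Longrightarrow> R *\<^sub>R z \<in> \<Omega>" and q: "1 \<le> q"
  shows "continuous_on A (\<lambda>z. cmod (f (R *\<^sub>R z)) powr q)"
  by (intro continuous_on_powr' continuous_on_norm continuous_on_compose2[OF f] continuous_on_scaleR continuous_on_const continuous_on_id)
     (use sub q in auto)

lemma continuous_on_slice:
  fixes f :: "complex ^ 'n \<Rightarrow> complex"
  assumes f: "continuous_on \<Omega> f" and sub: "\<And>l. l \<in> A \<Longrightarrow> l *s \<xi> \<in> \<Omega>"
  shows "continuous_on A (\<lambda>l. f (l *s \<xi>))"
  by (rule continuous_on_compose2[OF f]) (use sub in \<open>auto intro!: continuous_on_vector_scalar_mult continuous_on_id continuous_on_const\<close>)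

text \<open>On each orbit this is the monotonicity of circle means of \<open>|f|\<^sup>q\<close> on the slice; invariance of the measure
  integrates it.\<close>

theorem dilated_level_integral_le:
  fixes p :: "'n::finite \<Rightarrow> nat" and f :: "complex ^ 'n \<Rightarrow> complex"
  assumes p: "\<And>j. 0 < p j" and q: "1 \<le> q" and f: "holomorphic_cn f (ellipsoid p)"
    and r: "r < 0" and \<mu>: "is_demailly_measure c (ellipsoid p) (log_exhaustion p) r \<mu>" and R: "0 \<le> R" "R < 1"
  shows "(\<integral>\<^sup>+z\<in>level (ellipsoid p) (log_exhaustion p) r. ennreal (cmod (f (R *\<^sub>R z)) powr q) \<partial>\<mu>)
     \<le> (\<integral>\<^sup>+z\<in>level (ellipsoid p) (log_exhaustion p) r. ennreal (cmod (f z) powr q) \<partial>\<mu>)"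
proof -
  let ?L = "level (ellipsoid p) (log_exhaustion p) r"
  have s: "sets \<mu> = sets borel" using \<mu> by (simp add: is_demailly_measure_def)
  have fin: "finite_measure \<mu>" by (rule finite_demailly_measure[OF p \<mu> r])
  have inv: "distr \<mu> borel ((*s) (cis t)) = \<mu>" for t by (rule demailly_measure_rotation[OF p r _ \<mu>]) simp
  have fc: "continuous_on (ellipsoid p) f" by (rule holomorphic_cn_continuous_on[OF f])
  have Lc: "closed ?L" using compact_level_log_exhaustion[OF p r] by (rule compact_imp_closed)
  have L: "z \<in> ?L \<longleftrightarrow> ellipsoid_sum p z = exp r" for z by (simp add: level_log_exhaustion[OF r])
  have er: "exp r < 1" using r by simp
  have Ls: "l *s z \<in> ellipsoid p" if "z \<in> ?L" "cmod l \<le> 1" for l z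
    using that er by (intro smult_in_ellipsoid p) (simp add: L)
  define g where "g T z = ennreal (cmod (f (T *\<^sub>R z)) powr q) * indicator ?L z" for T :: real and z
  have gm: "g T \<in> borel_measurable borel" if "0 \<le> T" "T \<le> 1" for T
    unfolding g_def
    by (intro borel_measurable_on_closed[OF Lc] continuous_on_dilated_powr[OF fc _ q])
       (use Ls that in \<open>simp add: scaleR_eq_smult\<close>)
  have slice: "(\<integral>\<^sup>+t. g T (cis t *s z) * indicator {0..2*pi} t \<partial>lborel) =
      ennreal (integral {0..2*pi} (\<lambda>t. cmod (f ((of_real T * cis t) *s z)) powr q))"
    if z: "z \<in> ?L" and T: "0 \<le> T" "T \<le> 1" for z T
  proof -
    have "cis t *s z \<in> ?L" for t using z by (simp add: L ellipsoid_sum_rotation)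
    then have "g T (cis t *s z) = ennreal (cmod (f ((of_real T * cis t) *s z)) powr q)" for t
      by (simp add: g_def scaleR_eq_smult vector_smult_assoc)
    moreover have "continuous_on {0..2*pi} (\<lambda>t. cmod (f ((of_real T * cis t) *s z)) powr q)"
      by (intro continuous_on_powr' continuous_on_norm continuous_on_compose2[OF fc] continuous_on_vector_scalar_mult continuous_intros)
         (use Ls z T q in \<open>auto simp: norm_mult\<close>)
    ultimately show ?thesis by (simp add: nn_integral_Icc_continuous)
  qed
  have "(\<integral>\<^sup>+t. g R (cis t *s z) * indicator {0..2*pi} t \<partial>lborel) \<le> (\<integral>\<^sup>+t. g 1 (cis t *s z) * indicator {0..2*pi} t \<partial>lborel)" for z
  proof (cases "z \<in> ?L")
    case True
    define h where "h l = f (l *s z)" for l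
    have "continuous_on (cball 0 1) h" unfolding h_def
      by (rule continuous_on_slice[OF fc]) (use Ls True in simp)
    moreover have "h holomorphic_on ball 0 1" unfolding h_def
      by (rule holomorphic_slice[OF f open_ball]) (use Ls True in simp)
    ultimately have "integral {0..2*pi} (\<lambda>s. cmod (h (of_real R * cis s)) powr q) \<le> integral {0..2*pi} (\<lambda>t. cmod (h (cis t)) powr q)"
      using q R by (rule circle_mean_powr_mono)
    then show ?thesis using slice[OF True R(1) less_imp_le[OF R(2)]] slice[OF True, of 1]
      by (simp add: h_def ennreal_leI)
  next
    case False
    then have "cis t *s z \<notin> ?L" for t by (simp add: L ellipsoid_sum_rotation)
    then show ?thesis by (simp add: g_def)
  qed
  then have "(\<integral>\<^sup>+z. (\<integral>\<^sup>+t. g R (cis t *s z) * indicator {0..2*pi} t \<partial>lborel) \<partial>\<mu>)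
    \<le> (\<integral>\<^sup>+z. (\<integral>\<^sup>+t. g 1 (cis t *s z) * indicator {0..2*pi} t \<partial>lborel) \<partial>\<mu>)"
    by (rule nn_integral_mono)
  then have "ennreal (2 * pi) * (\<integral>\<^sup>+z. g R z \<partial>\<mu>) \<le> ennreal (2 * pi) * (\<integral>\<^sup>+z. g 1 z \<partial>\<mu>)"
    using R by (simp add: nn_integral_circle_average[OF fin s inv gm])
  then have "(\<integral>\<^sup>+z. g R z \<partial>\<mu>) \<le> (\<integral>\<^sup>+z. g 1 z \<partial>\<mu>)"
    by (subst (asm) ennreal_mult_le_mult_iff) auto
  then show ?thesis by (simp add: g_def)
qed

lemma set_integral_eq_of_null_compl:
  fixes \<phi> :: "complex ^ 'n \<Rightarrow> real"
  assumes s[measurable_cong]: "sets m = sets borel" and A[measurable]: "A \<in> sets borel" and null: "emeasure m (- A) = 0"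
    and \<phi>: "continuous_on UNIV \<phi>"
  shows "(LINT z:A|m. \<phi> z) = (LINT z|m. \<phi> z)"
proof -
  have [measurable]: "\<phi> \<in> borel_measurable borel" using \<phi> by (rule borel_measurable_continuous_onI)
  have "- A \<in> null_sets m" using null A by (simp add: null_sets_def s)
  then have "AE z in m. z \<notin> - A" by (rule AE_not_in)
  then have "AE z in m. indicator A z *\<^sub>R \<phi> z = \<phi> z" by (rule eventually_mono) simp
  then show ?thesis unfolding set_lebesgue_integral_def by (intro integral_cong_AE) auto
qed

section \<open>The boundary measure\<close>

lemma boundary_measure_basics:
  assumes "is_boundary_monge_ampere_measure c (ellipsoid p) (log_exhaustion p) \<mu>u"
  shows "sets \<mu>u = sets borel" "finite_measure \<mu>u" "emeasure \<mu>u (- closure (ellipsoid p)) = 0"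
  using assms by (auto simp: is_boundary_monge_ampere_measure_def)

lemma demailly_null_closure:
  fixes p :: "'n::finite \<Rightarrow> nat"
  assumes "is_demailly_measure c (ellipsoid p) (log_exhaustion p) r \<mu>" "r < 0"
  shows "emeasure \<mu> (- closure (ellipsoid p)) = 0"
proof -
  let ?L = "level (ellipsoid p) (log_exhaustion p) r"
  have "- ?L \<in> sets \<mu>"
    using assms(1) borel_comp[OF borel_level[OF assms(2)]] by (simp add: is_demailly_measure_def)
  moreover have "- closure (ellipsoid p) \<subseteq> - ?L" using closure_subset by (auto simp: level_def)
  ultimately have "emeasure \<mu> (- closure (ellipsoid p)) \<le> emeasure \<mu> (- ?L)" by (intro emeasure_mono)
  then show ?thesis using demailly_measure_null_off_level[OF assms] by simp
qed

text \<open>Invariance passes from the Demailly measures to their weak limit, and continuous functions determine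
  the limit.\<close>

theorem boundary_measure_rotation:
  fixes p :: "'n::finite \<Rightarrow> nat" and \<mu>u :: "(complex ^ 'n) measure"
  assumes p: "\<And>j. 0 < p j"
    and bd: "is_boundary_monge_ampere_measure c (ellipsoid p) (log_exhaustion p) \<mu>u"
    and w: "cmod w = 1"
  shows "distr \<mu>u borel ((*s) w) = \<mu>u"
proof (rule measure_eqI)
  note sets_boundary = boundary_measure_basics(1)[OF bd] and finite_boundary = boundary_measure_basics(2)[OF bd]
    and null_boundary = boundary_measure_basics(3)[OF bd]
  interpret finite_measure \<mu>u by (rule finite_boundary)
  have ms[measurable]: "(*s) w \<in> \<mu>u \<rightarrow>\<^sub>M borel"
    using measurable_rotation unfolding measurable_cong_sets[OF sets_boundary refl] .
  have finD: "finite_measure (distr \<mu>u borel ((*s) w))" by (rule finite_measure_distr) (rule ms)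
  show "sets (distr \<mu>u borel ((*s) w)) = sets \<mu>u" by (simp add: sets_boundary)
  obtain \<mu> where \<mu>: "\<And>r. r < 0 \<Longrightarrow> is_demailly_measure c (ellipsoid p) (log_exhaustion p) r (\<mu> r)"
    and lim: "\<And>\<phi> :: complex ^ 'n \<Rightarrow> real. continuous_on (closure (ellipsoid p)) \<phi> \<Longrightarrow>
           ((\<lambda>r. LINT z:closure (ellipsoid p)|\<mu> r. \<phi> z) \<longlongrightarrow> (LINT z:closure (ellipsoid p)|\<mu>u. \<phi> z)) (at_left 0)"
    using bd unfolding is_boundary_monge_ampere_measure_def by blast
  have cb: "closure (ellipsoid p) \<in> sets borel" by simp
  have lim': "((\<lambda>r. LINT z|\<mu> r. \<phi> z) \<longlongrightarrow> (LINT z|\<mu>u. \<phi> z)) (at_left 0)" if \<phi>: "continuous_on UNIV \<phi>" for \<phi> :: "complex ^ 'n \<Rightarrow> real"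
  proof -
    have "((\<lambda>r. LINT z:closure (ellipsoid p)|\<mu> r. \<phi> z) \<longlongrightarrow> (LINT z|\<mu>u. \<phi> z)) (at_left 0)"
      using lim[OF continuous_on_subset[OF \<phi>]] set_integral_eq_of_null_compl[OF sets_boundary cb null_boundary \<phi>] by simp
    moreover have "\<forall>\<^sub>F r in at_left 0. (LINT z:closure (ellipsoid p)|\<mu> r. \<phi> z) = (LINT z|\<mu> r. \<phi> z)"
    proof -
      have "\<forall>\<^sub>F r in at_left (0::real). r < 0" by (simp add: eventually_at_filter)
      then show ?thesis
      proof eventually_elim
        fix r :: real assume r: "r < 0"
        have "sets (\<mu> r) = sets borel" using \<mu>[OF r] by (simp add: is_demailly_measure_def)
        then show "(LINT z:closure (ellipsoid p)|\<mu> r. \<phi> z) = (LINT z|\<mu> r. \<phi> z)"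
          by (rule set_integral_eq_of_null_compl[OF _ cb demailly_null_closure[OF \<mu>[OF r] r] \<phi>])
      qed
    qed
    ultimately show ?thesis by (rule Lim_transform_eventually)
  qed
  fix A assume "A \<in> sets (distr \<mu>u borel ((*s) w))"
  then have A: "A \<in> sets borel" by simp
  show "emeasure (distr \<mu>u borel ((*s) w)) A = emeasure \<mu>u A"
  proof (rule measure_eq_on_open_of_Cc[OF open_UNIV _ sets_boundary _ _ _ A])
    show "emeasure (distr \<mu>u borel ((*s) w)) K < \<infinity>" for K
      using finite_measure.emeasure_finite[OF finD, of K] by (simp add: less_top)
    show "emeasure \<mu>u K < \<infinity>" for K by (simp add: less_top[symmetric])
    fix \<phi> :: "complex ^ 'n \<Rightarrow> real" assume "(\<lambda>z. complex_of_real (\<phi> z)) \<in> Cc UNIV"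
    then have "continuous_on UNIV (\<lambda>z. Re (complex_of_real (\<phi> z)))"
      unfolding Cc_def by (intro continuous_on_Re) simp
    then have \<phi>: "continuous_on UNIV \<phi>" by simp
    then have [measurable]: "\<phi> \<in> borel_measurable borel" by (rule borel_measurable_continuous_onI)
    have \<phi>w: "continuous_on UNIV (\<lambda>z. \<phi> (w *s z))"
      by (rule continuous_on_compose2[OF \<phi>]) (auto intro!: continuous_on_vector_scalar_mult continuous_on_const continuous_on_id)
    have "\<forall>\<^sub>F r in at_left (0::real). r < 0" by (simp add: eventually_at_filter)
    then have "\<forall>\<^sub>F r in at_left 0. (LINT z|\<mu> r. \<phi> (w *s z)) = (LINT z|\<mu> r. \<phi> z)"
    proof eventually_elim
      fix r :: real assume r: "r < 0"
      have s: "sets (\<mu> r) = sets borel" using \<mu>[OF r] by (simp add: is_demailly_measure_def)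
      have "(*s) w \<in> \<mu> r \<rightarrow>\<^sub>M borel"
        using measurable_rotation unfolding measurable_cong_sets[OF s refl] .
      from integral_distr[OF this, of \<phi>] show "(LINT z|\<mu> r. \<phi> (w *s z)) = (LINT z|\<mu> r. \<phi> z)"
        using demailly_measure_rotation[OF p r w \<mu>[OF r]] by simp
    qed
    from Lim_transform_eventually[OF lim'[OF \<phi>w] this] have "((\<lambda>r. LINT z|\<mu> r. \<phi> z) \<longlongrightarrow> (LINT z|\<mu>u. \<phi> (w *s z))) (at_left 0)" .
    then have "(LINT z|\<mu>u. \<phi> (w *s z)) = (LINT z|\<mu>u. \<phi> z)"
      using lim'[OF \<phi>] by (rule tendsto_unique[rotated]) simp
    then show "(LINT z|distr \<mu>u borel ((*s) w). \<phi> z) = (LINT z|\<mu>u. \<phi> z)"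
      using integral_distr[OF ms, of \<phi>] by simp
  qed auto
qed

text \<open>For \<open>R < 1\<close> the function \<open>|f(R z)|\<^sup>q\<close> is continuous up to the boundary, so its integral against \<open>\<mu>u\<close> is the
  limit of those against the Demailly measures, which the integrals of \<open>|f|\<^sup>q\<close> dominate. Uniqueness identifies the families
  of Demailly measures that occur in the two hypotheses.\<close>

theorem dilated_boundary_integral_bounded:
  fixes p :: "'n::finite \<Rightarrow> nat" and \<mu>u :: "(complex ^ 'n) measure"
  assumes p: "\<And>j. 0 < p j" and q: "1 \<le> q"
    and bd: "is_boundary_monge_ampere_measure c (ellipsoid p) (log_exhaustion p) \<mu>u"
    and f: "f \<in> poletsky_stessin_hardy c (ellipsoid p) (log_exhaustion p) q"
  obtains C where "0 \<le> C" "\<And>R. 0 \<le> R \<Longrightarrow> R < 1 \<Longrightarrow>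
    (\<integral>\<^sup>+z\<in>{z. ellipsoid_sum p z \<le> 1}. ennreal (cmod (f (R *\<^sub>R z)) powr q) \<partial>\<mu>u) \<le> ennreal C"
proof -
  note sets_boundary = boundary_measure_basics(1)[OF bd] and finite_boundary = boundary_measure_basics(2)[OF bd]
    and null_boundary = boundary_measure_basics(3)[OF bd]
  let ?L = "\<lambda>r. level (ellipsoid p) (log_exhaustion p) r" and ?cl = "closure (ellipsoid p)"
  let ?D = "{z. ellipsoid_sum p z \<le> 1}"
  have hol: "holomorphic_cn f (ellipsoid p)" using f by (simp add: poletsky_stessin_hardy_def)
  have fc: "continuous_on (ellipsoid p) f" by (rule holomorphic_cn_continuous_on[OF hol])
  obtain \<mu> where \<mu>: "\<And>r. r < 0 \<Longrightarrow> is_demailly_measure c (ellipsoid p) (log_exhaustion p) r (\<mu> r)"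
    and lim: "\<And>\<phi> :: complex ^ 'n \<Rightarrow> real. continuous_on ?cl \<phi> \<Longrightarrow>
           ((\<lambda>r. LINT z:?cl|\<mu> r. \<phi> z) \<longlongrightarrow> (LINT z:?cl|\<mu>u. \<phi> z)) (at_left 0)"
    using bd unfolding is_boundary_monge_ampere_measure_def by blast
  obtain \<mu>' where \<mu>': "\<And>r. r < 0 \<Longrightarrow> is_demailly_measure c (ellipsoid p) (log_exhaustion p) r (\<mu>' r)"
    and ls: "Limsup (at_left 0) (\<lambda>r. \<integral>\<^sup>+z\<in>?L r. ennreal (cmod (f z) powr q) \<partial>\<mu>' r) < \<infinity>"
    using f unfolding poletsky_stessin_hardy_def by blast
  obtain C' where C': "Limsup (at_left 0) (\<lambda>r. \<integral>\<^sup>+z\<in>?L r. ennreal (cmod (f z) powr q) \<partial>\<mu>' r) < C'" "C' < \<infinity>"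
    using dense[OF ls] by blast
  define C where "C = enn2real C'"
  have CC: "C' = ennreal C" "0 \<le> C" using C'(2) by (auto simp: C_def)
  have neg: "\<forall>\<^sub>F r in at_left (0::real). r < 0" by (simp add: eventually_at_filter)
  have ev: "\<forall>\<^sub>F r in at_left 0. (\<integral>\<^sup>+z\<in>?L r. ennreal (cmod (f z) powr q) \<partial>\<mu> r) \<le> ennreal C"
    using Limsup_lessD[OF C'(1)] neg
  proof eventually_elim
    fix r :: real assume "(\<integral>\<^sup>+z\<in>?L r. ennreal (cmod (f z) powr q) \<partial>\<mu>' r) < C'" "r < 0"
    moreover have "\<mu>' r = \<mu> r" using demailly_measure_unique[OF p \<open>r < 0\<close> \<mu>'[OF \<open>r < 0\<close>] \<mu>[OF \<open>r < 0\<close>]] .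
    ultimately show "(\<integral>\<^sup>+z\<in>?L r. ennreal (cmod (f z) powr q) \<partial>\<mu> r) \<le> ennreal C" using CC by simp
  qed
  have "(\<integral>\<^sup>+z\<in>?D. ennreal (cmod (f (R *\<^sub>R z)) powr q) \<partial>\<mu>u) \<le> ennreal C" if R: "0 \<le> R" "R < 1" for R
  proof -
    define \<phi> where "\<phi> z = cmod (f (R *\<^sub>R z)) powr q" for z
    have RD: "R *\<^sub>R z \<in> ellipsoid p" if "z \<in> ?D" for z
      unfolding scaleR_eq_smult using that R by (intro smult_in_ellipsoid p) simp
    have \<phi>c: "continuous_on ?cl \<phi>" unfolding \<phi>_def
      by (rule continuous_on_dilated_powr[OF fc _ q]) (use RD closure_ellipsoid_subset in blast)
    have le: "\<forall>\<^sub>F r in at_left 0. (LINT z:?cl|\<mu> r. \<phi> z) \<le> C"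
      using ev neg
    proof eventually_elim
      fix r :: real assume b: "(\<integral>\<^sup>+z\<in>?L r. ennreal (cmod (f z) powr q) \<partial>\<mu> r) \<le> ennreal C" and r: "r < 0"
      have s: "sets (\<mu> r) = sets borel" using \<mu>[OF r] by (simp add: is_demailly_measure_def)
      have "- ?L r \<in> null_sets (\<mu> r)"
        using demailly_measure_null_off_level[OF \<mu>[OF r] r] borel_comp[OF borel_level[OF r]]
        by (auto simp: null_sets_def s)
      then have "AE z in \<mu> r. z \<notin> - ?L r" by (rule AE_not_in)
      moreover have "?L r \<subseteq> ?cl" using closure_subset by (auto simp: level_def)
      ultimately have "AE z in \<mu> r. ennreal (indicator ?cl z *\<^sub>R \<phi> z) = ennreal (\<phi> z) * indicator (?L r) z"
        by (elim eventually_mono) (auto simp: indicator_def)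
      then have "(\<integral>\<^sup>+z. ennreal (indicator ?cl z *\<^sub>R \<phi> z) \<partial>\<mu> r) = (\<integral>\<^sup>+z\<in>?L r. ennreal (\<phi> z) \<partial>\<mu> r)"
        by (rule nn_integral_cong_AE)
      also have "\<dots> \<le> (\<integral>\<^sup>+z\<in>?L r. ennreal (cmod (f z) powr q) \<partial>\<mu> r)"
        unfolding \<phi>_def by (rule dilated_level_integral_le[OF p q hol r \<mu>[OF r] R])
      also have "\<dots> \<le> ennreal C" by (rule b)
      finally show "(LINT z:?cl|\<mu> r. \<phi> z) \<le> C"
        unfolding set_lebesgue_integral_def by (rule integral_real_bounded[OF CC(2)])
    qed
    have int_le: "(LINT z:?cl|\<mu>u. \<phi> z) \<le> C"
      by (rule tendsto_upperbound[OF lim[OF \<phi>c] le]) simp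
    interpret finite_measure \<mu>u by (rule finite_boundary)
    have "compact ?D" by (rule compact_ellipsoid_sum_le[OF p]) simp
    then have clc: "compact ?cl"
      using compact_Int_closed[OF _ closed_closure] closure_ellipsoid_subset[of p] by (metis Int_absorb1)
    have "bounded (\<phi> ` ?cl)" using compact_continuous_image[OF \<phi>c clc] by (rule compact_imp_bounded)
    then obtain K where K: "\<And>z. z \<in> ?cl \<Longrightarrow> norm (\<phi> z) \<le> K" unfolding bounded_iff by blast
    have "(\<lambda>z. indicator ?cl z *\<^sub>R \<phi> z) \<in> borel_measurable borel"
      by (rule borel_measurable_continuous_on_indicator[OF _ \<phi>c]) simp
    then have "(\<lambda>z. indicator ?cl z *\<^sub>R \<phi> z) \<in> borel_measurable \<mu>u"
      by (simp add: measurable_cong_sets[OF sets_boundary refl])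
    then have "integrable \<mu>u (\<lambda>z. indicator ?cl z *\<^sub>R \<phi> z)"
      by (intro integrable_const_bound[where B = "\<bar>K\<bar>"]) (use K in \<open>force simp: indicator_def\<close>)+
    then have "(\<integral>\<^sup>+z. ennreal (indicator ?cl z *\<^sub>R \<phi> z) \<partial>\<mu>u) = ennreal (LINT z:?cl|\<mu>u. \<phi> z)"
      unfolding set_lebesgue_integral_def by (rule nn_integral_eq_integral) (simp add: \<phi>_def)
    moreover have "(\<integral>\<^sup>+z\<in>?D. ennreal (cmod (f (R *\<^sub>R z)) powr q) \<partial>\<mu>u) = (\<integral>\<^sup>+z. ennreal (indicator ?cl z *\<^sub>R \<phi> z) \<partial>\<mu>u)"
    proof (rule nn_integral_cong_AE)
      have "- ?cl \<in> null_sets \<mu>u" using null_boundary by (simp add: null_sets_def sets_boundary)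
      then have "AE z in \<mu>u. z \<notin> - ?cl" by (rule AE_not_in)
      then show "AE z in \<mu>u. ennreal (cmod (f (R *\<^sub>R z)) powr q) * indicator ?D z = ennreal (indicator ?cl z *\<^sub>R \<phi> z)"
        by (rule eventually_mono) (use closure_ellipsoid_subset[of p] in \<open>auto simp: indicator_def \<phi>_def\<close>)
    qed
    ultimately show ?thesis using int_le by (simp add: ennreal_leI)
  qed
  then show ?thesis by (rule that[OF CC(2)])
qed

section \<open>Radial limits\<close>

definition radially_convergent :: "('n::finite \<Rightarrow> nat) \<Rightarrow> (complex ^ 'n \<Rightarrow> complex) \<Rightarrow> (complex ^ 'n) set" where
  "radially_convergent p f = {\<xi>. ellipsoid_sum p \<xi> \<le> 1 \<and> (\<exists>l. ((\<lambda>r::real. f (r *\<^sub>R \<xi>)) \<longlongrightarrow> l) (at_left 1))}"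

text \<open>In Cauchy's criterion each condition with fixed tolerance and fixed threshold is closed, because dilated
  functions are continuous up to the boundary.\<close>

lemma borel_radially_convergent:
  fixes p :: "'n::finite \<Rightarrow> nat"
  assumes p: "\<And>j. 0 < p j" and f: "continuous_on (ellipsoid p) f"
  shows "radially_convergent p f \<in> sets borel"
proof -
  let ?D = "{\<xi>. ellipsoid_sum p \<xi> \<le> 1}"
  define J where "J k = {(x, y). 1 - 1 / (real k + 1) < x \<and> x < 1 \<and> 1 - 1 / (real k + 1) < y \<and> y < 1}" for k
  define F where "F n k = ?D \<inter> (\<Inter>(x, y)\<in>J k. {\<xi> \<in> ?D. dist (f (x *\<^sub>R \<xi>)) (f (y *\<^sub>R \<xi>)) \<le> 1 / (real n + 1)})" for n k
  have Jpos: "0 \<le> x" if "1 - 1 / (real k + 1) < x" for x k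
  proof -
    have "1 / (real k + 1) \<le> 1" by simp
    then show ?thesis using that by linarith
  qed
  have fx: "continuous_on ?D (\<lambda>\<xi>. f (x *\<^sub>R \<xi>))" if "0 \<le> x" "x < 1" for x
  proof (rule continuous_on_compose2[OF f])
    show "(\<lambda>\<xi>. x *\<^sub>R \<xi>) ` ?D \<subseteq> ellipsoid p"
      unfolding scaleR_eq_smult using that by (auto intro!: smult_in_ellipsoid p)
  qed (intro continuous_on_scaleR continuous_on_const continuous_on_id)
  have "closed (F n k)" for n k
    unfolding F_def
  proof (intro closed_Int closed_ellipsoid_sum_le closed_INT ballI)
    fix xy assume "xy \<in> J k"
    then obtain x y where xy: "xy = (x, y)" "0 \<le> x" "x < 1" "0 \<le> y" "y < 1" using Jpos by (auto simp: J_def)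
    have "closed {\<xi> \<in> ?D. dist (f (x *\<^sub>R \<xi>)) (f (y *\<^sub>R \<xi>)) \<le> 1 / (real n + 1)}"
      by (intro continuous_on_closed_Collect_le continuous_on_dist fx xy continuous_on_const closed_ellipsoid_sum_le)
    then show "closed (case xy of (x, y) \<Rightarrow> {\<xi> \<in> ?D. dist (f (x *\<^sub>R \<xi>)) (f (y *\<^sub>R \<xi>)) \<le> 1 / (real n + 1)})"
      by (simp add: xy)
  qed
  then have "(\<Inter>n. \<Union>k. F n k) \<in> sets borel"
    by (intro sets.countable_INT' sets.countable_UN' borel_closed) auto
  moreover have "radially_convergent p f = (\<Inter>n. \<Union>k. F n k)"
    unfolding radially_convergent_def ex_tendsto_at_left_iff F_def J_def by (auto simp: INT_iff)
  ultimately show ?thesis by simp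
qed

lemma radial_limit_eq: "((\<lambda>r::real. f (r *\<^sub>R \<xi>)) \<longlongrightarrow> l) (at_left 1) \<Longrightarrow> radial_limit f \<xi> = l"
  unfolding radial_limit_def by (rule tendsto_Lim) simp

text \<open>Where there is no limit, \<open>radial_limit\<close> takes one default value, the same at all points; so
  it is Borel measurable on the whole boundary.\<close>

lemma radial_limit_nonconvergent:
  assumes "\<nexists>l. ((\<lambda>r::real. f (r *\<^sub>R \<xi>)) \<longlongrightarrow> l) (at_left 1)"
  shows "radial_limit f \<xi> = (THE _. False)"
proof -
  have "(\<lambda>l. ((\<lambda>r::real. f (r *\<^sub>R \<xi>)) \<longlongrightarrow> l) (at_left 1)) = (\<lambda>_. False)" using assms by (simp add: fun_eq_iff)
  then show ?thesis unfolding radial_limit_def t2_space_class.Lim_def by simp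
qed

text \<open>Bounded means along a sequence of radii tending to 1 bound all means, so the slice is in \<open>H\<^sup>q\<close>, which
  is contained in \<open>H\<^sup>1\<close> since \<open>y \<le> 1 + y\<^sup>q\<close>.\<close>

theorem slice_radial_limits:
  fixes p :: "'n::finite \<Rightarrow> nat" and f :: "complex ^ 'n \<Rightarrow> complex"
  assumes p: "\<And>j. 0 < p j" and q: "1 \<le> q" and f: "holomorphic_cn f (ellipsoid p)"
    and \<xi>: "ellipsoid_sum p \<xi> \<le> 1" and R: "R \<longlonglongrightarrow> 1" "\<And>k. 0 < R k" "\<And>k. R k < 1"
    and B: "\<And>k. integral {0..2*pi} (\<lambda>t. cmod (f ((of_real (R k) * cis t) *s \<xi>)) powr q) \<le> B"
  shows "AE t in lborel. t \<in> {0..2*pi} \<longrightarrow> cis t *s \<xi> \<in> radially_convergent p f"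
proof -
  have fc: "continuous_on (ellipsoid p) f" by (rule holomorphic_cn_continuous_on[OF f])
  define g where "g l = f (l *s \<xi>)" for l
  have gh: "g holomorphic_on ball 0 1" unfolding g_def
    by (rule holomorphic_slice[OF f open_ball]) (use \<xi> in \<open>auto intro!: smult_in_ellipsoid p\<close>)
  have gc: "continuous_on (ball 0 1) g" using gh by (rule holomorphic_on_imp_continuous_on)
  have g_mean: "integral {0..2*pi} (\<lambda>t. cmod (g (of_real r * cis t))) \<le> 2 * pi + B" if r: "0 \<le> r" "r < 1" for r
  proof -
    obtain k where k: "r < R k"
      using order_tendstoD(1)[OF R(1) r(2)] by (auto simp: eventually_sequentially)
    have ck: "continuous_on (cball 0 1) (\<lambda>z. g (of_real (R k) * z))"
      by (intro continuous_on_compose2[OF gc] continuous_intros)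
         (use R(2,3)[of k] in \<open>auto simp: norm_mult intro!: le_less_trans[OF mult_left_le]\<close>)
    have hk: "(\<lambda>z. g (of_real (R k) * z)) holomorphic_on ball 0 1"
      by (rule holomorphic_on_dilation[OF gh]) (use R(2,3)[of k] in simp)
    have c: "continuous_on {0..2*pi} (\<lambda>t. g (of_real r * cis t))"
      by (intro continuous_on_compose2[OF gc] continuous_intros) (use r in \<open>auto simp: norm_mult\<close>)
    have cq: "continuous_on {0..2*pi} (\<lambda>t. cmod (g (of_real r * cis t)) powr q)"
      by (intro continuous_on_powr' continuous_on_norm c continuous_on_const) (use q in auto)
    have "integral {0..2*pi} (\<lambda>t. cmod (g (of_real r * cis t))) \<le> integral {0..2*pi} (\<lambda>t. 1 + cmod (g (of_real r * cis t)) powr q)"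
    proof (rule integral_le)
      fix t
      have "y \<le> 1 + y powr q" if "0 \<le> y" for y :: real
        using powr_mono[of 1 q y] q that powr_ge_zero[of y q] by (cases "1 \<le> y") (auto simp del: powr_ge_zero)
      then show "cmod (g (of_real r * cis t)) \<le> 1 + cmod (g (of_real r * cis t)) powr q" by simp
    qed (intro integrable_continuous_real continuous_on_add continuous_on_norm c cq continuous_on_const)+
    also have "\<dots> = 2 * pi + integral {0..2*pi} (\<lambda>t. cmod (g (of_real r * cis t)) powr q)"
      using integrable_continuous_real[OF cq] by (subst integral_add) auto
    also have "integral {0..2*pi} (\<lambda>t. cmod (g (of_real r * cis t)) powr q) \<le> B"
    proof -
      have "of_real (R k) * (of_real (r / R k) * cis t) = of_real r * cis t" for t
        using R(2)[of k] by simp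
      then have "integral {0..2*pi} (\<lambda>t. cmod (g (of_real r * cis t)) powr q)
         = integral {0..2*pi} (\<lambda>t. cmod (g (of_real (R k) * (of_real (r / R k) * cis t))) powr q)" by (simp only:)
      also have "\<dots> \<le> integral {0..2*pi} (\<lambda>t. cmod (g (of_real (R k) * cis t)) powr q)"
        by (rule circle_mean_powr_mono[OF ck hk q]) (use r k R(2)[of k] in auto)
      also have "\<dots> \<le> B" using B[of k] by (simp add: g_def)
      finally show ?thesis .
    qed
    finally show ?thesis by simp
  qed
  have "AE t in lborel. t \<in> {0..2*pi} \<longrightarrow> (\<exists>l. ((\<lambda>r. g (of_real r * cis t)) \<longlongrightarrow> l) (at_left 1))"
    by (rule H1_radial_limits[OF gh g_mean])
  then show ?thesis
  proof (rule eventually_mono, intro impI)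
    fix t assume "t \<in> {0..2*pi} \<longrightarrow> (\<exists>l. ((\<lambda>r. g (of_real r * cis t)) \<longlongrightarrow> l) (at_left 1))" "t \<in> {0..2*pi}"
    then have "\<exists>l. ((\<lambda>r. g (of_real r * cis t)) \<longlongrightarrow> l) (at_left 1)" by blast
    then show "cis t *s \<xi> \<in> radially_convergent p f"
      using \<xi> by (simp add: radially_convergent_def g_def scaleR_eq_smult vector_smult_assoc ellipsoid_sum_rotation)
  qed
qed

theorem theorem2p1:
  fixes p :: "'n::finite \<Rightarrow> nat" and q c :: real
    and f :: "complex ^ 'n \<Rightarrow> complex" and \<mu>u :: "(complex ^ 'n) measure"
  assumes "\<And>j. 0 < p j"
    and "0 < c"
    and "1 \<le> q"
    and "is_boundary_monge_ampere_measure c (ellipsoid p) (log_exhaustion p) \<mu>u"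
    and "f \<in> poletsky_stessin_hardy c (ellipsoid p) (log_exhaustion p) q"
  shows "(AE \<xi> in \<mu>u. \<xi> \<in> frontier (ellipsoid p) \<longrightarrow>
            (\<exists>l. ((\<lambda>r::real. f (r *\<^sub>R \<xi>)) \<longlongrightarrow> l) (at_left 1)))
         \<and> in_Lp_on q (frontier (ellipsoid p)) \<mu>u (radial_limit f)"
proof -
  note p = assms(1) and q = assms(3) and bd = assms(4)
  let ?D = "{\<xi>. ellipsoid_sum p \<xi> \<le> 1}" and ?S = "frontier (ellipsoid p)"
  have f: "holomorphic_cn f (ellipsoid p)" using assms(5) by (simp add: poletsky_stessin_hardy_def)
  have fc: "continuous_on (ellipsoid p) f" by (rule holomorphic_cn_continuous_on[OF f])
  note s = boundary_measure_basics(1)[OF bd] and fin = boundary_measure_basics(2)[OF bd]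
  have inv: "distr \<mu>u borel ((*s) (cis t)) = \<mu>u" for t by (rule boundary_measure_rotation[OF p bd]) simp
  obtain C where C: "0 \<le> C" "\<And>R. 0 \<le> R \<Longrightarrow> R < 1 \<Longrightarrow>
    (\<integral>\<^sup>+z\<in>?D. ennreal (cmod (f (R *\<^sub>R z)) powr q) \<partial>\<mu>u) \<le> ennreal C"
    using dilated_boundary_integral_bounded[OF p q bd assms(5)] by blast
  define R where "R k = 1 - inverse (real (Suc (Suc k)))" for k
  have R: "0 < R k" "R k < 1" for k by (auto simp: R_def field_simps)
  have Rlim: "R \<longlonglongrightarrow> 1"
  proof -
    have "(\<lambda>k. 1 - inverse (real (Suc (Suc k)))) \<longlonglongrightarrow> 1 - 0"
      by (intro tendsto_diff tendsto_const LIMSEQ_Suc[OF LIMSEQ_inverse_real_of_nat])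
    then show ?thesis by (simp add: R_def[abs_def])
  qed
  have RD: "l *s z \<in> ellipsoid p" if "z \<in> ?D" "cmod l < 1" for l z
    using that by (intro smult_in_ellipsoid p) simp
  have D: "closed ?D" by (rule closed_ellipsoid_sum_le)
  have SD: "?S \<subseteq> ?D" using closure_ellipsoid_subset[of p] by (auto simp: frontier_def)
  define F where "F k z = ennreal (cmod (f (R k *\<^sub>R z)) powr q) * indicator ?D z" for k z
  have Fm[measurable]: "F k \<in> borel_measurable borel" for k
    unfolding F_def
    by (intro borel_measurable_on_closed[OF D] continuous_on_dilated_powr[OF fc _ q])
       (use RD R[of k] in \<open>simp add: scaleR_eq_smult\<close>)
  have FC: "(\<integral>\<^sup>+z. F k z \<partial>\<mu>u) \<le> ennreal C" for k
    unfolding F_def using C(2)[of "R k"] R[of k] by simp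
  define G where "G k z = (\<integral>\<^sup>+t. F k (cis t *s z) * indicator {0..2*pi} t \<partial>lborel)" for k z
  define H where "H k z = integral {0..2*pi} (\<lambda>t. cmod (f ((of_real (R k) * cis t) *s z)) powr q)" for k z
  have GH: "G k z = ennreal (H k z)" if z: "z \<in> ?D" for k z
  proof -
    have "F k (cis t *s z) = ennreal (cmod (f ((of_real (R k) * cis t) *s z)) powr q)" for t
      using z by (simp add: F_def scaleR_eq_smult vector_smult_assoc ellipsoid_sum_rotation)
    moreover have "continuous_on {0..2*pi} (\<lambda>t. cmod (f ((of_real (R k) * cis t) *s z)) powr q)"
      by (intro continuous_on_powr' continuous_on_norm continuous_on_compose2[OF fc] continuous_on_vector_scalar_mult continuous_intros)
         (use RD z R[of k] q in \<open>auto simp: norm_mult\<close>)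
    ultimately show ?thesis unfolding G_def H_def by (simp add: nn_integral_Icc_continuous)
  qed
  have Gint: "(\<integral>\<^sup>+z. G k z \<partial>\<mu>u) = ennreal (2 * pi) * (\<integral>\<^sup>+z. F k z \<partial>\<mu>u)" for k
    unfolding G_def by (rule nn_integral_circle_average[OF fin s inv Fm])
  have Gm[measurable]: "G k \<in> borel_measurable \<mu>u" for k
  proof -
    have "(\<lambda>(z, t). F k (cis t *s z) * indicator {0..2*pi} t) \<in> borel_measurable (borel \<Otimes>\<^sub>M lborel)"
    proof -
      have "(\<lambda>x. F k ((\<lambda>(z, t). cis t *s z) x) * indicator {0..2*pi} (snd x)) \<in> borel_measurable (borel \<Otimes>\<^sub>M borel)"
        by measurable
      then show ?thesis by (simp add: split_beta' measurable_cong_sets[OF sets_pair_measure_cong[OF refl sets_lborel] refl])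
    qed
    then have "G k \<in> borel_measurable borel"
      unfolding G_def by (rule lborel.borel_measurable_nn_integral[of "\<lambda>z t. F k (cis t *s z) * indicator {0..2*pi} t"])
    then show ?thesis by (simp add: measurable_cong_sets[OF s refl])
  qed
  \<comment> \<open>\<open>G k z\<close> is the integral of \<open>|f|\<^sup>q\<close> over the circle of radius \<open>R k\<close> on the slice through \<open>z\<close>; its lower limit is finite
    almost everywhere.\<close>
  have "(\<integral>\<^sup>+z. liminf (\<lambda>k. G k z) \<partial>\<mu>u) \<le> liminf (\<lambda>k. \<integral>\<^sup>+z. G k z \<partial>\<mu>u)"
    by (rule nn_integral_liminf) (rule Gm)
  also have "\<dots> \<le> liminf (\<lambda>k. ennreal (2 * pi) * ennreal C)"
    unfolding Gint by (intro Liminf_mono always_eventually allI mult_left_mono FC) simp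
  also have "\<dots> < \<infinity>" by (simp add: Liminf_const ennreal_mult_less_top)
  finally have "AE z in \<mu>u. liminf (\<lambda>k. G k z) \<noteq> \<infinity>"
    by (intro nn_integral_PInf_AE) auto
  then have slices: "AE z in \<mu>u. AE t in lborel. t \<in> {0..2*pi} \<longrightarrow> z \<in> ?D \<longrightarrow> cis t *s z \<in> radially_convergent p f"
  proof (rule eventually_mono)
    fix z assume fin: "liminf (\<lambda>k. G k z) \<noteq> \<infinity>"
    show "AE t in lborel. t \<in> {0..2*pi} \<longrightarrow> z \<in> ?D \<longrightarrow> cis t *s z \<in> radially_convergent p f"
    proof (cases "z \<in> ?D")
      case True
      obtain B where B: "liminf (\<lambda>k. G k z) < ennreal B" "0 \<le> B"
      proof -
        obtain b where "liminf (\<lambda>k. G k z) < b" "b < \<infinity>" using fin dense[of "liminf (\<lambda>k. G k z)" \<infinity>] by (auto simp: less_top)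
        then show ?thesis using that[of "enn2real b"] by auto
      qed
      have freq: "\<exists>k\<ge>N. G k z < ennreal B" for N
      proof (rule ccontr)
        assume "\<not> ?thesis"
        then have "\<forall>\<^sub>F k in sequentially. ennreal B \<le> G k z" unfolding eventually_sequentially by (auto simp: not_less)
        then have "ennreal B \<le> liminf (\<lambda>k. G k z)" by (rule Liminf_bounded)
        with B(1) show False by simp
      qed
      obtain \<sigma> where \<sigma>: "\<And>N. \<sigma> N \<ge> N" "\<And>N. G (\<sigma> N) z < ennreal B" using freq by metis
      have "AE t in lborel. t \<in> {0..2*pi} \<longrightarrow> cis t *s z \<in> radially_convergent p f"
      proof (rule slice_radial_limits[OF p q f, where R = "\<lambda>N. R (\<sigma> N)" and B = B])
        show "ellipsoid_sum p z \<le> 1" using True by simp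
        have "filterlim \<sigma> sequentially sequentially" using \<sigma>(1) by (intro filterlim_at_top_mono[OF filterlim_ident]) auto
        then show "(\<lambda>N. R (\<sigma> N)) \<longlonglongrightarrow> 1" by (rule filterlim_compose[OF Rlim])
        show "integral {0..2*pi} (\<lambda>t. cmod (f ((of_real (R (\<sigma> N)) * cis t) *s z)) powr q) \<le> B" for N
          using \<sigma>(2)[of N] B(2) unfolding GH[OF True] by (simp add: H_def ennreal_less_iff not_less_iff_gr_or_eq
              ennreal_less_iff[OF integral_nonneg] less_imp_le) (metis ennreal_leI linorder_not_le order_less_imp_le)
      qed (rule R)+
      then show ?thesis by (rule eventually_mono) blast
    qed simp
  qed
  \<comment> \<open>The exceptional set meets almost every orbit in a set of angles of measure 0, hence is null.\<close>
  define E where "E = ?D - radially_convergent p f"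
  have good: "radially_convergent p f \<in> sets borel" by (rule borel_radially_convergent[OF p fc])
  then have E: "E \<in> sets borel" unfolding E_def using D by auto
  have "(\<integral>\<^sup>+z. (\<integral>\<^sup>+t. indicator E (cis t *s z) * indicator {0..2*pi} t \<partial>lborel) \<partial>\<mu>u) = (\<integral>\<^sup>+z. 0 \<partial>\<mu>u)"
  proof (rule nn_integral_cong_AE)
    show "AE z in \<mu>u. (\<integral>\<^sup>+t. indicator E (cis t *s z) * indicator {0..2*pi} t \<partial>lborel) = 0"
      using slices
    proof (rule eventually_mono)
      fix z assume ae: "AE t in lborel. t \<in> {0..2*pi} \<longrightarrow> z \<in> ?D \<longrightarrow> cis t *s z \<in> radially_convergent p f"
      have "(\<integral>\<^sup>+t. indicator E (cis t *s z) * indicator {0..2*pi} t \<partial>lborel) = (\<integral>\<^sup>+(t::real). 0 \<partial>lborel)"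
      proof (rule nn_integral_cong_AE)
        show "AE t in lborel. indicator E (cis t *s z) * indicator {0..2*pi} t = (0::ennreal)"
          using ae by (rule eventually_mono) (auto simp: E_def indicator_def ellipsoid_sum_rotation)
      qed
      then show "(\<integral>\<^sup>+t. indicator E (cis t *s z) * indicator {0..2*pi} t \<partial>lborel) = 0" by simp
    qed
  qed
  then have "ennreal (2 * pi) * (\<integral>\<^sup>+z. indicator E z \<partial>\<mu>u) = 0"
    by (subst nn_integral_circle_average[OF fin s inv, symmetric]) (use E in auto)
  then have "emeasure \<mu>u E = 0" using E by (simp add: s)
  then have "E \<in> null_sets \<mu>u" using E by (simp add: null_sets_def s)
  then have aeE: "AE z in \<mu>u. z \<notin> E" by (rule AE_not_in)
  then have part1: "AE \<xi> in \<mu>u. \<xi> \<in> ?S \<longrightarrow> (\<exists>l. ((\<lambda>r::real. f (r *\<^sub>R \<xi>)) \<longlongrightarrow> l) (at_left 1))"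
    by (rule eventually_mono) (use SD in \<open>auto simp: E_def radially_convergent_def\<close>)

  have Rleft: "filterlim R (at_left 1) sequentially"
    using Rlim R by (simp add: filterlim_at less_imp_neq)
  have conv: "(\<lambda>k. f (R k *\<^sub>R \<xi>)) \<longlonglongrightarrow> radial_limit f \<xi>" if "\<xi> \<in> radially_convergent p f" for \<xi>
  proof -
    obtain l where l: "((\<lambda>r::real. f (r *\<^sub>R \<xi>)) \<longlongrightarrow> l) (at_left 1)"
      using \<open>\<xi> \<in> radially_convergent p f\<close> by (auto simp: radially_convergent_def)
    show ?thesis using filterlim_compose[OF l Rleft] radial_limit_eq[OF l] by simp
  qed
  define T where "T = ?S \<inter> radially_convergent p f"
  have Tb: "T \<in> sets borel" unfolding T_def using good by auto
  have TD: "T \<subseteq> ?D" using SD by (auto simp: T_def)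
  have lim_meas: "(\<lambda>\<xi>. indicator T \<xi> *\<^sub>R radial_limit f \<xi>) \<in> borel_measurable borel"
  proof (rule borel_measurable_LIMSEQ_metric)
    show "(\<lambda>\<xi>. indicator T \<xi> *\<^sub>R f (R k *\<^sub>R \<xi>)) \<in> borel_measurable borel" for k
    proof -
      have "continuous_on ?D (\<lambda>\<xi>. f (R k *\<^sub>R \<xi>))"
        by (intro continuous_on_compose2[OF fc] continuous_on_scaleR continuous_on_const continuous_on_id)
           (use RD R[of k] in \<open>auto simp: scaleR_eq_smult\<close>)
      then show ?thesis by (intro borel_measurable_continuous_on_indicator[OF Tb] continuous_on_subset[OF _ TD])
    qed
    show "(\<lambda>k. indicator T \<xi> *\<^sub>R f (R k *\<^sub>R \<xi>)) \<longlonglongrightarrow> indicator T \<xi> *\<^sub>R radial_limit f \<xi>" for \<xi>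
      using conv[of \<xi>] by (cases "\<xi> \<in> T") (auto simp: T_def)
  qed
  \<comment> \<open>The default value of \<open>radial_limit\<close> at points without a limit.\<close>
  define c0 :: complex where "c0 = (THE _. False)"
  have "(\<lambda>\<xi>. indicator T \<xi> *\<^sub>R radial_limit f \<xi> + indicator (?S - T) \<xi> *\<^sub>R c0) \<in> borel_measurable borel"
  proof (rule borel_measurable_add[OF lim_meas])
    have "?S - T \<in> sets borel" using Tb by auto
    then show "(\<lambda>\<xi>. indicator (?S - T) \<xi> *\<^sub>R c0) \<in> borel_measurable borel" by measurable
  qed
  also have "(\<lambda>\<xi>. indicator T \<xi> *\<^sub>R radial_limit f \<xi> + indicator (?S - T) \<xi> *\<^sub>R c0) = (\<lambda>\<xi>. indicator ?S \<xi> *\<^sub>R radial_limit f \<xi>)"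
  proof
    fix \<xi>
    have "radial_limit f \<xi> = c0" if "\<xi> \<in> ?S" "\<xi> \<notin> T"
      unfolding c0_def using that SD by (intro radial_limit_nonconvergent) (auto simp: T_def radially_convergent_def)
    then show "indicator T \<xi> *\<^sub>R radial_limit f \<xi> + indicator (?S - T) \<xi> *\<^sub>R c0 = indicator ?S \<xi> *\<^sub>R radial_limit f \<xi>"
      by (auto simp: indicator_def T_def)
  qed
  finally have meas: "set_borel_measurable \<mu>u ?S (radial_limit f)"
    unfolding set_borel_measurable_def by (simp add: measurable_cong_sets[OF s refl])
  have "(\<integral>\<^sup>+\<xi>\<in>?S. ennreal (cmod (radial_limit f \<xi>) powr q) \<partial>\<mu>u) \<le> (\<integral>\<^sup>+\<xi>. liminf (\<lambda>k. F k \<xi>) \<partial>\<mu>u)"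
  proof (rule nn_integral_mono_AE)
    show "AE \<xi> in \<mu>u. ennreal (cmod (radial_limit f \<xi>) powr q) * indicator ?S \<xi> \<le> liminf (\<lambda>k. F k \<xi>)"
      using aeE
    proof (rule eventually_mono)
      fix \<xi> assume \<xi>: "\<xi> \<notin> E"
      show "ennreal (cmod (radial_limit f \<xi>) powr q) * indicator ?S \<xi> \<le> liminf (\<lambda>k. F k \<xi>)"
      proof (cases "\<xi> \<in> ?S")
        case True
        then have g: "\<xi> \<in> radially_convergent p f" "\<xi> \<in> ?D" using \<xi> SD by (auto simp: E_def)
        have "(\<lambda>k. cmod (f (R k *\<^sub>R \<xi>)) powr q) \<longlonglongrightarrow> cmod (radial_limit f \<xi>) powr q"
          by (intro tendsto_powr' tendsto_norm conv[OF g(1)] tendsto_const) (use q in auto)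
        then have "(\<lambda>k. F k \<xi>) \<longlonglongrightarrow> ennreal (cmod (radial_limit f \<xi>) powr q)"
          unfolding F_def using g(2) by (simp add: tendsto_ennrealI)
        then have "liminf (\<lambda>k. F k \<xi>) = ennreal (cmod (radial_limit f \<xi>) powr q)"
          by (intro lim_imp_Liminf) auto
        then show ?thesis using True by simp
      qed simp
    qed
  qed
  also have "\<dots> \<le> liminf (\<lambda>k. \<integral>\<^sup>+\<xi>. F k \<xi> \<partial>\<mu>u)"
    by (rule nn_integral_liminf) (simp add: measurable_cong_sets[OF s refl])
  also have "\<dots> \<le> liminf (\<lambda>k. ennreal C)"
    by (intro Liminf_mono always_eventually allI FC)
  also have "\<dots> < \<infinity>" by (simp add: Liminf_const)
  finally have "(\<integral>\<^sup>+\<xi>\<in>?S. ennreal (cmod (radial_limit f \<xi>) powr q) \<partial>\<mu>u) < \<infinity>" .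
  with part1 meas show ?thesis unfolding in_Lp_on_def by blast
qed

end
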